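(* For any positive integer $n$, $$\sum_{M}x^{a(M)}y^{c(M)} = \sum_{M}x^{c(M)}y^{a(M)},$$ where both sums are over all bicubic maps $M$ on $n$ vertices, $a(M)$ is the number of $1$-colored faces of $M$ that touch the root face $R_3$, and $c(M)$ is the number of $3$-colored faces of $M$ that touch the face $R_2$. In other words, the two pairs of statistics $(a,c)$ and $(c,a)$ are jointly equidistributed on bicubic maps with $n$ vertices.
   Context: A planar map is a connected graph (multiple edges allowed) embedded in the sphere with no edge-crossings, considered up to continuous deformations. Maps are rooted: a directed edge is distinguished as the root edge. The face to the right of the root edge, when following its orientation, is the root face, and the vertex from which the root edge stems is the root vertex. A planar map is cubic if every vertex has degree 3, and bicubic if in addition it is bipartite, i.e. its vertices can be colored black and white so that adjacent vertices have different colors. The faces of a bicubic map can be colored with colors $1,2,3$ so that adjacent faces have distinct colors and the colors $1,2,3$ appear in counterclockwise order around white vertices; by convention the root vertex is black and the root face has color $3$ (this fixes the colorings). $R_1,R_2,R_3$ denote the three faces around the root vertex, where $R_i$ has color $i$; in particular $R_3$ is the root face. Two faces touch if there is an edge belonging to the boundaries of both. *)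

theory Defs
  imports Main "HOL-Library.FuncSet" "HOL-Combinatorics.Orbits"
begin

text \<open>
  Rooted maps on oriented surfaces are encoded by darts (half-edges, i.e. directed edges leaving
  their origin vertex): \<open>ccw d\<close> is the next dart counterclockwise around the origin of \<open>d\<close>, and
  \<open>opp d\<close> is the same edge with the opposite direction.  The root is a directed edge, i.e. a dart.
  Deformation classes of connected maps on the sphere are exactly the isomorphism classes of
  transitive such structures with Euler characteristic 2.
\<close>

record 'd rooted_map =
  darts :: "'d set"
  ccw :: "'d \<Rightarrow> 'd"
  opp :: "'d \<Rightarrow> 'd"
  root_dart :: 'd

text \<open>
  Vertices, edges and faces are identified with their sets of darts.  Walking along \<open>d\<close> with a face
  on the right, the next dart on the boundary of that face is \<open>ccw (opp d)\<close>; so \<open>face M d\<close> is the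
  face to the right of \<open>d\<close>, and the darts of a face are those having it on their right.
\<close>

definition vertex :: "'d rooted_map \<Rightarrow> 'd \<Rightarrow> 'd set" where
  "vertex M d = orbit (ccw M) d"

definition edge :: "'d rooted_map \<Rightarrow> 'd \<Rightarrow> 'd set" where
  "edge M d = {d, opp M d}"

definition face :: "'d rooted_map \<Rightarrow> 'd \<Rightarrow> 'd set" where
  "face M d = orbit (ccw M \<circ> opp M) d"

definition vertices :: "'d rooted_map \<Rightarrow> 'd set set" where
  "vertices M = vertex M ` darts M"

definition edges :: "'d rooted_map \<Rightarrow> 'd set set" where
  "edges M = edge M ` darts M"

definition faces :: "'d rooted_map \<Rightarrow> 'd set set" where
  "faces M = face M ` darts M"

definition root_vertex :: "'d rooted_map \<Rightarrow> 'd set" where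
  "root_vertex M = vertex M (root_dart M)"

definition root_face :: "'d rooted_map \<Rightarrow> 'd set" where
  "root_face M = face M (root_dart M)"

definition wf_map :: "'d rooted_map \<Rightarrow> bool" where
  "wf_map M \<longleftrightarrow> finite (darts M) \<and> root_dart M \<in> darts M \<and>
     ccw M permutes darts M \<and> opp M permutes darts M \<and>
     (\<forall>d\<in>darts M. opp M d \<noteq> d \<and> opp M (opp M d) = d)"

definition connected_map :: "'d rooted_map \<Rightarrow> bool" where
  "connected_map M \<longleftrightarrow>
     (\<forall>d\<in>darts M. \<forall>e\<in>darts M. (d, e) \<in> {(d, e). e = ccw M d \<or> e = opp M d}\<^sup>*)"

definition planar_map :: "'d rooted_map \<Rightarrow> bool" where
  "planar_map M \<longleftrightarrow> wf_map M \<and> connected_map M \<and>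
     int (card (vertices M)) - int (card (edges M)) + int (card (faces M)) = 2"

definition cubic :: "'d rooted_map \<Rightarrow> bool" where
  "cubic M \<longleftrightarrow> (\<forall>v\<in>vertices M. card v = 3)"

text \<open>\<open>B\<close> is the set of black vertices of a proper black/white colouring.\<close>

definition bicolouring :: "'d rooted_map \<Rightarrow> 'd set set \<Rightarrow> bool" where
  "bicolouring M B \<longleftrightarrow> B \<subseteq> vertices M \<and>
     (\<forall>d\<in>darts M. vertex M d \<in> B \<longleftrightarrow> vertex M (opp M d) \<notin> B)"

definition bipartite :: "'d rooted_map \<Rightarrow> bool" where
  "bipartite M \<longleftrightarrow> (\<exists>B. bicolouring M B)"

definition bicubic_map :: "'d rooted_map \<Rightarrow> bool" where
  "bicubic_map M \<longleftrightarrow> planar_map M \<and> cubic M \<and> bipartite M"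

definition black_vertices :: "'d rooted_map \<Rightarrow> 'd set set" where
  "black_vertices M = (THE B. bicolouring M B \<and> root_vertex M \<in> B)"

definition white_vertices :: "'d rooted_map \<Rightarrow> 'd set set" where
  "white_vertices M = vertices M - black_vertices M"

text \<open>An edge belongs to the boundary of the faces on its two sides.\<close>

definition touch :: "'d rooted_map \<Rightarrow> 'd set \<Rightarrow> 'd set \<Rightarrow> bool" where
  "touch M f g \<longleftrightarrow> (\<exists>e\<in>edges M. e \<inter> f \<noteq> {} \<and> e \<inter> g \<noteq> {})"

text \<open>
  Around a vertex, \<open>face M d\<close> occupies the corner immediately clockwise of \<open>d\<close>, so the faces of
  \<open>d\<close>, \<open>ccw M d\<close>, \<open>ccw M (ccw M d)\<close> follow each other counterclockwise; \<open>k mod 3 + 1\<close> is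
  the cyclic successor of the colour \<open>k\<close>.
\<close>

definition face_colouring :: "'d rooted_map \<Rightarrow> ('d set \<Rightarrow> nat) \<Rightarrow> bool" where
  "face_colouring M k \<longleftrightarrow> k \<in> faces M \<rightarrow>\<^sub>E {1, 2, 3} \<and>
     (\<forall>f\<in>faces M. \<forall>g\<in>faces M. f \<noteq> g \<and> touch M f g \<longrightarrow> k f \<noteq> k g) \<and>
     (\<forall>d\<in>darts M. vertex M d \<in> white_vertices M \<longrightarrow>
        k (face M (ccw M d)) = k (face M d) mod 3 + 1) \<and>
     k (root_face M) = 3"

definition face_colour :: "'d rooted_map \<Rightarrow> 'd set \<Rightarrow> nat" where
  "face_colour M = (THE k. face_colouring M k)"

definition face_at_root :: "'d rooted_map \<Rightarrow> nat \<Rightarrow> 'd set" where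
  "face_at_root M i =
     (THE f. f \<in> faces M \<and> f \<inter> root_vertex M \<noteq> {} \<and> face_colour M f = i)"

definition a_stat :: "'d rooted_map \<Rightarrow> nat" where
  "a_stat M = card {f \<in> faces M. face_colour M f = 1 \<and> touch M f (face_at_root M 3)}"

definition c_stat :: "'d rooted_map \<Rightarrow> nat" where
  "c_stat M = card {f \<in> faces M. face_colour M f = 3 \<and> touch M f (face_at_root M 2)}"

text \<open>
  Maps up to deformation: classes of maps with darts in \<open>nat\<close> under root- and
  orientation-preserving relabelling.  Every finite map has such a representative.
\<close>

definition map_iso :: "'d rooted_map \<Rightarrow> 'e rooted_map \<Rightarrow> bool" where
  "map_iso M N \<longleftrightarrow> (\<exists>h. bij_betw h (darts M) (darts N) \<and>
     (\<forall>d\<in>darts M. h (ccw M d) = ccw N (h d) \<and> h (opp M d) = opp N (h d)) \<and>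
     h (root_dart M) = root_dart N)"

definition labelled_bicubic_maps :: "nat \<Rightarrow> nat rooted_map set" where
  "labelled_bicubic_maps n = {M. bicubic_map M \<and> card (vertices M) = n}"

definition bicubic_maps :: "nat \<Rightarrow> nat rooted_map set set" where
  "bicubic_maps n = labelled_bicubic_maps n //
     {(M, N). M \<in> labelled_bicubic_maps n \<and> N \<in> labelled_bicubic_maps n \<and> map_iso M N}"

text \<open>The statistics are isomorphism invariant, hence constant on each class.\<close>

definition a_num :: "nat rooted_map set \<Rightarrow> nat" where
  "a_num X = the_elem (a_stat ` X)"

definition c_num :: "nat rooted_map set \<Rightarrow> nat" where
  "c_num X = the_elem (c_stat ` X)"

end

theory Submission
  imports Defs "HOL-Combinatorics.Permutations" "HOL-Computational_Algebra.Formal_Power_Series"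
begin

text \<open>
  A bicubic map is the same as a rooted transitive pair of permutations \<open>p\<close>, \<open>q\<close> of its black vertices
  such that the cycles of \<open>p\<close>, \<open>q\<close> and \<open>p \<circ> q\<close> (the faces of colour 3, 2 and 1) satisfy Euler's formula.
  Rooted structures have no automorphisms, so labelled ones may be counted instead, with exponential
  generating function \<open>F(x, y)\<close>, where \<open>x\<close> and \<open>y\<close> mark the two statistics and \<open>T\<close> the size.

  Cutting at the first return of the face \<open>R\<^sub>3\<close> to the face \<open>R\<^sub>1\<close> and then removing the root gives
  \<open>(x - 1) F(x, y) = T (x + F(x, 1)) ((x - 1) y + (x - 1 + y) F(x, y) - y F(1, y))\<close>. Turning the root around
  its vertex gives \<open>F(1, y) = F(y, 1)\<close>. Eliminating \<open>T\<close> between this equation and its special case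
  \<open>y = 1\<close> expresses \<open>F(x, y)\<close> rationally in \<open>F(x, 1)\<close>, \<open>F(y, 1)\<close> and \<open>F(1, 1)\<close>; the equations
  for \<open>F(x, 1)\<close> and \<open>F(y, 1)\<close>, with \<open>T\<close> eliminated, state precisely that this expression is symmetric.

  Both the decomposition and the existence of the face colouring rest on the genus inequality for
  transitive pairs of permutations.
\<close>

section \<open>Cycles of permutations\<close>

text \<open>The decomposition treats the two statistics quite differently, so no bijection
  exchanging them is built; the symmetry becomes visible only after the elimination. The cut at the
  first return is what makes the root removable: once the faces of colours 3 and 1 at the root meet
  nowhere else, detaching the root leaves a hypermap with a marked corner, and the exponent of x
  records how many faces of colour 1 precede that corner. Summing over the corners is a geometric
  sum, the origin of the factor x - 1 and of the term F(1, y). The equation is therefore exploited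
  for real x, y > 1, and infinitely many values recover the coefficients.

  On permutations every cut or join is multiplication by a transposition, which merges two cycles or
  splits one according to whether its two points share a cycle. The genus inequality acts as a
  combinatorial Jordan curve theorem: a cut that would raise the Euler characteristic above 2 must
  disconnect the hypermap. For the colouring the same bound shows that a threefold cover is
  disconnected.\<close>

lemma orbit_self:
  assumes "f permutes S" "finite S" shows "x \<in> orbit f x"
  using assms permutation_permutes permutation_self_in_orbit by metis

lemma orbit_eq:
  assumes "f permutes S" "finite S" "y \<in> orbit f x" shows "orbit f y = orbit f x"
  using cyclic_on_orbit[OF assms(1,2)] assms(3) orbit_cyclic_eq3 by metis

lemma orbit_eq_iff:
  assumes "f permutes S" "finite S" shows "orbit f y = orbit f x \<longleftrightarrow> y \<in> orbit f x"
  using orbit_eq[OF assms] orbit_self[OF assms] by metis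

lemma orbit_involution:
  assumes "f (f x) = x" shows "orbit f x = {x, f x}"
proof -
  have "orbit f x = {(f ^^ m) x | m. m < 2}"
    by (rule orbit_altdef_bounded) (simp_all add: numeral_2_eq_2 assms)
  also have "\<dots> = (\<lambda>m. (f ^^ m) x) ` {..<2}" by blast
  also have "{..<2::nat} = {0, 1}" by auto
  finally show ?thesis by simp
qed

lemma orbit_period_3:
  assumes "f (f (f x)) = x" shows "orbit f x = {x, f x, f (f x)}"
proof -
  have "orbit f x = {(f ^^ m) x | m. m < 3}"
    by (rule orbit_altdef_bounded) (simp_all add: numeral_3_eq_3 assms)
  also have "\<dots> = (\<lambda>m. (f ^^ m) x) ` {..<3}" by blast
  also have "{..<3::nat} = {0, 1, 2}" by auto
  finally show ?thesis by (simp add: numeral_2_eq_2)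
qed

lemma orbit_least:
  assumes "x \<in> A" "f ` A \<subseteq> A" shows "orbit f x \<subseteq> A"
proof
  fix y assume "y \<in> orbit f x" then show "y \<in> A" using assms by induct auto
qed

lemma orbit_closed: "f ` orbit f x \<subseteq> orbit f x"
  by (auto intro: orbit.step)

section \<open>Merging and splitting cycles by a transposition\<close>

lemma transpose_comp_permutes:
  assumes "f permutes S" "a \<in> S" "b \<in> S" shows "transpose a b \<circ> f permutes S"
  using assms permutes_compose permutes_swap_id by metis

lemma transpose_comp_cancel: "transpose a b \<circ> (transpose a b \<circ> f) = f"
  by (simp add: fun_eq_iff)

text \<open>Fixed points inside the carrier count as cycles of length one.\<close>

definition ncyc :: "'a set \<Rightarrow> ('a \<Rightarrow> 'a) \<Rightarrow> nat" where
  "ncyc S f = card (orbit f ` S)"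

text \<open>Composing on the left with the transposition changes only values in
  \<open>{a, b}\<close>, so the walk from \<open>a\<close> follows \<open>f\<close> until it first
  lands on one of them.\<close>

lemma funpow_transpose_comp:
  assumes "\<And>i. 0 < i \<Longrightarrow> i < k \<Longrightarrow> (f ^^ i) a \<noteq> a \<and> (f ^^ i) a \<noteq> b"
  shows "i < k \<Longrightarrow> ((transpose a b \<circ> f) ^^ i) a = (f ^^ i) a"
proof (induction i)
  case (Suc i)
  then show ?case using assms[of "Suc i"] by (simp add: transpose_apply_other)
qed simp

lemma funpow_transpose_comp_last:
  assumes "\<And>i. 0 < i \<Longrightarrow> i < k \<Longrightarrow> (f ^^ i) a \<noteq> a \<and> (f ^^ i) a \<noteq> b" "0 < k"
  shows "((transpose a b \<circ> f) ^^ k) a = transpose a b ((f ^^ k) a)"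
proof -
  obtain j where "k = Suc j" using assms(2) by (cases k) auto
  then show ?thesis using funpow_transpose_comp[where f=f and k=k and i=j, OF assms(1)] by simp
qed

text \<open>On landing at \<open>b\<close> the walk is sent back to \<open>a\<close>, so the arc
  from \<open>a\<close> up to the point before \<open>b\<close> closes into a cycle of its
  own.\<close>

lemma orbit_transpose_segment:
  assumes "\<And>i. 0 < i \<Longrightarrow> i < k \<Longrightarrow> (f ^^ i) a \<noteq> a \<and> (f ^^ i) a \<noteq> b" "0 < k" "(f ^^ k) a = b"
  shows "orbit (transpose a b \<circ> f) a = {(f ^^ i) a | i. i < k}"
proof -
  have "((transpose a b \<circ> f) ^^ k) a = a"
    using funpow_transpose_comp_last[OF assms(1,2)] assms(3) by simp
  from orbit_altdef_bounded[OF this assms(2)] show ?thesis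
    using funpow_transpose_comp[where f=f and k=k, OF assms(1)] by auto metis
qed

text \<open>After a return to \<open>a\<close> at time \<open>i\<close> the walk would repeat
  itself, and \<open>b\<close> would already have been hit \<open>i\<close> steps before its first
  hit. The case \<open>b = a\<close> is included and describes one full turn.\<close>

lemma first_hit_avoids:
  assumes "b \<in> orbit f a" "0 < i" "i < funpow_dist1 f a b"
  shows "(f ^^ i) a \<noteq> a \<and> (f ^^ i) a \<noteq> b"
proof
  show "(f ^^ i) a \<noteq> b" using funpow_dist1_least assms by metis
  show "(f ^^ i) a \<noteq> a"
  proof
    assume "(f ^^ i) a = a"
    then have "(f ^^ (funpow_dist1 f a b - i)) a = (f ^^ (funpow_dist1 f a b - i)) ((f ^^ i) a)" by simp
    also have "\<dots> = (f ^^ (funpow_dist1 f a b)) a"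
      using assms(3) by (simp only: funpow_add[symmetric] o_apply[symmetric, of "f ^^ _"]) (simp del: funpow.simps)
    also have "\<dots> = b" using funpow_dist1_prop assms(1) by metis
    finally show False using funpow_dist1_least[of "funpow_dist1 f a b - i" f a b] assms(2,3) by simp
  qed
qed

lemma split_notin:
  assumes "b \<in> orbit f a" "a \<noteq> b"
  shows "b \<notin> orbit (transpose a b \<circ> f) a"
proof -
  let ?k = "funpow_dist1 f a b"
  have "orbit (transpose a b \<circ> f) a = {(f ^^ i) a | i. i < ?k}"
    using orbit_transpose_segment[OF first_hit_avoids[OF assms(1)]] funpow_dist1_prop[OF assms(1)] by blast
  moreover have "(f ^^ i) a \<noteq> b" if "i < ?k" for i
    using first_hit_avoids[OF assms(1), of i] that assms(2) by (cases "i = 0") auto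
  ultimately show ?thesis by auto
qed

context
  fixes S :: "'a set" and f :: "'a \<Rightarrow> 'a" and a b :: 'a
  assumes f: "f permutes S" and fin: "finite S" and ab: "a \<in> S" "b \<in> S" and nb: "b \<notin> orbit f a"
begin

lemma merge_reach: "orbit f a \<subseteq> orbit (transpose a b \<circ> f) a" "b \<in> orbit (transpose a b \<circ> f) a"
proof -
  let ?g = "transpose a b \<circ> f"
  have aa: "a \<in> orbit f a" using orbit_self[OF f fin] .
  have g: "?g permutes S" using f ab by (rule transpose_comp_permutes)
  obtain k where k: "k > 0" "(f ^^ k) a = a" "orbit f a = (\<lambda>n. (f ^^ n) a) ` {0..<k}"
    and av: "\<And>i. 0 < i \<Longrightarrow> i < k \<Longrightarrow> (f ^^ i) a \<noteq> a \<and> (f ^^ i) a \<noteq> b"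
  proof
    show "funpow_dist1 f a a > 0" by simp
    show "(f ^^ funpow_dist1 f a a) a = a" using funpow_dist1_prop[OF aa] .
    show "orbit f a = (\<lambda>n. (f ^^ n) a) ` {0..<funpow_dist1 f a a}" using orbit_conv_funpow_dist1[OF aa] .
    show "(f ^^ i) a \<noteq> a \<and> (f ^^ i) a \<noteq> b" if "0 < i" "i < funpow_dist1 f a a" for i
      using first_hit_avoids[OF aa that] nb aa funpow_in_orbit by metis
  qed
  \<comment> \<open>After a full turn of the \<open>f\<close>-cycle the return to \<open>a\<close>
    is redirected to \<open>b\<close>.\<close>
  have "(?g ^^ k) a = b"
    using funpow_transpose_comp_last[of k f a b] av k by simp
  then show "b \<in> orbit ?g a" unfolding orbit_altdef using k(1) by (intro CollectI exI[of _ k]) simp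
  show "orbit f a \<subseteq> orbit ?g a"
  proof
    fix x assume "x \<in> orbit f a"
    then have "x \<in> (\<lambda>n. (f ^^ n) a) ` {0..<k}" by (rule subst[OF k(3)])
    then obtain i where i: "i < k" "x = (f ^^ i) a" by (auto simp del: funpow.simps)
    have "(?g ^^ i) a = (f ^^ i) a" by (rule funpow_transpose_comp[OF av i(1)])
    with i(2) have "x = (?g ^^ i) a" by (rule trans[OF _ sym])
    then show "x \<in> orbit ?g a" using funpow_in_orbit[OF orbit_self[OF g fin]] by metis
  qed
qed

end

lemma merge_orbit:
  assumes f: "f permutes S" and fin: "finite S" and ab: "a \<in> S" "b \<in> S" and nb: "b \<notin> orbit f a"
  shows "orbit (transpose a b \<circ> f) a = orbit f a \<union> orbit f b"
proof -
  let ?g = "transpose a b \<circ> f"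
  have g: "?g permutes S" using f ab(1,2) by (rule transpose_comp_permutes)
  have na: "a \<notin> orbit f b" using nb orbit_eq_iff[OF f fin] by metis
  have b: "b \<in> orbit ?g a" using merge_reach[OF f fin ab nb] by simp
  have "orbit f b \<subseteq> orbit ?g b"
    using merge_reach(1)[OF f fin ab(2,1) na] by (simp add: transpose_commute)
  then have 1: "orbit f a \<union> orbit f b \<subseteq> orbit ?g a"
    using merge_reach[OF f fin ab nb] orbit_eq[OF g fin b] by auto
  have "?g ` (orbit f a \<union> orbit f b) \<subseteq> orbit f a \<union> orbit f b"
  proof
    fix y assume "y \<in> ?g ` (orbit f a \<union> orbit f b)"
    then obtain x where x: "x \<in> orbit f a \<union> orbit f b" "y = transpose a b (f x)" by auto
    then have "f x \<in> orbit f a \<union> orbit f b" by (auto intro: orbit.step)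
    then show "y \<in> orbit f a \<union> orbit f b"
      using x(2) orbit_self[OF f fin] by (cases "f x = a"; cases "f x = b") auto
  qed
  then have "orbit ?g a \<subseteq> orbit f a \<union> orbit f b"
    by (intro orbit_least) (use orbit_self[OF f fin] in auto)
  with 1 show ?thesis by blast
qed

lemma orbit_transpose_other:
  assumes "x \<in> orbit f x" "a \<notin> orbit f x" "b \<notin> orbit f x"
  shows "orbit (transpose a b \<circ> f) x = orbit f x"
proof (rule orbit_cong)
  fix s assume "s \<in> orbit f x"
  then have "f s \<noteq> a" "f s \<noteq> b" using assms(2,3) orbit.step by metis+
  then show "(transpose a b \<circ> f) s = f s" by (simp add: transpose_apply_other)
qed fact

text \<open>A rewrite rule for all cycles at once: those avoiding \<open>a\<close> and
  \<open>b\<close> are untouched.\<close>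

lemma merge_orbit_cases:
  assumes f: "f permutes S" and fin: "finite S" and ab: "a \<in> S" "b \<in> S" and nb: "b \<notin> orbit f a"
  shows "orbit (transpose a b \<circ> f) x =
    (if x \<in> orbit f a \<union> orbit f b then orbit f a \<union> orbit f b else orbit f x)"
proof (cases "x \<in> orbit f a \<union> orbit f b")
  case True
  have "x \<in> orbit (transpose a b \<circ> f) a" using merge_orbit[OF assms] True by simp
  from orbit_eq[OF transpose_comp_permutes[OF f ab] fin this] show ?thesis
    using merge_orbit[OF assms] True by simp
next
  case False
  then have "a \<notin> orbit f x" "b \<notin> orbit f x" using orbit_eq_iff[OF f fin] orbit_self[OF f fin] by blast+
  then show ?thesis using orbit_transpose_other orbit_self[OF f fin] False by metis
qed

lemma ncyc_merge:
  assumes f: "f permutes S" and fin: "finite S" and ab: "a \<in> S" "b \<in> S" and nb: "b \<notin> orbit f a"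
  shows "Suc (ncyc S (transpose a b \<circ> f)) = ncyc S f"
proof -
  let ?g = "transpose a b \<circ> f"
  let ?A = "orbit f a" and ?B = "orbit f b"
  note c = merge_orbit_cases[OF assms]
  have AB: "?A \<noteq> ?B" using nb orbit_self[OF f fin] by metis
  have neq: "orbit f x \<noteq> ?A \<union> ?B" for x
  proof
    assume e: "orbit f x = ?A \<union> ?B"
    then have "a \<in> orbit f x" "b \<in> orbit f x" using orbit_self[OF f fin] by auto
    then show False using orbit_eq[OF f fin] AB by metis
  qed
  have "orbit ?g ` S = insert (?A \<union> ?B) (orbit f ` S - {?A, ?B})"
  proof (rule set_eqI, rule iffI)
    fix X assume "X \<in> orbit ?g ` S"
    then obtain x where x: "x \<in> S" "X = orbit ?g x" by auto
    show "X \<in> insert (?A \<union> ?B) (orbit f ` S - {?A, ?B})"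
    proof (cases "x \<in> ?A \<union> ?B")
      case False
      then have "orbit f x \<noteq> ?A" "orbit f x \<noteq> ?B" using orbit_self[OF f fin] by blast+
      then show ?thesis using x c[of x] False by auto
    qed (use x c in auto)
  next
    fix X assume X: "X \<in> insert (?A \<union> ?B) (orbit f ` S - {?A, ?B})"
    show "X \<in> orbit ?g ` S"
    proof (cases "X = ?A \<union> ?B")
      case True then show ?thesis using merge_orbit[OF assms] ab by blast
    next
      case False
      then obtain x where x: "x \<in> S" "X = orbit f x" "X \<noteq> ?A" "X \<noteq> ?B" using X by auto
      then have "x \<notin> ?A \<union> ?B" using orbit_eq[OF f fin] by blast
      then show ?thesis using x c[of x] by auto
    qed
  qed
  moreover have "?A \<union> ?B \<notin> orbit f ` S - {?A, ?B}" using neq by auto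
  ultimately have "ncyc S ?g = Suc (card (orbit f ` S - {?A, ?B}))"
    using fin by (simp add: ncyc_def)
  moreover have "card (orbit f ` S - {?A, ?B}) + 2 = card (orbit f ` S)"
  proof -
    have "{?A, ?B} \<subseteq> orbit f ` S" "card {?A, ?B} = 2" using ab AB by auto
    then show ?thesis using card_Diff_subset[of "{?A,?B}" "orbit f ` S"] card_mono[of "orbit f ` S" "{?A,?B}"] fin by simp
  qed
  ultimately show ?thesis by (simp add: ncyc_def)
qed

text \<open>Transpositions are involutions, and after the split \<open>b\<close> no longer lies in
  the cycle of \<open>a\<close>, so this is the merging count read backwards.\<close>

lemma ncyc_split:
  assumes f: "f permutes S" and fin: "finite S" and ab: "a \<in> S" "b \<in> S" "a \<noteq> b" and nb: "b \<in> orbit f a"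
  shows "ncyc S (transpose a b \<circ> f) = Suc (ncyc S f)"
  using ncyc_merge[OF transpose_comp_permutes[OF f ab(1,2)] fin ab(1,2) split_notin[OF nb ab(3)]]
  unfolding transpose_comp_cancel by (rule sym)

section \<open>Connected pairs of permutations and the genus inequality\<close>

text \<open>On a finite set an injective map of \<open>A\<close> into itself is onto
  \<open>A\<close>, so nothing from outside can enter \<open>A\<close>.\<close>

lemma closed_Diff:
  assumes "f permutes E" "finite E" "A \<subseteq> B" "B \<subseteq> E" "f ` A \<subseteq> A" "f ` B \<subseteq> B"
  shows "f ` (B - A) \<subseteq> B - A"
proof -
  have "inj f" using assms(1) by (rule permutes_inj)
  moreover have "finite A" by (rule finite_subset[OF subset_trans[OF assms(3,4)] assms(2)])
  ultimately have "f ` A = A" using assms(5) endo_inj_surj inj_on_subset by (metis subset_UNIV)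
  then show ?thesis using \<open>inj f\<close> assms(6) by (auto simp: inj_def)
qed

lemma perm_restrict_permutes:
  assumes "f permutes E" "finite E" "A \<subseteq> E" "f ` A \<subseteq> A"
  shows "perm_restrict f A permutes A"
proof (rule bij_imp_permutes)
  have "inj_on f A" using permutes_inj[OF assms(1)] inj_on_subset by blast
  moreover have "finite A" using assms finite_subset by blast
  ultimately have "f ` A = A" using assms(4) endo_inj_surj by metis
  then have "bij_betw f A A" using \<open>inj_on f A\<close> by (simp add: bij_betw_def)
  then show "bij_betw (perm_restrict f A) A A"
    by (subst bij_betw_cong[of A _ f]) (simp_all add: perm_restrict_def)
qed (simp add: perm_restrict_def)

lemma orbit_cong_closed:
  assumes "f ` A \<subseteq> A" "\<And>x. x \<in> A \<Longrightarrow> f x = g x" "x \<in> A"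
  shows "orbit g x = orbit f x"
  using orbit_cong0[of x A f g] assms by auto

lemma ncyc_cong:
  assumes "f ` A \<subseteq> A" "\<And>x. x \<in> A \<Longrightarrow> f x = g x"
  shows "ncyc A g = ncyc A f"
  unfolding ncyc_def using orbit_cong_closed[OF assms] by (metis (no_types, lifting) image_cong)

lemma orbit_perm_restrict:
  assumes "f ` A \<subseteq> A" "x \<in> A" shows "orbit (perm_restrict f A) x = orbit f x"
  by (rule orbit_cong_closed[OF assms(1) _ assms(2)]) (simp add: perm_restrict_def)

lemma orbit_sub_closed:
  assumes "f ` A \<subseteq> A" "x \<in> A" shows "orbit f x \<subseteq> A"
  using assms orbit_least by metis

lemma ncyc_Un:
  assumes "f ` A \<subseteq> A" "f ` B \<subseteq> B" "A \<inter> B = {}" "finite A" "finite B"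
  shows "ncyc (A \<union> B) f = ncyc A f + ncyc B f"
proof -
  have "orbit f ` A \<inter> orbit f ` B = {}"
  proof (rule ccontr)
    assume "\<not> ?thesis"
    then obtain x y where "x \<in> A" "y \<in> B" "orbit f x = orbit f y" by auto
    then have "orbit f x \<subseteq> A \<inter> B" using orbit_sub_closed assms by (metis Int_greatest)
    then show False using assms(3) orbit_nonempty[of f x] by auto
  qed
  then show ?thesis using assms(4,5) by (simp add: ncyc_def image_Un card_Un_disjoint)
qed

text \<open>Transitivity of the generated group, phrased by closed sets: by finiteness, closure
  under the permutations entails closure under their inverses. The empty carrier counts as
  connected.\<close>

definition conn :: "'a set \<Rightarrow> ('a \<Rightarrow> 'a) \<Rightarrow> ('a \<Rightarrow> 'a) \<Rightarrow> bool" where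
  "conn E p q \<longleftrightarrow> (\<forall>A\<subseteq>E. A \<noteq> {} \<longrightarrow> p ` A \<subseteq> A \<longrightarrow> q ` A \<subseteq> A \<longrightarrow> A = E)"

lemma connD: "conn E p q \<Longrightarrow> A \<subseteq> E \<Longrightarrow> x \<in> A \<Longrightarrow> p ` A \<subseteq> A \<Longrightarrow> q ` A \<subseteq> A \<Longrightarrow> A = E"
  unfolding conn_def by (metis empty_iff)

lemma conn_cong:
  assumes "\<And>x. x \<in> E \<Longrightarrow> p' x = p x" "\<And>x. x \<in> E \<Longrightarrow> q' x = q x"
  shows "conn E p' q' = conn E p q"
proof -
  have "p' ` A = p ` A" "q' ` A = q ` A" if "A \<subseteq> E" for A
    using that assms by (auto intro!: image_cong)
  then show ?thesis unfolding conn_def by (metis (no_types, lifting))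
qed

text \<open>A closed set that misses \<open>r\<close> has a closed complement containing
  \<open>r\<close>, so only sets through the root have to be tested.\<close>

lemma conn_rootI:
  assumes "p permutes E" "q permutes E" "finite E" "r \<in> E"
    and "\<And>A. A \<subseteq> E \<Longrightarrow> r \<in> A \<Longrightarrow> p ` A \<subseteq> A \<Longrightarrow> q ` A \<subseteq> A \<Longrightarrow> A = E"
  shows "conn E p q"
  unfolding conn_def
proof (intro allI impI)
  fix A assume A: "A \<subseteq> E" "A \<noteq> {}" "p ` A \<subseteq> A" "q ` A \<subseteq> A"
  have cl: "p ` (E - A) \<subseteq> E - A" "q ` (E - A) \<subseteq> E - A"
    using closed_Diff[OF assms(1,3) A(1) order.refl A(3)] closed_Diff[OF assms(2,3) A(1) order.refl A(4)]
      assms(1,2) permutes_image by blast+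
  show "A = E"
  proof (cases "r \<in> A")
    case False
    then have "E - A = E" using assms(5)[of "E - A"] cl assms(4) by blast
    then show ?thesis using A by blast
  qed (use assms(5) A in blast)
qed

text \<open>Only forward closure is demanded; for permutations of a finite set this is the orbit
  under the generated group.\<close>

definition joint_orbit :: "('a \<Rightarrow> 'a) \<Rightarrow> ('a \<Rightarrow> 'a) \<Rightarrow> 'a \<Rightarrow> 'a set" where
  "joint_orbit p q x = \<Inter> {A. x \<in> A \<and> p ` A \<subseteq> A \<and> q ` A \<subseteq> A}"

lemma joint_orbit_base: "x \<in> joint_orbit p q x" and joint_orbit_closed: "p ` joint_orbit p q x \<subseteq> joint_orbit p q x" "q ` joint_orbit p q x \<subseteq> joint_orbit p q x"
  unfolding joint_orbit_def by auto

lemma joint_orbit_least: "x \<in> A \<Longrightarrow> p ` A \<subseteq> A \<Longrightarrow> q ` A \<subseteq> A \<Longrightarrow> joint_orbit p q x \<subseteq> A"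
  unfolding joint_orbit_def by auto

lemma conn_joint_orbit:
  assumes "conn E p q" "p permutes E" "q permutes E" "r \<in> E"
  shows "joint_orbit p q r = E"
proof (rule connD[OF assms(1) _ joint_orbit_base joint_orbit_closed])
  show "joint_orbit p q r \<subseteq> E" using assms joint_orbit_least permutes_image by (metis order_refl)
qed

lemma transpose_closed:
  assumes "(transpose a b \<circ> f) ` A \<subseteq> A" "a \<in> A \<longleftrightarrow> b \<in> A"
  shows "f ` A \<subseteq> A"
proof
  fix y assume "y \<in> f ` A"
  then obtain x where x: "x \<in> A" "y = f x" by auto
  then have "transpose a b y \<in> A" using assms(1) by auto
  then show "y \<in> A" using assms(2) by (auto simp: transpose_def split: if_splits)
qed

section \<open>Cutting a connected pair by a transposition\<close>

context
  fixes E H :: "'a set" and p q p' :: "'a \<Rightarrow> 'a" and a b :: 'a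
  assumes p: "p permutes E" and q: "q permutes E" and fin: "finite E"
    and ab: "a \<in> E" "b \<in> E" and co: "conn E p q"
    and p'_eq: "p' = transpose a b \<circ> p" and H_eq: "H = joint_orbit p' q a"
begin

lemma cut_permutes: "p' permutes E" using transpose_comp_permutes[OF p ab] p'_eq by simp

lemma cut_joint_orbit: "a \<in> H" "p' ` H \<subseteq> H" "q ` H \<subseteq> H"
  unfolding H_eq by (fact joint_orbit_base joint_orbit_closed)+

lemma cut_least: "a \<in> A \<Longrightarrow> p' ` A \<subseteq> A \<Longrightarrow> q ` A \<subseteq> A \<Longrightarrow> H \<subseteq> A"
  unfolding H_eq by (fact joint_orbit_least)

lemma cut_sub: "H \<subseteq> E"
  using cut_least[of E] ab(1) permutes_image[OF cut_permutes] permutes_image[OF q] by auto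

text \<open>A closed set through \<open>a\<close> contains \<open>H\<close>, hence \<open>b\<close>,
  and a set containing both points does not notice the transposition.\<close>

lemma cut_conn:
  assumes "b \<in> H" shows "conn E p' q"
proof (rule conn_rootI[OF cut_permutes q fin ab(1)])
  fix A assume A: "A \<subseteq> E" "a \<in> A" "p' ` A \<subseteq> A" "q ` A \<subseteq> A"
  then have "b \<in> A" using assms cut_least[of A] by auto
  then show "A = E" using connD[OF co A(1) A(2) transpose_closed[OF A(3)[unfolded p'_eq]] A(4)] A(2) by simp
qed

lemma cut_closed: "p' ` (E - H) \<subseteq> E - H" "q ` (E - H) \<subseteq> E - H"
  using closed_Diff[OF cut_permutes fin cut_sub order.refl cut_joint_orbit(2)]
    closed_Diff[OF q fin cut_sub order.refl cut_joint_orbit(3)] permutes_image[OF cut_permutes] permutes_image[OF q]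
  by auto

lemma cut_conn1: "conn H p' q"
  unfolding conn_def
proof (intro allI impI)
  fix A assume A: "A \<subseteq> H" "A \<noteq> {}" "p' ` A \<subseteq> A" "q ` A \<subseteq> A"
  show "A = H"
  proof (cases "a \<in> A")
    case False
    have "H \<subseteq> H - A"
      using cut_least[of "H - A"] False cut_joint_orbit(1)
       closed_Diff[OF cut_permutes fin A(1) cut_sub A(3) cut_joint_orbit(2)] closed_Diff[OF q fin A(1) cut_sub A(4) cut_joint_orbit(3)]
      by simp
    then show ?thesis using A by blast
  qed (use A cut_least[of A] in blast)
qed

text \<open>Adding \<open>H\<close> to a closed set through \<open>b\<close> gives a set with both
  \<open>a\<close> and \<open>b\<close>, closed under the uncut pair and so everything: at most two
  components arise.\<close>

lemma cut_conn2:
  assumes "b \<notin> H" shows "conn (E - H) p' q"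
proof -
  have *: "A = E - H" if A: "A \<subseteq> E - H" "b \<in> A" "p' ` A \<subseteq> A" "q ` A \<subseteq> A" for A
  proof -
    have cl: "p' ` (A \<union> H) \<subseteq> A \<union> H" "q ` (A \<union> H) \<subseteq> A \<union> H"
      using A cut_joint_orbit by (auto simp: image_Un)
    have "p ` (A \<union> H) \<subseteq> A \<union> H"
      using transpose_closed[OF cl(1)[unfolded p'_eq]] A(2) cut_joint_orbit(1) by blast
    from connD[OF co _ _ this cl(2), of a] have "A \<union> H = E" using A(1) cut_sub cut_joint_orbit(1) by blast
    then show ?thesis using A by blast
  qed
  show ?thesis unfolding conn_def
  proof (intro allI impI)
    fix A assume A: "A \<subseteq> E - H" "A \<noteq> {}" "p' ` A \<subseteq> A" "q ` A \<subseteq> A"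
    show "A = E - H"
    proof (cases "b \<in> A")
      case False
      have "E - H - A = E - H"
        using * [of "E - H - A"] False assms ab
          closed_Diff[OF cut_permutes fin A(1) _ A(3) cut_closed(1)] closed_Diff[OF q fin A(1) _ A(4) cut_closed(2)]
        by blast
      then show ?thesis using A by blast
    qed (use A * in blast)
  qed
qed

end

text \<open>For a transitive pair on a nonempty \<open>E\<close>, \<open>chi E p q - card E\<close>
  is the Euler characteristic \<open>2 - 2 g\<close> of the associated surface.\<close>

definition chi :: "'a set \<Rightarrow> ('a \<Rightarrow> 'a) \<Rightarrow> ('a \<Rightarrow> 'a) \<Rightarrow> nat" where
  "chi E p q = ncyc E p + ncyc E q + ncyc E (p \<circ> q)"

lemma comp_closed: "f ` A \<subseteq> A \<Longrightarrow> g ` A \<subseteq> A \<Longrightarrow> (f \<circ> g) ` A \<subseteq> A"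
  by auto

lemma chi_cong:
  assumes "p ` A \<subseteq> A" "q ` A \<subseteq> A" "\<And>x. x \<in> A \<Longrightarrow> p x = p' x" "\<And>x. x \<in> A \<Longrightarrow> q x = q' x"
  shows "chi A p' q' = chi A p q"
proof -
  have "(p \<circ> q) x = (p' \<circ> q') x" if "x \<in> A" for x
    using that assms(3)[of "q x"] assms(4)[of x] assms(2) by auto
  then show ?thesis unfolding chi_def
    using ncyc_cong[OF assms(1,3)] ncyc_cong[OF assms(2,4)] ncyc_cong[OF comp_closed[OF assms(1,2)]] by metis
qed

lemma chi_perm_restrict:
  assumes "p ` A \<subseteq> A" "q ` A \<subseteq> A"
  shows "chi A (perm_restrict p A) (perm_restrict q A) = chi A p q"
  by (rule chi_cong[OF assms]) (simp_all add: perm_restrict_def)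

lemma conn_perm_restrict:
  "conn A (perm_restrict p A) (perm_restrict q A) = conn A p q"
  by (rule conn_cong) (simp_all add: perm_restrict_def)

lemma chi_Un:
  assumes "p ` A \<subseteq> A" "p ` B \<subseteq> B" "q ` A \<subseteq> A" "q ` B \<subseteq> B" "A \<inter> B = {}" "finite A" "finite B"
  shows "chi (A \<union> B) p q = chi A p q + chi B p q"
  unfolding chi_def
  using ncyc_Un[OF assms(1,2,5-7)] ncyc_Un[OF assms(3,4,5-7)]
    ncyc_Un[OF comp_closed[OF assms(1,3)] comp_closed[OF assms(2,4)] assms(5-7)] by simp

lemma ncyc_id: "ncyc A id = card A"
proof -
  have "orbit id x = {x}" for x :: 'a by (simp add: orbit_eq_singleton_iff)
  then have "orbit id ` A = (\<lambda>x. {x}) ` A" by simp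
  then show ?thesis by (simp add: ncyc_def card_image)
qed

text \<open>Induction on the number of points moved by \<open>p\<close>: composing with
  \<open>transpose a (p a)\<close> turns \<open>a\<close> into a fixed point and gives
  \<open>p\<close> one more cycle. If the pair stays connected, the cycles of
  \<open>p \<circ> q\<close> change by one at most, which this gain covers. If it falls apart, both
  components obey the bound, for a total of \<open>card E + 4\<close>, and going back merges two
  cycles of \<open>p'\<close> and two of \<open>p' \<circ> q\<close>. For \<open>p = id\<close>,
  connectedness leaves \<open>q\<close> at most one cycle.\<close>

theorem genus_nonneg:
  assumes "p permutes E" "q permutes E" "finite E" "conn E p q"
  shows "chi E p q \<le> card E + 2"
  using assms
proof (induction "card {x. p x \<noteq> x}" arbitrary: E p q rule: less_induct)
  case less
  note p = less.prems(1) and q = less.prems(2) and fin = less.prems(3) and co = less.prems(4)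
  have finsupp: "finite {x. p x \<noteq> x}" if "p permutes E" for p
    using fin finite_subset[of "{x. p x \<noteq> x}" E] permutes_not_in[OF that] by blast
  show ?case
  proof (cases "p = id")
    case True
    have "ncyc E q \<le> 1"
    proof (cases "E = {}")
      case False
      have "orbit q x = E" if "x \<in> E" for x
        using connD[OF co permutes_orbit_subset[OF q that] orbit_self[OF q fin] _ orbit_closed] True by simp
      then have "orbit q ` E = {E}" using False by auto
      then show ?thesis by (simp add: ncyc_def)
    qed (simp add: ncyc_def)
    then show ?thesis using True by (simp add: chi_def ncyc_id)
  next
    case False
    then obtain a where a: "p a \<noteq> a" by (auto simp: fun_eq_iff)
    define b where "b = p a"
    have ab: "a \<in> E" "b \<in> E" "a \<noteq> b" using a permutes_not_in[OF p] permutes_in_image[OF p] b_def by metis+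
    define p' where "p' = transpose a b \<circ> p"
    have p': "p' permutes E" using transpose_comp_permutes[OF p ab(1,2)] p'_def by simp
    have pq: "p \<circ> q permutes E" and pq': "p' \<circ> q permutes E" using permutes_compose[OF q] p p' by auto
    have w: "p' \<circ> q = transpose a b \<circ> (p \<circ> q)" "p \<circ> q = transpose a b \<circ> (p' \<circ> q)"
      unfolding p'_def comp_assoc transpose_comp_cancel by simp_all
    have np: "ncyc E p' = Suc (ncyc E p)"
      unfolding p'_def by (rule ncyc_split[OF p fin ab]) (simp add: b_def orbit.base)
    have supp: "{x. p' x \<noteq> x} \<subset> {x. p x \<noteq> x}"
    proof
      have "p b \<noteq> b" using ab(3) permutes_inj[OF p] b_def by (metis injD)
      then show "{x. p' x \<noteq> x} \<subseteq> {x. p x \<noteq> x}"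
        using a by (auto simp: p'_def transpose_def split: if_splits)
      have "p' a = a" by (simp add: p'_def b_def)
      then show "{x. p' x \<noteq> x} \<noteq> {x. p x \<noteq> x}" using a by blast
    qed
    define H where "H = joint_orbit p' q a"
    show ?thesis
    proof (cases "b \<in> H")
      case True
      have "conn E p' q"
        using cut_conn[OF p q fin ab(1,2) co p'_def H_def True] .
      then have "chi E p' q \<le> card E + 2"
        using less.hyps[OF psubset_card_mono[OF finsupp[OF p] supp] p' q fin] by blast
      moreover have "ncyc E (p \<circ> q) \<le> Suc (ncyc E (p' \<circ> q))"
        using ncyc_merge[OF pq fin ab(1,2)] ncyc_split[OF pq fin ab] w(1) by (metis le_SucI le_refl lessI less_imp_le)
      ultimately show ?thesis using np by (simp add: chi_def)
    next
      case False
      have H: "H \<subseteq> E" "p' ` H \<subseteq> H" "q ` H \<subseteq> H" "a \<in> H" 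
        using cut_sub[OF p q fin ab(1,2) co p'_def H_def] cut_joint_orbit[OF p q fin ab(1,2) co p'_def H_def] by auto
      have H2: "p' ` (E - H) \<subseteq> E - H" "q ` (E - H) \<subseteq> E - H"
        using cut_closed[OF p q fin ab(1,2) co p'_def H_def] .
      have c: "conn H p' q" "conn (E - H) p' q"
        using cut_conn1[OF p q fin ab(1,2) co p'_def H_def] cut_conn2[OF p q fin ab(1,2) co p'_def H_def False] .
      \<comment> \<open>The restriction to a component moves no point fixed by \<open>p'\<close>, so
        the induction hypothesis reaches it.\<close>
      have IH: "chi A p' q \<le> card A + 2" if A: "A \<subseteq> E" "p' ` A \<subseteq> A" "q ` A \<subseteq> A" "conn A p' q" for A
      proof -
        have "{x. perm_restrict p' A x \<noteq> x} \<subseteq> {x. p' x \<noteq> x}" by (auto simp: perm_restrict_def)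
        then have "card {x. perm_restrict p' A x \<noteq> x} < card {x. p x \<noteq> x}"
          using psubset_card_mono[OF finsupp[OF p], of "{x. perm_restrict p' A x \<noteq> x}"] supp by blast
        from less.hyps[OF this perm_restrict_permutes[OF p' fin A(1,2)] perm_restrict_permutes[OF q fin A(1,3)]
            finite_subset[OF A(1) fin]] A(4)
        show ?thesis by (simp add: conn_perm_restrict chi_perm_restrict[OF A(2,3)])
      qed
      have "chi E p' q = chi H p' q + chi (E - H) p' q"
        using chi_Un[OF H(2) H2(1) H(3) H2(2)] fin finite_subset[OF H(1) fin] H(1)
        by (metis Diff_disjoint Diff_partition finite_Diff)
      also have "\<dots> \<le> card E + 4"
        using IH[OF H(1-3) c(1)] IH[OF _ H2 c(2)] card_Diff_subset[OF finite_subset[OF H(1) fin] H(1)]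
         card_mono[OF fin H(1)] by simp
      finally have "chi E p' q \<le> card E + 4" .
      \<comment> \<open>The two points lie in different components, hence in different cycles of
        \<open>p' \<circ> q\<close>, which are merged on the way back.\<close>
      moreover have "b \<notin> orbit (p' \<circ> q) a"
        using orbit_sub_closed[OF comp_closed[OF H(2,3)] H(4)] False by blast
      from ncyc_merge[OF pq' fin ab(1,2) this] have "Suc (ncyc E (p \<circ> q)) = ncyc E (p' \<circ> q)" using w(2) by simp
      ultimately show ?thesis using np by (simp add: chi_def)
    qed
  qed
qed

section \<open>Planar hypermaps\<close>

type_synonym 'a hypermap = "('a \<Rightarrow> 'a) \<times> ('a \<Rightarrow> 'a) \<times> 'a"

text \<open>
  A rooted planar hypermap on \<open>E\<close>. It stands for the bicubic map with black vertices \<open>E\<close> whose faces of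
  colour 3, 2 and 1 are the cycles of \<open>p\<close>, \<open>q\<close> and \<open>p \<circ> q\<close>; the condition on \<open>chi\<close> is Euler's formula.
  The statistics \<open>a\<close> and \<open>c\<close> become \<open>ast\<close> and \<open>cst\<close>, as two faces touch iff they share a black vertex.
\<close>

definition hmap :: "'a set \<Rightarrow> ('a \<Rightarrow> 'a) \<Rightarrow> ('a \<Rightarrow> 'a) \<Rightarrow> 'a \<Rightarrow> bool" where
  "hmap E p q r \<longleftrightarrow> finite E \<and> p permutes E \<and> q permutes E \<and> r \<in> E \<and> conn E p q \<and> chi E p q = card E + 2"

definition ast :: "('a \<Rightarrow> 'a) \<Rightarrow> ('a \<Rightarrow> 'a) \<Rightarrow> 'a \<Rightarrow> nat" where
  "ast p q r = card (orbit (p \<circ> q) ` orbit p r)"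

definition cst :: "('a \<Rightarrow> 'a) \<Rightarrow> ('a \<Rightarrow> 'a) \<Rightarrow> 'a \<Rightarrow> nat" where
  "cst p q r = card (orbit p ` orbit q r)"

text \<open>The faces of colours 1 and 3 at the root share no black vertex except the root
  itself.\<close>

definition simple_root :: "('a \<Rightarrow> 'a) \<Rightarrow> ('a \<Rightarrow> 'a) \<Rightarrow> 'a \<Rightarrow> bool" where
  "simple_root p q r \<longleftrightarrow> orbit (p \<circ> q) r \<inter> orbit p r = {r}"

definition first_return :: "('a \<Rightarrow> 'a) \<Rightarrow> ('a \<Rightarrow> 'a) \<Rightarrow> 'a \<Rightarrow> 'a" where
  "first_return p q r = (p ^^ (LEAST k. k > 0 \<and> (p ^^ k) r \<in> orbit (p \<circ> q) r)) r"

lemma hmapD: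
  assumes "hmap E p q r"
  shows "finite E" "p permutes E" "q permutes E" "r \<in> E" "conn E p q" "chi E p q = card E + 2"
  using assms by (auto simp: hmap_def)

lemma closed_Int: "f ` A \<subseteq> A \<Longrightarrow> f ` B \<subseteq> B \<Longrightarrow> f ` (A \<inter> B) \<subseteq> A \<inter> B"
  by auto

lemma hmap_comp_permutes: "hmap E p q r \<Longrightarrow> p \<circ> q permutes E"
  using hmapD permutes_compose by metis

lemma hmap_perm_restrictI:
  assumes "p permutes E" "q permutes E" "finite E" "A \<subseteq> E" "p ` A \<subseteq> A" "q ` A \<subseteq> A" "r \<in> A" "conn A p q" "chi A p q = card A + 2"
  shows "hmap A (perm_restrict p A) (perm_restrict q A) r"
  unfolding hmap_def
  using perm_restrict_permutes[OF assms(1,3,4,5)] perm_restrict_permutes[OF assms(2,3,4,6)] assms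
    finite_subset[OF assms(4,3)] by (simp add: conn_perm_restrict chi_perm_restrict)

lemma orbit_comp_perm_restrict:
  assumes "p ` A \<subseteq> A" "q ` A \<subseteq> A" "x \<in> A"
  shows "orbit (perm_restrict p A \<circ> perm_restrict q A) x = orbit (p \<circ> q) x"
  by (rule orbit_cong_closed[OF comp_closed[OF assms(1,2)] _ assms(3)])
    (use assms(2) in \<open>auto simp: perm_restrict_def\<close>)

lemma ast_perm_restrict:
  assumes "p ` A \<subseteq> A" "q ` A \<subseteq> A" "r \<in> A"
  shows "ast (perm_restrict p A) (perm_restrict q A) r = ast p q r"
proof -
  have "orbit (perm_restrict p A \<circ> perm_restrict q A) ` orbit p r = orbit (p \<circ> q) ` orbit p r"
    by (rule image_cong[OF refl]) (use orbit_comp_perm_restrict[OF assms(1,2)] orbit_sub_closed[OF assms(1,3)] in blast)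
  then show ?thesis unfolding ast_def orbit_perm_restrict[OF assms(1,3)] by simp
qed

lemma cst_perm_restrict:
  assumes "p ` A \<subseteq> A" "q ` A \<subseteq> A" "r \<in> A"
  shows "cst (perm_restrict p A) (perm_restrict q A) r = cst p q r"
proof -
  have "orbit (perm_restrict p A) ` orbit q r = orbit p ` orbit q r"
    by (rule image_cong[OF refl]) (use orbit_perm_restrict[OF assms(1)] orbit_sub_closed[OF assms(2,3)] in blast)
  then show ?thesis unfolding cst_def orbit_perm_restrict[OF assms(2,3)] by simp
qed

lemma simple_root_perm_restrict:
  assumes "p ` A \<subseteq> A" "q ` A \<subseteq> A" "r \<in> A"
  shows "simple_root (perm_restrict p A) (perm_restrict q A) r = simple_root p q r"
  unfolding simple_root_def orbit_perm_restrict[OF assms(1,3)] orbit_comp_perm_restrict[OF assms] by simp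

lemma perm_restrict_comp_split:
  assumes "p permutes E" "A \<subseteq> E" "p ` (E - A) \<subseteq> E - A"
  shows "perm_restrict p A \<circ> perm_restrict p (E - A) = p"
proof
  fix x
  have "p x = x" if "x \<notin> E" using that permutes_not_in[OF assms(1)] by simp
  then show "(perm_restrict p A \<circ> perm_restrict p (E - A)) x = p x"
    using assms(2,3) by (auto simp: perm_restrict_def)
qed

text \<open>Gluing two hypermaps at their roots merges the root cycles of \<open>p\<close> and of \<open>p \<circ> q\<close>.\<close>

context
  fixes E1 E2 E :: "'a set" and p0 q p w0 w :: "'a \<Rightarrow> 'a" and r e :: 'a
  assumes p0: "p0 permutes E" and q: "q permutes E" and fin: "finite E"
    and E: "E1 \<union> E2 = E" "E1 \<inter> E2 = {}" and re: "r \<in> E1" "e \<in> E2"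
    and cl1: "p0 ` E1 \<subseteq> E1" "q ` E1 \<subseteq> E1" and cl2: "p0 ` E2 \<subseteq> E2" "q ` E2 \<subseteq> E2"
    and conn1: "conn E1 p0 q" and conn2: "conn E2 p0 q"
    and p_eq: "p = transpose r e \<circ> p0" and w0_eq: "w0 = p0 \<circ> q" and w_eq: "w = p \<circ> q"
begin

lemma glue_in: "r \<in> E" "e \<in> E" using re E by auto

lemma glue_p: "p permutes E" unfolding p_eq using transpose_comp_permutes[OF p0 glue_in] .

lemma glue_w0: "w0 permutes E"
  unfolding w0_eq by (rule permutes_compose[OF q p0])

lemma glue_w_eq: "w = transpose r e \<circ> w0" unfolding w_eq w0_eq p_eq comp_assoc ..

lemma glue_w0_closed: "w0 ` E1 \<subseteq> E1" "w0 ` E2 \<subseteq> E2"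
  unfolding w0_eq using comp_closed cl1 cl2 by blast+

lemma glue_not: "e \<notin> orbit p0 r" "e \<notin> orbit w0 r"
  using orbit_sub_closed[OF cl1(1) re(1)] orbit_sub_closed[OF glue_w0_closed(1) re(1)] E(2) re(2) by blast+

lemma glue_orbit_p: "orbit p x = (if x \<in> orbit p0 r \<union> orbit p0 e then orbit p0 r \<union> orbit p0 e else orbit p0 x)"
  unfolding p_eq by (rule merge_orbit_cases[OF p0 fin glue_in glue_not(1)])

lemma glue_orbit_w: "orbit w x = (if x \<in> orbit w0 r \<union> orbit w0 e then orbit w0 r \<union> orbit w0 e else orbit w0 x)"
  unfolding glue_w_eq by (rule merge_orbit_cases[OF glue_w0 fin glue_in glue_not(2)])

lemma glue_self: "x \<in> orbit p0 x" "x \<in> orbit w0 x" "x \<in> orbit q x"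
  using orbit_self[OF p0 fin] orbit_self[OF glue_w0 fin] orbit_self[OF q fin] by auto

lemma glue_sub:
  "orbit p0 r \<subseteq> E1" "orbit w0 r \<subseteq> E1" "orbit q r \<subseteq> E1" "orbit p0 e \<subseteq> E2" "orbit w0 e \<subseteq> E2"
  by (intro orbit_sub_closed cl1 cl2 re glue_w0_closed)+

lemma glue_conn: "conn E p q"
proof (rule conn_rootI[OF glue_p q fin glue_in(1)])
  fix A assume A: "A \<subseteq> E" "r \<in> A" "p ` A \<subseteq> A" "q ` A \<subseteq> A"
  have "orbit p r \<subseteq> A" using orbit_sub_closed[OF A(3,2)] .
  then have e: "e \<in> A" using glue_orbit_p[of r] glue_self by auto
  then have "p0 ` A \<subseteq> A" using transpose_closed[OF A(3)[unfolded p_eq]] A(2) by simp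
  then have c: "p0 ` (A \<inter> E1) \<subseteq> A \<inter> E1" "p0 ` (A \<inter> E2) \<subseteq> A \<inter> E2"
    "q ` (A \<inter> E1) \<subseteq> A \<inter> E1" "q ` (A \<inter> E2) \<subseteq> A \<inter> E2"
    using A(4) cl1 cl2 closed_Int by metis+
  have "A \<inter> E1 = E1"
    by (rule connD[OF conn1 _ _ c(1,3), of r]) (use A(2) re in auto)
  moreover have "A \<inter> E2 = E2"
    by (rule connD[OF conn2 _ _ c(2,4), of e]) (use e re in auto)
  ultimately show "A = E" using E(1) A(1) by blast
qed

text \<open>The two pieces contribute \<open>card E + 4\<close>; the transposition merges one pair
  of cycles of \<open>p0\<close> and one pair of cycles of \<open>w0\<close>.\<close>

lemma glue_chi:
  assumes "chi E1 p0 q = card E1 + 2" "chi E2 p0 q = card E2 + 2"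
  shows "chi E p q = card E + 2"
proof -
  have f12: "finite E1" "finite E2" using fin E(1) by auto
  have "Suc (ncyc E p) = ncyc E p0" "Suc (ncyc E (p \<circ> q)) = ncyc E (p0 \<circ> q)"
    using ncyc_merge[OF p0 fin glue_in glue_not(1)] ncyc_merge[OF glue_w0 fin glue_in glue_not(2)]
      p_eq glue_w_eq w_eq w0_eq by simp_all
  moreover have "chi E p0 q = chi E1 p0 q + chi E2 p0 q"
    using chi_Un[OF cl1(1) cl2(1) cl1(2) cl2(2) E(2) f12] E(1) by simp
  moreover have "card E = card E1 + card E2" using card_Un_disjoint[OF f12 E(2)] E(1) by simp
  ultimately show ?thesis using assms by (simp add: chi_def)
qed

text \<open>The two root cycles of \<open>w0\<close> become one, and no other cycles are identified
  because they lie in disjoint carriers. The shift by one later becomes the factor \<open>x\<close>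
  in front of the generating function.\<close>

lemma glue_ast: "Suc (ast p q r) = ast p0 q r + ast p0 q e"
proof -
  let ?W = "orbit w0 r \<union> orbit w0 e"
  let ?I1 = "orbit w0 ` orbit p0 r" and ?I2 = "orbit w0 ` orbit p0 e"
  have in1: "X \<subseteq> E1" if "X \<in> ?I1" for X
    using that glue_sub(1) orbit_sub_closed[OF glue_w0_closed(1)] by blast
  have in2: "X \<subseteq> E2" if "X \<in> ?I2" for X
    using that glue_sub(4) orbit_sub_closed[OF glue_w0_closed(2)] by blast
  have ne: "X \<noteq> {}" if "X \<in> ?I1 \<union> ?I2" for X using that glue_self by blast
  have fin': "finite ?I1" "finite ?I2" using fin E(1) glue_sub finite_subset by (metis finite_Un finite_imageI)+
  have "orbit w ` (orbit p0 r \<union> orbit p0 e) = insert ?W ((?I1 - {orbit w0 r}) \<union> (?I2 - {orbit w0 e}))" (is "?L = ?R")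
  proof (rule set_eqI, rule iffI)
    fix X assume "X \<in> ?L"
    then obtain x where x: "x \<in> orbit p0 r \<union> orbit p0 e" "X = orbit w x" by auto
    show "X \<in> ?R"
    proof (cases "x \<in> ?W")
      case False
      then have "orbit w0 x \<noteq> orbit w0 r" "orbit w0 x \<noteq> orbit w0 e" using glue_self by blast+
      then show ?thesis using x glue_orbit_w[of x] False by auto
    qed (use x glue_orbit_w[of x] in simp)
  next
    fix X assume X: "X \<in> ?R"
    show "X \<in> ?L"
    proof (cases "X = ?W")
      case True
      then have "X = orbit w r" using glue_orbit_w[of r] glue_self by simp
      then show ?thesis using glue_self by blast
    next
      case False
      then obtain x where x: "x \<in> orbit p0 r \<union> orbit p0 e" "X = orbit w0 x"
        and n: "x \<in> orbit p0 r \<and> X \<noteq> orbit w0 r \<or> x \<in> orbit p0 e \<and> X \<noteq> orbit w0 e" using X by auto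
      have "x \<notin> ?W"
      proof
        assume "x \<in> ?W"
        then have "X = orbit w0 r \<and> x \<in> E1 \<or> X = orbit w0 e \<and> x \<in> E2"
          using x(2) orbit_eq[OF glue_w0 fin] glue_sub by blast
        then show False using n glue_sub E(2) by blast
      qed
      then have "X = orbit w x" using glue_orbit_w[of x] x(2) by simp
      then show ?thesis using x(1) by blast
    qed
  qed
  moreover have "orbit p r = orbit p0 r \<union> orbit p0 e" using glue_orbit_p[of r] glue_self by simp
  ultimately have "ast p q r = card (insert ?W ((?I1 - {orbit w0 r}) \<union> (?I2 - {orbit w0 e})))"
    by (simp add: ast_def w_eq)
  also have "\<dots> = Suc (card ((?I1 - {orbit w0 r}) \<union> (?I2 - {orbit w0 e})))"
  proof (rule card_insert_disjoint)
    have "r \<in> ?W" "e \<in> ?W" using glue_self by auto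
    then have "\<not> ?W \<subseteq> E1" "\<not> ?W \<subseteq> E2" using re E(2) by blast+
    then show "?W \<notin> (?I1 - {orbit w0 r}) \<union> (?I2 - {orbit w0 e})" using in1 in2 by blast
  qed (use fin' in simp)
  also have "card ((?I1 - {orbit w0 r}) \<union> (?I2 - {orbit w0 e})) = card (?I1 - {orbit w0 r}) + card (?I2 - {orbit w0 e})"
  proof (rule card_Un_disjoint)
    show "(?I1 - {orbit w0 r}) \<inter> (?I2 - {orbit w0 e}) = {}"
    proof (rule ccontr)
      assume "\<not> ?thesis"
      then obtain X where X: "X \<in> ?I1" "X \<in> ?I2" by blast
      have "X \<subseteq> E1 \<inter> E2" using in1[OF X(1)] in2[OF X(2)] by (rule Int_greatest)
      then show False using E(2) ne[of X] X by simp
    qed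
  qed (use fin' in auto)
  finally have "ast p q r = Suc (card (?I1 - {orbit w0 r}) + card (?I2 - {orbit w0 e}))" .
  moreover have "Suc (card (?I1 - {orbit w0 r})) = card ?I1"
    by (rule card_Suc_Diff1[OF fin'(1)]) (use glue_self in blast)
  moreover have "Suc (card (?I2 - {orbit w0 e})) = card ?I2"
    by (rule card_Suc_Diff1[OF fin'(2)]) (use glue_self in blast)
  ultimately show ?thesis unfolding ast_def w0_eq by simp
qed

text \<open>The root cycle of \<open>q\<close> stays in \<open>E1\<close>. The only cycle of
  \<open>p0\<close> there that changes is enlarged by points of \<open>E2\<close>, so distinct
  cycles stay distinct.\<close>

lemma glue_cst: "cst p q r = cst p0 q r"
proof -
  let ?P = "orbit p0 r \<union> orbit p0 e"
  let ?g = "\<lambda>X. if X = orbit p0 r then ?P else X"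
  have "orbit p x = ?g (orbit p0 x)" if "x \<in> orbit q r" for x
  proof -
    have "x \<in> E1" using that glue_sub by blast
    then have "x \<in> ?P \<longleftrightarrow> x \<in> orbit p0 r" using glue_sub E(2) by blast
    then show ?thesis using glue_orbit_p[of x] orbit_eq_iff[OF p0 fin, of x r] by simp
  qed
  then have "orbit p ` orbit q r = ?g ` (orbit p0 ` orbit q r)"
    unfolding image_image by (rule image_cong[OF refl])
  moreover have "inj_on ?g (orbit p0 ` orbit q r)"
  proof -
    have "X \<noteq> ?P" if "X \<in> orbit p0 ` orbit q r" for X
    proof -
      obtain x where "x \<in> E1" "X = orbit p0 x" using \<open>X \<in> _\<close> glue_sub(3) by auto
      then have "e \<notin> X" using orbit_sub_closed[OF cl1(1), of x] re(2) E(2) by blast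
      then show ?thesis using glue_self(1)[of e] by auto
    qed
    then show ?thesis by (auto simp: inj_on_def split: if_splits)
  qed
  ultimately show ?thesis unfolding cst_def by (simp only: card_image)
qed

text \<open>The walk of \<open>p\<close> from \<open>r\<close> first makes the full turn inside
  \<open>E1\<close>, where by simplicity it avoids the root cycle of \<open>w\<close>, and then
  jumps to \<open>e\<close>. The gluing point can therefore be read off from the result.\<close>

lemma glue_first_return:
  assumes "simple_root p0 q r"
  shows "first_return p q r = e" "\<not> simple_root p q r"
proof -
  have single: "orbit w0 r \<inter> orbit p0 r = {r}" using assms unfolding simple_root_def w0_eq .
  have ow: "orbit w r = orbit w0 r \<union> orbit w0 e" and op: "orbit p r = orbit p0 r \<union> orbit p0 e"
    using glue_orbit_w[of r] glue_orbit_p[of r] glue_self by simp_all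
  define k where "k = funpow_dist1 p0 r r"
  have k: "k > 0" "(p0 ^^ k) r = r" unfolding k_def using funpow_dist1_prop[OF glue_self(1)] by simp_all
  have inp: "(p0 ^^ i) r \<in> orbit p0 r" for i using funpow_in_orbit glue_self(1) by metis
  have av: "(p0 ^^ i) r \<noteq> r \<and> (p0 ^^ i) r \<noteq> e" if "0 < i" "i < k" for i
    using first_hit_avoids[OF glue_self(1), of i r] that inp[of i] glue_not unfolding k_def by metis
  have pk: "(p ^^ k) r = e"
    unfolding p_eq using funpow_transpose_comp_last[OF av k(1)] k(2) by simp
  have e_in: "e \<in> orbit w r" unfolding ow using glue_self by auto
  have least: "(LEAST k. k > 0 \<and> (p ^^ k) r \<in> orbit w r) = k"
  proof (rule Least_equality)
    show "k > 0 \<and> (p ^^ k) r \<in> orbit w r" using k(1) pk e_in by simp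
    fix i assume i: "i > 0 \<and> (p ^^ i) r \<in> orbit w r"
    show "k \<le> i"
    proof (rule ccontr)
      assume "\<not> k \<le> i"
      then have "i < k" by simp
      then have "(p ^^ i) r = (p0 ^^ i) r" unfolding p_eq using funpow_transpose_comp[OF av] by blast
      then have "(p0 ^^ i) r \<in> orbit w0 r \<union> orbit w0 e" using i ow by simp
      moreover have "(p0 ^^ i) r \<notin> orbit w0 e" using inp[of i] glue_sub E(2) by blast
      ultimately show False using single inp[of i] av[of i] i \<open>i < k\<close> by blast
    qed
  qed
  show "first_return p q r = e" unfolding first_return_def using least pk w_eq by simp
  have "e \<in> orbit w r \<inter> orbit p r" using e_in op glue_self by auto
  moreover have "e \<noteq> r" using re E(2) by auto
  ultimately show "\<not> simple_root p q r" unfolding simple_root_def using w_eq by blast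
qed

end

definition hmaps :: "'a set \<Rightarrow> 'a hypermap set" where
  "hmaps E = {(p, q, r). hmap E p q r}"

definition simple_hmaps :: "'a set \<Rightarrow> 'a hypermap set" where
  "simple_hmaps E = {(p, q, r). hmap E p q r \<and> simple_root p q r}"

lemma perm_restrict_comp_disjoint:
  assumes "f permutes A" "g permutes B" "A \<inter> B = {}"
  shows "perm_restrict (f \<circ> g) A = f" "perm_restrict (f \<circ> g) B = g" "(f \<circ> g) permutes (A \<union> B)"
    "(f \<circ> g) ` A \<subseteq> A" "(f \<circ> g) ` B \<subseteq> B"
proof -
  have 1: "g x = x" if "x \<in> A" for x using that assms(2,3) permutes_not_in[of g B x] by blast
  have 2: "f (g x) = g x" if "x \<in> B" for x
    using that assms permutes_not_in[of f A] permutes_in_image[OF assms(2)] by blast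
  have 3: "f x = x" if "x \<notin> A" for x using that assms(1) permutes_not_in by metis
  have 4: "g x = x" if "x \<notin> B" for x using that assms(2) permutes_not_in by metis
  show "perm_restrict (f \<circ> g) A = f" "perm_restrict (f \<circ> g) B = g"
    using 1 2 3 4 by (auto simp: fun_eq_iff perm_restrict_def)
  show "(f \<circ> g) permutes (A \<union> B)"
    using permutes_compose[OF permutes_subset[OF assms(2), of "A \<union> B"] permutes_subset[OF assms(1), of "A \<union> B"]] by simp
  show "(f \<circ> g) ` A \<subseteq> A" using 1 permutes_in_image[OF assms(1)] by auto
  show "(f \<circ> g) ` B \<subseteq> B" using 2 permutes_in_image[OF assms(2)] by auto
qed

definition glue :: "'a set \<times> 'a hypermap \<times> 'a hypermap \<Rightarrow> 'a hypermap" where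
  "glue = (\<lambda>(E1, (p1, q1, r), (p2, q2, e)). (transpose r e \<circ> (p1 \<circ> p2), q1 \<circ> q2, r))"

lemma glue_simp: "glue (E1, (p1, q1, r), (p2, q2, e)) = (transpose r e \<circ> (p1 \<circ> p2), q1 \<circ> q2, r)"
  by (simp add: glue_def)

text \<open>Multiplying by the transposition again undoes the gluing; the component of the root is
  recovered as a joint orbit.\<close>

definition unglue :: "'a set \<Rightarrow> 'a hypermap \<Rightarrow> 'a set \<times> 'a hypermap \<times> 'a hypermap" where
  "unglue E = (\<lambda>(p, q, r). let e = first_return p q r; p0 = transpose r e \<circ> p; H = joint_orbit p0 q r in
     (H, (perm_restrict p0 H, perm_restrict q H, r), (perm_restrict p0 (E - H), perm_restrict q (E - H), e)))"

lemma glue_correct: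
  assumes E: "E1 \<inter> E2 = {}" "E1 \<union> E2 = E" and h1: "hmap E1 p1 q1 r" and h2: "hmap E2 p2 q2 e" and s: "simple_root p1 q1 r"
    and p: "p = transpose r e \<circ> (p1 \<circ> p2)" and q: "q = q1 \<circ> q2"
  shows "hmap E p q r" "\<not> simple_root p q r" "Suc (ast p q r) = ast p1 q1 r + ast p2 q2 e" "cst p q r = cst p1 q1 r"
    "unglue E (p, q, r) = (E1, (p1, q1, r), (p2, q2, e))"
proof -
  define p0 where "p0 = p1 \<circ> p2"
  note d1 = hmapD[OF h1] and d2 = hmapD[OF h2]
  note P = perm_restrict_comp_disjoint[OF d1(2) d2(2) E(1), folded p0_def]
  note Q = perm_restrict_comp_disjoint[OF d1(3) d2(3) E(1), folded q]
  have fin: "finite E" using d1 d2 E by auto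
  have pp: "p0 permutes E" "q permutes E" using P(3) Q(3) E by auto
  have c1: "conn E1 p0 q" and c2: "conn E2 p0 q"
    using conn_perm_restrict[of E1 p0 q] conn_perm_restrict[of E2 p0 q] P Q d1 d2 by simp_all
  have p_eq: "p = transpose r e \<circ> p0" using p p0_def by simp
  have ch: "chi E1 p0 q = card E1 + 2" "chi E2 p0 q = card E2 + 2"
    using chi_perm_restrict[OF P(4) Q(4)] chi_perm_restrict[OF P(5) Q(5)] P Q d1 d2 by simp_all
  note G = pp fin E(2,1) d1(4) d2(4) P(4) Q(4) P(5) Q(5) c1 c2 p_eq refl refl
  have s0: "simple_root p0 q r" using simple_root_perm_restrict[OF P(4) Q(4) d1(4)] P Q s by simp
  show "hmap E p q r"
    unfolding hmap_def using fin pp glue_p[OF G] glue_conn[OF G] glue_chi[OF G ch] d1(4) E by blast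
  show "\<not> simple_root p q r" using glue_first_return[OF G s0] by simp
  show "Suc (ast p q r) = ast p1 q1 r + ast p2 q2 e"
    using glue_ast[OF G] ast_perm_restrict[OF P(4) Q(4) d1(4)] ast_perm_restrict[OF P(5) Q(5) d2(4)] P Q by simp
  show "cst p q r = cst p1 q1 r"
    using glue_cst[OF G] cst_perm_restrict[OF P(4) Q(4) d1(4)] P Q by simp
  have e: "first_return p q r = e" using glue_first_return[OF G s0] by simp
  have p0: "transpose r e \<circ> p = p0" using p_eq transpose_comp_cancel by metis
  have H: "joint_orbit p0 q r = E1"
  proof (rule connD[OF c1 _ joint_orbit_base joint_orbit_closed])
    show "joint_orbit p0 q r \<subseteq> E1" using joint_orbit_least[OF d1(4) P(4) Q(4)] .
  qed
  have "E - E1 = E2" using E by blast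
  then show "unglue E (p, q, r) = (E1, (p1, q1, r), (p2, q2, e))"
    unfolding unglue_def by (simp add: Let_def e p0 H P Q)
qed

text \<open>The combinatorial Jordan curve argument. The first return \<open>e\<close> shares with
  \<open>r\<close> a cycle of \<open>p\<close> and a cycle of \<open>p \<circ> q\<close>, so the
  transposition splits both and raises \<open>chi\<close> by two. A connected result would violate
  the genus inequality; hence the hypermap falls apart, and both pieces must attain the
  bound.\<close>

lemma unglue_correct:
  assumes h: "hmap E p q r" and s: "\<not> simple_root p q r"
  shows "\<exists>E1 p1 q1 p2 q2 e. E1 \<subseteq> E \<and> hmap E1 p1 q1 r \<and> simple_root p1 q1 r \<and> hmap (E - E1) p2 q2 e
     \<and> (p, q, r) = glue (E1, (p1, q1, r), (p2, q2, e))"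
proof -
  note d = hmapD[OF h]
  define w where "w = p \<circ> q"
  have w: "w permutes E" using hmap_comp_permutes[OF h] w_def by simp
  have self: "r \<in> orbit p r" "r \<in> orbit w r" using orbit_self d w by metis+
  obtain e' where e': "e' \<in> orbit w r" "e' \<in> orbit p r" "e' \<noteq> r"
    using s self unfolding simple_root_def w_def by blast
  define j where "j = funpow_dist1 p r e'"
  have "(p ^^ j) r = e'" "j > 0" unfolding j_def using funpow_dist1_prop[OF e'(2)] by simp_all
  define k where "k = (LEAST k. k > 0 \<and> (p ^^ k) r \<in> orbit w r)"
  have k: "k > 0" "(p ^^ k) r \<in> orbit w r" "k \<le> j"
    using LeastI[of "\<lambda>k. k > 0 \<and> (p ^^ k) r \<in> orbit w r" j] Least_le[of "\<lambda>k. k > 0 \<and> (p ^^ k) r \<in> orbit w r" j]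
      \<open>(p ^^ j) r = e'\<close> \<open>j > 0\<close> e'(1) unfolding k_def by simp_all
  have less: "(p ^^ i) r \<notin> orbit w r" if "0 < i" "i < k" for i
    using not_less_Least[of i "\<lambda>k. k > 0 \<and> (p ^^ k) r \<in> orbit w r"] that unfolding k_def by blast
  define e where "e = (p ^^ k) r"
  \<comment> \<open>\<open>e'\<close> is reached within the first turn, and the first return comes
    no later than \<open>e'\<close>.\<close>
  have ne: "e \<noteq> r"
  proof
    assume "e = r"
    moreover have "k \<noteq> j" using \<open>e = r\<close> e_def \<open>(p ^^ j) r = e'\<close> e'(3) by auto
    ultimately show False
      using first_hit_avoids[OF e'(2) k(1)] k(3) unfolding e_def j_def by simp
  qed
  have e_in: "e \<in> orbit p r" "e \<in> orbit w r" using e_def k(2) funpow_in_orbit[OF self(1)] by auto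
  have E: "r \<in> E" "e \<in> E" using d(4) e_in permutes_orbit_subset[OF d(2,4)] by auto
  define p0 where "p0 = transpose r e \<circ> p"
  define w0 where "w0 = p0 \<circ> q"
  have w0_eq: "w0 = transpose r e \<circ> w" unfolding w0_def p0_def w_def comp_assoc ..
  have p0: "p0 permutes E" unfolding p0_def by (rule transpose_comp_permutes[OF d(2) E])
  have "chi E p0 q = card E + 4"
    using ncyc_split[OF d(2,1) E ne[symmetric] e_in(1)] ncyc_split[OF w d(1) E ne[symmetric] e_in(2)] d(6)
    unfolding chi_def p0_def[symmetric] w0_eq[symmetric] w_def[symmetric] w0_def[symmetric] by simp
  define H where "H = joint_orbit p0 q r"
  note C = d(2,3,1) E d(5) p0_def H_def
  have eH: "e \<notin> H"
  proof
    assume "e \<in> H"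
    then have "chi E p0 q \<le> card E + 2" using genus_nonneg[OF p0 d(3,1) cut_conn[OF C]] by blast
    then show False using \<open>chi E p0 q = card E + 4\<close> by simp
  qed
  have H: "H \<subseteq> E" "r \<in> H" "p0 ` H \<subseteq> H" "q ` H \<subseteq> H" using cut_sub[OF C] cut_joint_orbit[OF C] by auto
  note H2 = cut_closed[OF C]
  note c1 = cut_conn1[OF C] and c2 = cut_conn2[OF C eH]
  have fH: "finite H" using finite_subset[OF H(1) d(1)] .
  have gen: "chi A p0 q \<le> card A + 2" if "A \<subseteq> E" "p0 ` A \<subseteq> A" "q ` A \<subseteq> A" "conn A p0 q" for A
    using genus_nonneg[OF perm_restrict_permutes[OF p0 d(1) that(1,2)] perm_restrict_permutes[OF d(3,1) that(1,3)]
      finite_subset[OF that(1) d(1)]] that(4) by (simp add: conn_perm_restrict chi_perm_restrict[OF that(2,3)])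
  have "chi E p0 q = chi H p0 q + chi (E - H) p0 q"
    using chi_Un[OF H(3) H2(1) H(4) H2(2)] fH d(1) Diff_partition[OF H(1)] by simp
  moreover have "card E = card H + card (E - H)"
    using card_Diff_subset[OF fH H(1)] card_mono[OF d(1) H(1)] by simp
  \<comment> \<open>Two upper bounds whose sum is attained are both equalities.\<close>
  ultimately have ch: "chi H p0 q = card H + 2" "chi (E - H) p0 q = card (E - H) + 2"
    using gen[OF H(1,3,4) c1] gen[OF Diff_subset H2 c2] \<open>chi E p0 q = card E + 4\<close> by simp_all
  have h1: "hmap H (perm_restrict p0 H) (perm_restrict q H) r"
    by (rule hmap_perm_restrictI[OF p0 d(3,1) H(1,3,4,2) c1 ch(1)])
  have h2: "hmap (E - H) (perm_restrict p0 (E - H)) (perm_restrict q (E - H)) e"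
    by (rule hmap_perm_restrictI[OF p0 d(3,1) Diff_subset H2 _ c2 ch(2)]) (use E eH in simp)
  have av: "(p ^^ i) r \<noteq> r \<and> (p ^^ i) r \<noteq> e" if "0 < i" "i < k" for i
    using less[OF that] self e_in by auto
  have "orbit p0 r = {(p ^^ i) r | i. i < k}"
    unfolding p0_def by (rule orbit_transpose_segment[OF av k(1)], assumption, assumption, rule e_def[symmetric])
  \<comment> \<open>The cut only shortens the root cycle, so the piece inherits that the walk meets
    it nowhere strictly between times 0 and \<open>k\<close>.\<close>
  moreover have "orbit w0 r \<subseteq> orbit w r"
  proof -
    have "e \<notin> orbit w0 r" using orbit_sub_closed[OF comp_closed[OF H(3,4)] H(2)] eH w0_def by blast
    have "w0 permutes E" unfolding w0_eq by (rule transpose_comp_permutes[OF w E])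
    from merge_orbit[OF this d(1) E \<open>e \<notin> orbit w0 r\<close>] show ?thesis
      unfolding w0_eq transpose_comp_cancel by blast
  qed
  moreover have "w0 permutes E" unfolding w0_eq by (rule transpose_comp_permutes[OF w E])
  ultimately have "orbit w0 r \<inter> orbit p0 r = {r}"
  proof -
    have "x = r" if x: "x \<in> orbit w0 r" "x \<in> orbit p0 r" for x
    proof -
      obtain i where i: "i < k" "x = (p ^^ i) r" using x(2) \<open>orbit p0 r = _\<close> by auto
      then have "i = 0" using less[of i] x(1) \<open>orbit w0 r \<subseteq> _\<close> by auto
      then show "x = r" using i by simp
    qed
    then show ?thesis using orbit_self[OF p0 d(1), of r] orbit_self[OF \<open>w0 permutes E\<close> d(1), of r] by auto
  qed
  then have s1: "simple_root (perm_restrict p0 H) (perm_restrict q H) r"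
    unfolding simple_root_perm_restrict[OF H(3,4,2)] unfolding simple_root_def w0_def .
  have "(p, q, r) = glue (H, (perm_restrict p0 H, perm_restrict q H, r), (perm_restrict p0 (E - H), perm_restrict q (E - H), e))"
    unfolding glue_simp perm_restrict_comp_split[OF p0 H(1) H2(1)] perm_restrict_comp_split[OF d(3) H(1) H2(2)]
    unfolding p0_def transpose_comp_cancel ..
  then show ?thesis using h1 h2 s1 H(1) by blast
qed

lemma glue_bij:
  "bij_betw glue (SIGMA E1:Pow E. simple_hmaps E1 \<times> hmaps (E - E1)) (hmaps E - simple_hmaps E)"
    (is "bij_betw glue ?D ?R")
proof -
  have fwd: "glue a \<in> ?R \<and> unglue E (glue a) = a" if a: "a \<in> ?D" for a
  proof -
    obtain E1 p1 q1 r p2 q2 e where eq: "a = (E1, (p1, q1, r), (p2, q2, e))" by (metis prod_cases7 prod.collapse)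
    have "E1 \<inter> (E - E1) = {}" "E1 \<union> (E - E1) = E" "hmap E1 p1 q1 r" "hmap (E - E1) p2 q2 e" "simple_root p1 q1 r"
      using a unfolding eq simple_hmaps_def hmaps_def by auto
    note G = glue_correct[OF this refl refl]
    show ?thesis unfolding eq glue_simp using G(1,2,5) by (simp add: simple_hmaps_def hmaps_def)
  qed
  have "b \<in> glue ` ?D" if "b \<in> ?R" for b
  proof -
    obtain p q r where b: "b = (p, q, r)" by (metis prod_cases3)
    have "hmap E p q r" "\<not> simple_root p q r" using that unfolding b simple_hmaps_def hmaps_def by auto
    from unglue_correct[OF this] obtain E1 p1 q1 p2 q2 e where u:
      "E1 \<subseteq> E" "hmap E1 p1 q1 r" "simple_root p1 q1 r" "hmap (E - E1) p2 q2 e"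
      "(p, q, r) = glue (E1, (p1, q1, r), (p2, q2, e))" by blast
    then have "(E1, (p1, q1, r), (p2, q2, e)) \<in> ?D" by (simp add: simple_hmaps_def hmaps_def)
    then show ?thesis unfolding b using u(5) by (rule image_eqI[rotated])
  qed
  then have "glue ` ?D = ?R" using fwd by (intro equalityI subsetI) auto
  moreover have "inj_on glue ?D"
  proof (rule inj_onI)
    fix a b assume "a \<in> ?D" "b \<in> ?D" "glue a = glue b"
    then show "a = b" using fwd[of a] fwd[of b] by metis
  qed
  ultimately show ?thesis unfolding bij_betw_def by blast
qed

lemma glue_stats:
  assumes "(E1, (p1, q1, r1), (p2, q2, e)) \<in> (SIGMA E1:Pow E. simple_hmaps E1 \<times> hmaps (E - E1))"
    "glue (E1, (p1, q1, r1), (p2, q2, e)) = (p, q, r)"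
  shows "Suc (ast p q r) = ast p1 q1 r1 + ast p2 q2 e" "cst p q r = cst p1 q1 r1"
proof -
  have "E1 \<inter> (E - E1) = {}" "E1 \<union> (E - E1) = E" "hmap E1 p1 q1 r1" "hmap (E - E1) p2 q2 e" "simple_root p1 q1 r1"
    using assms(1) unfolding simple_hmaps_def hmaps_def by auto
  from glue_correct(3,4)[OF this refl refl]
  show "Suc (ast p q r) = ast p1 q1 r1 + ast p2 q2 e" "cst p q r = cst p1 q1 r1"
    using assms(2) by (auto simp: glue_simp)
qed

section \<open>Attaching a new root\<close>

context
  fixes E E' :: "'a set" and p' q' p0 q w0 w' :: "'a \<Rightarrow> 'a" and r r' :: 'a
  assumes p': "p' permutes E'" and q': "q' permutes E'" and fin': "finite E'"
    and r: "r \<notin> E'" and r': "r' \<in> E'" and E: "E = insert r E'"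
    and p0_eq: "p0 = p' \<circ> transpose r r'" and q_eq: "q = transpose r r' \<circ> q'"
    and w0_eq: "w0 = p0 \<circ> q" and w'_eq: "w' = p' \<circ> q'"
begin

text \<open>The two transpositions stand next to each other in \<open>p0 \<circ> q\<close> and
  cancel. Thus \<open>r\<close> is inserted after \<open>r'\<close> in its cycle of
  \<open>p'\<close> and before \<open>r'\<close> in its cycle of \<open>q'\<close>, while the
  product merely has \<open>r\<close> as a fixed point.\<close>

lemma leaf_w0: "w0 = w'"
  unfolding w0_eq w'_eq p0_eq q_eq by (simp add: fun_eq_iff)

lemma leaf_fix: "p' r = r" "q' r = r" "w' r = r"
  using permutes_not_in[OF p' r] permutes_not_in[OF q' r] by (simp_all add: w'_eq)

lemma leaf_fin: "finite E" and leaf_in: "r \<in> E" "r' \<in> E" "p' r' \<in> E" "r \<noteq> r'"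
  using fin' r r' E permutes_in_image[OF p'] by auto

lemma leaf_p'E: "p' permutes E" and leaf_q'E: "q' permutes E" and leaf_w': "w' permutes E'"
proof -
  show w': "w' permutes E'" unfolding w'_eq by (rule permutes_compose[OF q' p'])
  have "E' \<subseteq> E" using E by auto
  then show "p' permutes E" "q' permutes E" using permutes_subset p' q' by metis+
qed

lemma leaf_p0_transpose: "p0 = transpose r (p' r') \<circ> p'"
proof
  fix x
  have "p' x = p' r' \<longleftrightarrow> x = r'" "p' x = r \<longleftrightarrow> x = r"
    using permutes_inj[OF p'] leaf_fix(1) by (metis injD)+
  then show "p0 x = (transpose r (p' r') \<circ> p') x"
    unfolding p0_eq using leaf_fix(1) by (auto simp: transpose_def)
qed

lemma leaf_p0: "p0 permutes E" and leaf_q: "q permutes E"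
  unfolding leaf_p0_transpose q_eq
  using transpose_comp_permutes[OF leaf_p'E leaf_in(1,3)] transpose_comp_permutes[OF leaf_q'E leaf_in(1,2)] by auto

lemma leaf_values: "p0 r = p' r'" "p0 r' = r" "q r = r'" "x \<noteq> r \<Longrightarrow> x \<noteq> r' \<Longrightarrow> p0 x = p' x"
  unfolding p0_eq q_eq using leaf_fix by (simp_all add: transpose_apply_other)

lemma leaf_orbit_fix: "orbit p' r = {r}" "orbit q' r = {r}" "orbit w0 r = {r}"
  unfolding orbit_eq_singleton_iff leaf_w0 using leaf_fix by auto

lemma leaf_not: "p' r' \<notin> orbit p' r" "r' \<notin> orbit q' r"
  using leaf_orbit_fix leaf_in r r' permutes_in_image[OF p'] by auto

lemma leaf_orbit_p: "orbit p0 x = (if x \<in> insert r (orbit p' r') then insert r (orbit p' r') else orbit p' x)"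
proof -
  have "orbit p' (p' r') = orbit p' r'" using orbit_eq[OF p' fin' orbit.base] .
  then show ?thesis
    using merge_orbit_cases[OF leaf_p'E leaf_fin leaf_in(1,3) leaf_not(1), of x] leaf_orbit_fix
    unfolding leaf_p0_transpose by simp
qed

lemma leaf_orbit_q: "orbit q r = insert r (orbit q' r')"
  using merge_orbit[OF leaf_q'E leaf_fin leaf_in(1,2) leaf_not(2)] leaf_orbit_fix unfolding q_eq by simp

lemma leaf_orbits_sub: "orbit p' r' \<subseteq> E'" "orbit q' r' \<subseteq> E'"
  using permutes_orbit_subset[OF p' r'] permutes_orbit_subset[OF q' r'] .

lemma leaf_self: "r' \<in> orbit p' r'" "r' \<in> orbit q' r'"
  using orbit_self[OF p' fin'] orbit_self[OF q' fin'] by auto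

lemma ncyc_insert_fix:
  assumes "f permutes E'" shows "ncyc E f = Suc (ncyc E' f)"
proof -
  have "orbit f r = {r}" using permutes_not_in[OF assms r] by (simp add: orbit_eq_singleton_iff)
  moreover have "{r} \<notin> orbit f ` E'" using permutes_orbit_subset[OF assms] r by blast
  ultimately show ?thesis using fin' by (simp add: ncyc_def E)
qed

text \<open>The root joins existing cycles of \<open>p'\<close> and \<open>q'\<close> and is a cycle
  of its own for the product, which matches the growth of the carrier by one.\<close>

lemma leaf_chi: "chi E p0 q = Suc (chi E' p' q')"
proof -
  have "Suc (ncyc E p0) = ncyc E p'" "Suc (ncyc E q) = ncyc E q'"
    using ncyc_merge[OF leaf_p'E leaf_fin leaf_in(1,3) leaf_not(1)] ncyc_merge[OF leaf_q'E leaf_fin leaf_in(1,2) leaf_not(2)]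
    unfolding leaf_p0_transpose q_eq by simp_all
  moreover have "p0 \<circ> q = w'" using leaf_w0 w0_eq by simp
  ultimately show ?thesis
    using ncyc_insert_fix[OF p'] ncyc_insert_fix[OF q'] ncyc_insert_fix[OF leaf_w']
    unfolding chi_def w'_eq[symmetric] by simp
qed

lemma leaf_conn: "conn E p0 q \<longleftrightarrow> conn E' p' q'"
proof
  assume c: "conn E p0 q"
  show "conn E' p' q'"
  proof (rule conn_rootI[OF p' q' fin' r'])
    fix A assume A: "A \<subseteq> E'" "r' \<in> A" "p' ` A \<subseteq> A" "q' ` A \<subseteq> A"
    have "p0 x \<in> insert r A" if "x \<in> insert r A" for x
      using that A(2,3) leaf_values by (cases "x = r"; cases "x = r'") auto
    moreover have "q x \<in> insert r A" if "x \<in> insert r A" for x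
      using that A(2,4) leaf_fix unfolding q_eq by (auto simp: transpose_def)
    ultimately have "insert r A = E" using connD[OF c, of "insert r A" r] A(1) E by blast
    then show "A = E'" using E r A(1) by (metis insert_ident subsetD)
  qed
next
  assume c: "conn E' p' q'"
  show "conn E p0 q"
  proof (rule conn_rootI[OF leaf_p0 leaf_q leaf_fin leaf_in(1)])
    fix A assume A: "A \<subseteq> E" "r \<in> A" "p0 ` A \<subseteq> A" "q ` A \<subseteq> A"
    have r'A: "r' \<in> A" using A(2,4) leaf_values(3) by (metis image_subset_iff)
    have E': "A - {r} \<subseteq> E'" using A(1) E by blast
    have "p' x \<in> A - {r}" if "x \<in> A - {r}" for x
    proof -
      have "p' x \<in> E'" using that E' permutes_in_image[OF p'] by blast
      moreover have "p' x \<in> A"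
      proof (cases "x = r'")
        case True
        then show ?thesis using A(2,3) leaf_values(1) by (metis image_subset_iff)
      next
        case False
        then have "p' x = p0 x" using leaf_values(4)[of x] that by simp
        then show ?thesis using A(3) that by (metis DiffD1 image_subset_iff)
      qed
      ultimately show ?thesis using r by auto
    qed
    moreover have "q' x \<in> A - {r}" if "x \<in> A - {r}" for x
    proof -
      have 1: "q' x \<in> E'" using that E' permutes_in_image[OF q'] by blast
      have "q x \<in> A" using that A(4) by blast
      then have "q' x \<in> A" using r'A 1 r unfolding q_eq by (auto simp: transpose_def split: if_splits)
      then show ?thesis using r 1 by auto
    qed
    ultimately have "A - {r} = E'" using connD[OF c E', of r'] r'A leaf_in(4) by blast
    then show "A = E" using E A(2) by blast
  qed
qed

lemma leaf_hmap: "hmap E p0 q r \<longleftrightarrow> hmap E' p' q' r'"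
  using leaf_p0 leaf_q leaf_fin leaf_in p' q' fin' r' leaf_conn leaf_chi E r
  by (simp add: hmap_def)

lemma leaf_simple: "simple_root p0 q r"
  unfolding simple_root_def w0_eq[symmetric] using leaf_orbit_fix leaf_orbit_p[of r] by auto

lemma leaf_ast: "ast p0 q r = Suc (ast p' q' r')"
proof -
  have "orbit w0 ` insert r (orbit p' r') = insert {r} (orbit w' ` orbit p' r')"
    using leaf_orbit_fix leaf_w0 by simp
  moreover have "{r} \<notin> orbit w' ` orbit p' r'"
    using leaf_orbits_sub permutes_orbit_subset[OF leaf_w'] r by blast
  moreover have "finite (orbit p' r')" using leaf_orbits_sub fin' finite_subset by blast
  moreover have "orbit p0 r = insert r (orbit p' r')" using leaf_orbit_p[of r] by simp
  ultimately show ?thesis unfolding ast_def w0_eq[symmetric] w'_eq[symmetric] by simp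
qed

text \<open>The root lies in the \<open>p0\<close>-cycle of \<open>r'\<close>, which the root cycle
  of \<open>q'\<close> meets already; that cycle only gains the point \<open>r\<close>.\<close>

lemma leaf_cst: "cst p0 q r = cst p' q' r'"
proof -
  let ?P = "insert r (orbit p' r')"
  let ?g = "\<lambda>X. if X = orbit p' r' then ?P else X"
  have g: "orbit p0 x = ?g (orbit p' x)" if "x \<in> orbit q' r'" for x
  proof -
    have "x \<noteq> r" using that leaf_orbits_sub r by blast
    then show ?thesis using leaf_orbit_p[of x] orbit_eq_iff[OF p' fin', of x r'] by simp
  qed
  have "orbit p0 r = orbit p0 r'" using leaf_orbit_p[of r] leaf_orbit_p[of r'] leaf_self by simp
  then have "orbit p0 ` orbit q r = orbit p0 ` orbit q' r'" unfolding leaf_orbit_q using leaf_self by auto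
  also have "\<dots> = ?g ` (orbit p' ` orbit q' r')" unfolding image_image by (rule image_cong[OF refl g])
  finally have eq: "orbit p0 ` orbit q r = ?g ` (orbit p' ` orbit q' r')" .
  have "X \<noteq> ?P" if X: "X \<in> orbit p' ` orbit q' r'" for X
  proof -
    obtain x where "x \<in> E'" "X = orbit p' x" using X leaf_orbits_sub by auto
    then have "X \<subseteq> E'" using permutes_orbit_subset[OF p', of x] by simp
    then show ?thesis using r by auto
  qed
  then have "inj_on ?g (orbit p' ` orbit q' r')" by (auto simp: inj_on_def split: if_splits)
  then show ?thesis unfolding cst_def eq by (simp only: card_image)
qed

text \<open>As \<open>r\<close> sits between \<open>r'\<close> and \<open>p' r'\<close>, the walks
  from \<open>r\<close> and from \<open>r'\<close> agree from the first step until the turn is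
  complete, without a shift of the index.\<close>

lemma leaf_walk:
  assumes "0 < i" "\<And>j. 0 < j \<Longrightarrow> j < i \<Longrightarrow> (p' ^^ j) r' \<noteq> r'"
  shows "(p0 ^^ i) r = (p' ^^ i) r'"
  using assms
proof (induction i rule: nat_induct_non_zero)
  case (Suc i)
  have "(p' ^^ i) r' \<in> E'" using funpow_in_orbit[OF leaf_self(1)] leaf_orbits_sub by blast
  then have "(p' ^^ i) r' \<noteq> r" "(p' ^^ i) r' \<noteq> r'" using r Suc by auto
  then have "p0 ((p' ^^ i) r') = p' ((p' ^^ i) r')" using leaf_values(4) by simp
  moreover have "(p0 ^^ i) r = (p' ^^ i) r'" using Suc by simp
  ultimately show ?case by simp
qed (simp add: leaf_values)

end

text \<open>Joining the root to the \<open>k\<close>-th corner \<open>d\<close> of the root cycle of \<open>p0\<close> cuts that cycle in two.\<close>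

context
  fixes E :: "'a set" and p0 q p w0 w :: "'a \<Rightarrow> 'a" and r d :: 'a and k :: nat
  assumes h: "hmap E p0 q r" and w0_eq: "w0 = p0 \<circ> q" and w_eq: "w = p \<circ> q" and w0r: "w0 r = r"
    and p_eq: "p = transpose r d \<circ> p0" and k: "0 < k" "(p0 ^^ k) r = d" and dr: "d \<noteq> r"
    and avoid: "\<forall>i. 0 < i \<and> i < k \<longrightarrow> (p0 ^^ i) r \<noteq> r \<and> (p0 ^^ i) r \<noteq> d"
begin

lemma close_avoid: "0 < i \<Longrightarrow> i < k \<Longrightarrow> (p0 ^^ i) r \<noteq> r \<and> (p0 ^^ i) r \<noteq> d"
  using avoid by blast

lemma close_w: "w = transpose r d \<circ> w0" unfolding w_eq w0_eq p_eq comp_assoc ..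

lemma close_self: "x \<in> orbit p0 x" "x \<in> orbit q x" "x \<in> orbit w0 x"
  using orbit_self hmapD[OF h] hmap_comp_permutes[OF h] w0_eq by metis+

lemma close_d: "d \<in> orbit p0 r" using funpow_in_orbit[OF close_self(1)] k by metis

lemma close_in: "r \<in> E" "d \<in> E"
  using hmapD[OF h] permutes_orbit_subset close_d by (metis, metis subsetD)

lemma close_p: "p permutes E" and close_w0: "w0 permutes E"
  unfolding p_eq
  using transpose_comp_permutes[OF _ close_in] hmapD[OF h] hmap_comp_permutes[OF h] w0_eq by auto

lemma close_orbit_w0: "orbit w0 r = {r}" using w0r by (simp add: orbit_eq_singleton_iff)

lemma close_not: "d \<notin> orbit w0 r" using close_orbit_w0 dr by simp

lemma close_orbit_w: "orbit w x = (if x \<in> insert r (orbit w0 d) then insert r (orbit w0 d) else orbit w0 x)"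
  using merge_orbit_cases[OF close_w0 hmapD(1)[OF h] close_in close_not] close_orbit_w0 unfolding close_w by simp

lemma close_orbit_p: "orbit p r = {(p0 ^^ i) r | i. i < k}"
  unfolding p_eq by (rule orbit_transpose_segment[OF close_avoid k]) auto

lemma close_d_notin: "d \<notin> orbit p r"
  unfolding p_eq by (rule split_notin[OF close_d dr[symmetric]])

text \<open>A cycle of \<open>p0\<close> is split while the singleton cycle of \<open>r\<close>
  under \<open>w0\<close> is merged with the cycle of \<open>d\<close>, so \<open>chi\<close> is
  unchanged. The pair stays connected because \<open>d\<close> is reached from \<open>r\<close>
  along \<open>w\<close>.\<close>

lemma close_hmap: "hmap E p q r"
proof -
  note d = hmapD[OF h]
  have "d \<in> joint_orbit p q r"
    using close_orbit_w[of r] close_self orbit_sub_closed[OF comp_closed[OF joint_orbit_closed] joint_orbit_base, of p q r] w_eq by auto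
  then have "conn E p q" by (rule cut_conn[OF d(2,3,1) close_in d(5) p_eq refl])
  moreover have "ncyc E p = Suc (ncyc E p0)"
    unfolding p_eq by (rule ncyc_split[OF d(2,1) close_in dr[symmetric] close_d])
  moreover have "Suc (ncyc E w) = ncyc E w0"
    unfolding close_w by (rule ncyc_merge[OF close_w0 d(1) close_in close_not])
  ultimately show ?thesis using d close_p unfolding hmap_def chi_def w_eq w0_eq by simp
qed

text \<open>The root face of colour 1 is now \<open>r\<close> together with the cycle of
  \<open>d\<close>, and the root cycle of \<open>p\<close> is the arc before \<open>d\<close>. Hence
  \<open>d\<close> must be the first corner on its face of colour 1, which is why
  \<open>corners\<close> collects first occurrences.\<close>

lemma close_simple: "simple_root p q r \<longleftrightarrow> (\<forall>i. 0 < i \<and> i < k \<longrightarrow> (p0 ^^ i) r \<notin> orbit w0 d)"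
proof -
  have ow: "orbit w r = insert r (orbit w0 d)" using close_orbit_w[of r] by simp
  show ?thesis
  proof
    assume s: "simple_root p q r"
    show "\<forall>i. 0 < i \<and> i < k \<longrightarrow> (p0 ^^ i) r \<notin> orbit w0 d"
    proof (intro allI impI notI)
      fix i assume i: "0 < i \<and> i < k" "(p0 ^^ i) r \<in> orbit w0 d"
      then have "(p0 ^^ i) r \<in> orbit w r \<inter> orbit p r" using ow close_orbit_p by auto
      then have "(p0 ^^ i) r = r" using s unfolding simple_root_def w_eq by auto
      then show False using close_avoid i by simp
    qed
  next
    assume s: "\<forall>i. 0 < i \<and> i < k \<longrightarrow> (p0 ^^ i) r \<notin> orbit w0 d"
    have "x = r" if x: "x \<in> orbit w r" "x \<in> orbit p r" for x
    proof -
      obtain i where "x = (p0 ^^ i) r" "i < k" using x(2) close_orbit_p by auto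
      then show ?thesis using s x(1) ow by (cases "i = 0") auto
    qed
    moreover have "r \<in> orbit w r" "r \<in> orbit p r" using ow orbit_self[OF close_p hmapD(1)[OF h]] by auto
    ultimately show "simple_root p q r" unfolding simple_root_def w_eq by auto
  qed
qed

text \<open>The remaining arc sees only the faces of colour 1 met before \<open>d\<close>, besides
  the new root face.\<close>

lemma close_ast:
  assumes "simple_root p q r"
  shows "ast p q r = Suc (card ((\<lambda>i. orbit w0 ((p0 ^^ i) r)) ` {0<..<k}))"
proof -
  have out: "(p0 ^^ i) r \<notin> insert r (orbit w0 d)" if "0 < i" "i < k" for i
    using assms that close_avoid[OF that] unfolding close_simple by auto
  have "insert 0 {0<..<k} = {..<k}" using k(1) by auto
  then have "orbit p r = (\<lambda>i. (p0 ^^ i) r) ` insert 0 {0<..<k}"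
    unfolding close_orbit_p by (simp only:) blast
  then have "orbit w ` orbit p r = insert (orbit w r) ((\<lambda>i. orbit w ((p0 ^^ i) r)) ` {0<..<k})"
    by (simp add: image_image)
  also have "(\<lambda>i. orbit w ((p0 ^^ i) r)) ` {0<..<k} = (\<lambda>i. orbit w0 ((p0 ^^ i) r)) ` {0<..<k}"
    by (rule image_cong[OF refl]) (use out close_orbit_w in auto)
  finally have "orbit w ` orbit p r = insert (orbit w r) ((\<lambda>i. orbit w0 ((p0 ^^ i) r)) ` {0<..<k})" .
  moreover have "orbit w r \<notin> (\<lambda>i. orbit w0 ((p0 ^^ i) r)) ` {0<..<k}"
  proof
    assume "orbit w r \<in> (\<lambda>i. orbit w0 ((p0 ^^ i) r)) ` {0<..<k}"
    then obtain i where "0 < i" "i < k" "orbit w r = orbit w0 ((p0 ^^ i) r)" by auto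
    then have "(p0 ^^ i) r \<in> insert r (orbit w0 d)"
      using close_self(3)[of "(p0 ^^ i) r"] close_orbit_w[of r] by simp
    then show False using out[OF \<open>0 < i\<close> \<open>i < k\<close>] by simp
  qed
  ultimately show ?thesis unfolding ast_def w_eq by simp
qed

text \<open>The root cycle of \<open>p0\<close> breaks into two, and the root cycle of
  \<open>q\<close> meets both halves: one at \<open>r\<close>, the other at
  \<open>q r\<close>.\<close>

lemma close_cst:
  assumes "q r \<notin> orbit p r"
  shows "cst p q r = Suc (cst p0 q r)"
proof -
  note d = hmapD[OF h]
  let ?O = "orbit p0 r"
  have pd: "p0 = transpose r d \<circ> p" unfolding p_eq transpose_comp_cancel ..
  have O: "?O = orbit p r \<union> orbit p d"
    unfolding pd by (rule merge_orbit[OF close_p d(1) close_in close_d_notin])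
  have other: "orbit p0 x = orbit p x" if "x \<notin> ?O" for x
    using merge_orbit_cases[OF close_p d(1) close_in close_d_notin, of x] that unfolding pd[symmetric] O by simp
  \<comment> \<open>Since \<open>w0\<close> fixes \<open>r\<close>, the point \<open>q r\<close> is
    the predecessor of \<open>r\<close> on the cycle of \<open>p0\<close>.\<close>
  have p0r: "p0 (q r) = r" using w0r w0_eq by simp
  have qr: "q r \<in> ?O" using orbit_eq_iff[OF d(2,1)] orbit.base[of p0 "q r"] p0r close_self(1) by metis
  then have qd: "orbit p (q r) = orbit p d" using O assms orbit_eq[OF close_p d(1)] by blast
  let ?R = "orbit p ` (orbit q r - ?O)"
  have self: "x \<in> orbit p x" for x using orbit_self[OF close_p d(1)] .
  have 1: "orbit p ` orbit q r = insert (orbit p r) (insert (orbit p d) ?R)"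
  proof
    show "orbit p ` orbit q r \<subseteq> insert (orbit p r) (insert (orbit p d) ?R)"
    proof
      fix X assume "X \<in> orbit p ` orbit q r"
      then obtain x where x: "x \<in> orbit q r" "X = orbit p x" by auto
      show "X \<in> insert (orbit p r) (insert (orbit p d) ?R)"
        using x O orbit_eq[OF close_p d(1), of x] by (cases "x \<in> ?O") auto
    qed
    show "insert (orbit p r) (insert (orbit p d) ?R) \<subseteq> orbit p ` orbit q r"
    proof (intro insert_subsetI)
      show "orbit p r \<in> orbit p ` orbit q r" using close_self(2)[of r] by (rule imageI)
      show "orbit p d \<in> orbit p ` orbit q r" unfolding qd[symmetric] using orbit.base[of q r] by (rule imageI)
    qed blast
  qed
  have 2: "orbit p0 ` orbit q r = insert ?O ?R"
  proof
    show "orbit p0 ` orbit q r \<subseteq> insert ?O ?R"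
    proof
      fix X assume "X \<in> orbit p0 ` orbit q r"
      then obtain x where x: "x \<in> orbit q r" "X = orbit p0 x" by auto
      show "X \<in> insert ?O ?R"
      proof (cases "x \<in> ?O")
        case True
        then show ?thesis using x(2) orbit_eq[OF d(2,1) True] by simp
      next
        case False
        then have "orbit p0 x \<in> ?R" using x(1) other[OF False] by (intro image_eqI[of _ _ x]) simp_all
        then show ?thesis using x(2) by simp
      qed
    qed
    show "insert ?O ?R \<subseteq> orbit p0 ` orbit q r"
    proof (intro insert_subsetI subsetI)
      show "?O \<in> orbit p0 ` orbit q r" using close_self(2)[of r] by (rule imageI)
      fix X assume "X \<in> ?R"
      then obtain x where "x \<in> orbit q r" "x \<notin> ?O" "X = orbit p x" by blast
      then show "X \<in> orbit p0 ` orbit q r" using other[of x] by (intro image_eqI[of _ _ x]) simp_all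
    qed
  qed
  have n: "X \<inter> ?O = {}" if X: "X \<in> ?R" for X
  proof -
    obtain x where "x \<notin> ?O" "X = orbit p x" using X by auto
    then have "X = orbit p0 x" using other by simp
    show ?thesis
    proof (rule ccontr)
      assume "X \<inter> ?O \<noteq> {}"
      then obtain y where "y \<in> orbit p0 x" "y \<in> ?O" using \<open>X = orbit p0 x\<close> by auto
      then have "orbit p0 x = ?O" using orbit_eq[OF d(2,1)] by metis
      then show False using \<open>x \<notin> ?O\<close> close_self(1)[of x] by simp
    qed
  qed
  have "finite ?R" using finite_subset[OF permutes_orbit_subset[OF d(3,4)] d(1)] by simp
  moreover have "?O \<notin> ?R" "orbit p r \<notin> ?R" "orbit p d \<notin> ?R"
    using n[of ?O] n[of "orbit p r"] n[of "orbit p d"] O self close_self(1)[of r] by blast+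
  moreover have "orbit p r \<noteq> orbit p d" using close_d_notin self by metis
  ultimately show ?thesis unfolding cst_def 1 2 by simp
qed

end

text \<open>The reverse of closing: \<open>d\<close> is the successor of \<open>r\<close> on its
  face of colour 1. Simplicity puts \<open>d\<close> outside the root cycle of \<open>p\<close>, so
  the transposition merges two cycles of \<open>p\<close> while it splits \<open>r\<close> off as a
  fixed point of the product.\<close>

lemma open_hmap:
  assumes h: "hmap E p q r" and s: "simple_root p q r" and d: "d = (p \<circ> q) r" "d \<noteq> r" and p0: "p0 = transpose r d \<circ> p"
  shows "hmap E p0 q r" "(p0 \<circ> q) r = r" "d \<in> orbit p0 r"
proof -
  note D = hmapD[OF h]
  define w where "w = p \<circ> q"
  have w: "w permutes E" using hmap_comp_permutes[OF h] w_def by simp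
  have w0: "p0 \<circ> q = transpose r d \<circ> w" unfolding p0 w_def comp_assoc ..
  show w0r: "(p0 \<circ> q) r = r" unfolding w0 using d(1) w_def by simp
  have "d \<in> orbit w r" using d(1) w_def orbit.base by metis
  then have dn: "d \<notin> orbit p r" using s d(2) unfolding simple_root_def w_def by blast
  have in_E: "r \<in> E" "d \<in> E" using D(4) permutes_in_image[OF w] d(1) w_def by auto
  have p0E: "p0 permutes E" unfolding p0 by (rule transpose_comp_permutes[OF D(2) in_E])
  have O: "orbit p0 r = orbit p r \<union> orbit p d" unfolding p0 by (rule merge_orbit[OF D(2,1) in_E dn])
  then show dO: "d \<in> orbit p0 r" using orbit_self[OF D(2,1)] by blast
  have "conn E p0 q"
  proof (rule conn_rootI[OF p0E D(3,1,4)])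
    fix A assume A: "A \<subseteq> E" "r \<in> A" "p0 ` A \<subseteq> A" "q ` A \<subseteq> A"
    then have "d \<in> A" using orbit_sub_closed[OF A(3,2)] dO by blast
    then show "A = E" using connD[OF D(5) A(1,2) transpose_closed[OF A(3)[unfolded p0]] A(4)] A(2) by simp
  qed
  moreover have "Suc (ncyc E p0) = ncyc E p" unfolding p0 by (rule ncyc_merge[OF D(2,1) in_E dn])
  moreover have "ncyc E (p0 \<circ> q) = Suc (ncyc E w)"
    unfolding w0 by (rule ncyc_split[OF w D(1) in_E d(2)[symmetric] \<open>d \<in> orbit w r\<close>])
  ultimately show "hmap E p0 q r" using D p0E unfolding hmap_def chi_def w_def by simp
qed

section \<open>First occurrences and corners of the root face\<close>

definition first_occ :: "(nat \<Rightarrow> 'b) \<Rightarrow> nat set" where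
  "first_occ g = {k. 0 < k \<and> (\<forall>i. 0 < i \<and> i < k \<longrightarrow> g i \<noteq> g k)}"

lemma first_occ_inj: "inj_on g (first_occ g)"
proof (rule inj_onI)
  fix i j assume "i \<in> first_occ g" "j \<in> first_occ g" "g i = g j"
  then show "i = j" by (cases i j rule: linorder_cases) (auto simp: first_occ_def)
qed

lemma first_occ_least:
  assumes "0 < i" obtains j where "j \<in> first_occ g" "j \<le> i" "g j = g i"
proof
  define j where "j = (LEAST j. 0 < j \<and> g j = g i)"
  have j: "0 < j \<and> g j = g i" unfolding j_def by (rule LeastI[of _ i]) (use assms in simp)
  show "j \<le> i" unfolding j_def by (rule Least_le) (use assms in simp)
  show "g j = g i" using j by simp
  have "g l \<noteq> g j" if "0 < l" "l < j" for l
    using not_less_Least[of l "\<lambda>j. 0 < j \<and> g j = g i"] that j unfolding j_def by auto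
  then show "j \<in> first_occ g" using j unfolding first_occ_def by auto
qed

lemma first_occ_image_less: "g ` (first_occ g \<inter> {..<k}) = g ` {0<..<k}"
proof
  show "g ` (first_occ g \<inter> {..<k}) \<subseteq> g ` {0<..<k}" by (auto simp: first_occ_def)
  show "g ` {0<..<k} \<subseteq> g ` (first_occ g \<inter> {..<k})"
  proof
    fix y assume "y \<in> g ` {0<..<k}"
    then obtain i where i: "0 < i" "i < k" "y = g i" by auto
    obtain j where "j \<in> first_occ g" "j \<le> i" "g j = g i" using first_occ_least[OF i(1)] .
    then show "y \<in> g ` (first_occ g \<inter> {..<k})" using i by (intro image_eqI[of _ _ j]) auto
  qed
qed

lemma first_occ_image: "g ` first_occ g = g ` {0<..}"
proof
  show "g ` first_occ g \<subseteq> g ` {0<..}" by (auto simp: first_occ_def)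
  show "g ` {0<..} \<subseteq> g ` first_occ g"
  proof
    fix y assume "y \<in> g ` {0<..}"
    then obtain i where i: "0 < i" "y = g i" by auto
    obtain j where "j \<in> first_occ g" "j \<le> i" "g j = g i" using first_occ_least[OF i(1)] .
    then show "y \<in> g ` first_occ g" using i by (intro image_eqI[of _ _ j]) auto
  qed
qed

text \<open>One index for each face of colour 1 that touches the root cycle of \<open>p\<close>,
  namely its first visit. Counting starts at 1, so in each turn the root itself is visited
  last.\<close>

definition corners :: "'a hypermap \<Rightarrow> nat set" where
  "corners = (\<lambda>(p, q, r). first_occ (\<lambda>i. orbit (p \<circ> q) ((p ^^ i) r)))"

lemma card_corners: "card (corners (p, q, r)) = ast p q r"
proof -
  let ?g = "\<lambda>i. orbit (p \<circ> q) ((p ^^ i) r)"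
  have "orbit p r = (\<lambda>i. (p ^^ i) r) ` {0<..}" unfolding orbit_altdef by auto
  then have "orbit (p \<circ> q) ` orbit p r = ?g ` first_occ ?g"
    unfolding first_occ_image by (simp add: image_image)
  then show ?thesis unfolding ast_def corners_def by (simp add: card_image[OF first_occ_inj])
qed

text \<open>The rank of a corner is the number of faces seen before it, which is what remains of the
  statistic after closing.\<close>

lemma card_corners_less:
  "card (corners (p, q, r) \<inter> {..<k}) = card ((\<lambda>i. orbit (p \<circ> q) ((p ^^ i) r)) ` {0<..<k})"
  unfolding corners_def first_occ_image_less[symmetric]
  by (simp add: card_image[OF inj_on_subset[OF first_occ_inj]])

text \<open>Corner indices are positive, so 0 is free to mean that the root is inserted without
  closing; the transposition is then \<open>transpose r r\<close>, the identity.\<close>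

definition attach :: "'a \<times> 'a hypermap \<times> nat \<Rightarrow> 'a hypermap" where
  "attach = (\<lambda>(r, (p', q', r'), k). (transpose r (if k = 0 then r else (p' ^^ k) r') \<circ> (p' \<circ> transpose r r'), transpose r r' \<circ> q', r))"

text \<open>All data can be read off: the old root is \<open>q r\<close>, and the corner is the
  image \<open>d\<close> of \<open>r\<close> under the product.\<close>

definition detach :: "'a hypermap \<Rightarrow> 'a \<times> 'a hypermap \<times> nat" where
  "detach = (\<lambda>(p, q, r). let d = (p \<circ> q) r; p0 = transpose r d \<circ> p; r' = q r; p' = p0 \<circ> transpose r r' in
     (r, (p', transpose r r' \<circ> q, r'), if d = r then 0 else LEAST k. 0 < k \<and> (p' ^^ k) r' = d))"

lemma attach_simp:
  "attach (r, (p', q', r'), k) = (transpose r (if k = 0 then r else (p' ^^ k) r') \<circ> (p' \<circ> transpose r r'), transpose r r' \<circ> q', r)"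
  by (simp add: attach_def)

lemma comp_transpose_cancel: "(f \<circ> transpose a b) \<circ> transpose a b = f"
  by (simp add: fun_eq_iff)

lemma attach_correct:
  assumes rE: "r \<in> E" and h': "hmap (E - {r}) p' q' r'" and k: "k \<in> insert 0 (corners (p', q', r'))"
    and a: "attach (r, (p', q', r'), k) = (p, q, s)"
  shows "s = r \<and> hmap E p q r \<and> simple_root p q r \<and> detach (p, q, r) = (r, (p', q', r'), k)"
    "ast p q r = (if k = 0 then Suc (ast p' q' r') else Suc (card (corners (p', q', r') \<inter> {..<k})))"
    "cst p q r = (if k = 0 then cst p' q' r' else Suc (cst p' q' r'))"
proof -
  note D = hmapD[OF h']
  define p0 where "p0 = p' \<circ> transpose r r'"
  define d where "d = (if k = 0 then r else (p' ^^ k) r')"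
  define w' where "w' = p' \<circ> q'"
  define w0 where "w0 = p0 \<circ> q"
  have pq: "p = transpose r d \<circ> p0" "q = transpose r r' \<circ> q'" "s = r"
    using a unfolding attach_simp d_def p0_def by auto
  have rn: "r \<notin> E - {r}" and Ei: "E = insert r (E - {r})" using rE by auto
  note L = D(2,3,1) rn D(4) Ei p0_def pq(2) w0_def w'_def
  have h0: "hmap E p0 q r" using leaf_hmap[OF L] h' by simp
  have w0: "w0 = w'" by (rule leaf_w0[OF L])
  have w0r: "w0 r = r" unfolding w0 by (rule leaf_fix[OF L])
  have p0c: "p0 \<circ> transpose r r' = p'" unfolding p0_def by (rule comp_transpose_cancel)
  have qc: "transpose r r' \<circ> q = q'" unfolding pq(2) by (rule transpose_comp_cancel)
  have qr: "q r = r'" by (rule leaf_values[OF L])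
  have pc: "transpose r d \<circ> p = p0" unfolding pq(1) by (rule transpose_comp_cancel)
  have pw: "p \<circ> q = transpose r d \<circ> w0" unfolding pq(1) w0_def comp_assoc ..
  have wr: "(p \<circ> q) r = d" unfolding pw using w0r by simp
  have "(s = r \<and> hmap E p q r \<and> simple_root p q r \<and> detach (p, q, r) = (r, (p', q', r'), k)) \<and>
    ast p q r = (if k = 0 then Suc (ast p' q' r') else Suc (card (corners (p', q', r') \<inter> {..<k}))) \<and>
    cst p q r = (if k = 0 then cst p' q' r' else Suc (cst p' q' r'))"
  proof (cases "k = 0")
    case True
    then have dr: "d = r" by (simp add: d_def)
    then have pp: "p = p0" unfolding pq(1) by simp
    have "detach (p, q, r) = (r, (p', q', r'), k)"
      unfolding detach_def using wr pc p0c qc qr dr True by (simp add: Let_def)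
    then show ?thesis
      using h0 leaf_simple[OF L] leaf_ast[OF L] leaf_cst[OF L] True pq(3) unfolding pp by simp
  next
    case False
    define g where "g = (\<lambda>i. orbit w' ((p' ^^ i) r'))"
    have d: "d = (p' ^^ k) r'" using False by (simp add: d_def)
    have kc: "k \<in> first_occ g" using k False unfolding corners_def g_def w'_def by simp
    have gk: "g i \<noteq> g k" if "0 < i" "i < k" for i using kc that unfolding first_occ_def by auto
    have ne: "(p' ^^ i) r' \<noteq> d" if "0 < i" "i < k" for i
      using gk[OF that] unfolding g_def d by metis
    \<comment> \<open>A return to \<open>r'\<close> at time \<open>j\<close> would bring
      \<open>d\<close> forward to time \<open>k - j\<close>, before its first occurrence.\<close>
    have nr': "(p' ^^ j) r' \<noteq> r'" if "0 < j" "j < k" for j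
    proof
      assume "(p' ^^ j) r' = r'"
      then have "(p' ^^ (k - j)) ((p' ^^ j) r') = (p' ^^ (k - j)) r'" by simp
      then have "(p' ^^ (k - j + j)) r' = (p' ^^ (k - j)) r'" by (simp only: funpow_add o_apply)
      then show False using ne[of "k - j"] that d by simp
    qed
    have walk: "(p0 ^^ i) r = (p' ^^ i) r'" if "0 < i" "i \<le> k" for i
      using leaf_walk[OF L that(1)] nr' that(2) by auto
    have inE': "(p' ^^ i) r' \<in> E - {r}" for i
      using funpow_in_orbit[OF leaf_self(1)[OF L]] leaf_orbits_sub(1)[OF L] by blast
    have k0: "0 < k" "(p0 ^^ k) r = d" using False walk[of k] d by auto
    have dr: "d \<noteq> r" using inE'[of k] d by auto
    have av: "\<forall>i. 0 < i \<and> i < k \<longrightarrow> (p0 ^^ i) r \<noteq> r \<and> (p0 ^^ i) r \<noteq> d"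
      using walk inE' ne by (metis DiffD2 insertI1 less_imp_le)
    note C = h0 w0_def refl w0r pq(1) k0 dr av
    have hm: "hmap E p q r" by (rule close_hmap[OF C])
    have "(p0 ^^ i) r \<notin> orbit w0 d" if "0 < i" "i < k" for i
    proof
      assume "(p0 ^^ i) r \<in> orbit w0 d"
      then have "orbit w' ((p0 ^^ i) r) = orbit w' d"
        unfolding w0 by (rule orbit_eq[OF leaf_w'[OF L] D(1)])
      then show False using gk[OF that] walk[of i] that d unfolding g_def by simp
    qed
    then have si: "simple_root p q r" using close_simple[OF C] by blast
    have "(LEAST j. 0 < j \<and> (p' ^^ j) r' = d) = k"
    proof (rule Least_equality)
      show "0 < k \<and> (p' ^^ k) r' = d" using k0 d by simp
      show "k \<le> j" if "0 < j \<and> (p' ^^ j) r' = d" for j using that ne[of j] by (metis not_le)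
    qed
    then have de: "detach (p, q, r) = (r, (p', q', r'), k)"
      unfolding detach_def using wr pc p0c qc qr dr by (simp add: Let_def)
    have "(\<lambda>i. orbit w0 ((p0 ^^ i) r)) ` {0<..<k} = (\<lambda>i. orbit w' ((p' ^^ i) r')) ` {0<..<k}"
      by (rule image_cong[OF refl]) (use walk w0 in auto)
    then have as: "ast p q r = Suc (card (corners (p', q', r') \<inter> {..<k}))"
      using close_ast[OF C si] unfolding card_corners_less w'_def by simp
    \<comment> \<open>\<open>r' = q r\<close> ends the turn and so lies beyond the arc of the first
      \<open>k\<close> points, as the count for the second statistic requires.\<close>
    have "r' \<notin> orbit p r"
    proof
      assume "r' \<in> orbit p r"
      then obtain i where i: "i < k" "r' = (p0 ^^ i) r" unfolding close_orbit_p[OF C] by blast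
      then have "i \<noteq> 0" using leaf_in(4)[OF L] by (metis funpow_0)
      then show False using walk[of i] nr'[of i] i by simp
    qed
    then have "cst p q r = Suc (cst p' q' r')"
      using close_cst[OF C] leaf_cst[OF L] qr by simp
    then show ?thesis using hm si de as pq(3) False by simp
  qed
  then show "s = r \<and> hmap E p q r \<and> simple_root p q r \<and> detach (p, q, r) = (r, (p', q', r'), k)"
    "ast p q r = (if k = 0 then Suc (ast p' q' r') else Suc (card (corners (p', q', r') \<inter> {..<k})))"
    "cst p q r = (if k = 0 then cst p' q' r' else Suc (cst p' q' r'))" by blast+
qed

lemma detach_correct:
  assumes h: "hmap E p q r" and s: "simple_root p q r" and E1: "E \<noteq> {r}"
  shows "\<exists>p' q' r' k. hmap (E - {r}) p' q' r' \<and> k \<in> insert 0 (corners (p', q', r')) \<and> attach (r, (p', q', r'), k) = (p, q, r)"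
proof -
  note H = hmapD[OF h]
  define d where "d = (p \<circ> q) r"
  define p0 where "p0 = transpose r d \<circ> p"
  define w0 where "w0 = p0 \<circ> q"
  have h0: "hmap E p0 q r" "w0 r = r"
    using open_hmap[OF h s d_def _ p0_def] h unfolding w0_def p0_def
    by (cases "d = r"; simp add: d_def)+
  have pp: "p = transpose r d \<circ> p0" unfolding p0_def transpose_comp_cancel ..
  note H0 = hmapD[OF h0(1)]
  define r' where "r' = q r"
  define p' where "p' = p0 \<circ> transpose r r'"
  define q' where "q' = transpose r r' \<circ> q"
  define w' where "w' = p' \<circ> q'"
  have p0r': "p0 r' = r" using h0(2) by (simp add: w0_def r'_def)
  have r'E: "r' \<in> E" using H(4) permutes_in_image[OF H(3)] r'_def by simp
  \<comment> \<open>If \<open>q\<close> fixed the root, so would \<open>p0\<close>, and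
    connectedness would leave a single point.\<close>
  have "r' \<noteq> r"
  proof
    assume "r' = r"
    then have "{r} = E" using connD[OF H0(5), of "{r}" r] H(4) p0r' r'_def by auto
    then show False using E1 by simp
  qed
  have perm: "f permutes E - {r}" if "f permutes E" "f r = r" for f
    using permutes_superset[OF that(1), of "E - {r}"] that(2) by auto
  have "p' permutes E" unfolding p'_def by (rule permutes_compose[OF permutes_swap_id[OF H(4) r'E] H0(2)])
  then have p': "p' permutes E - {r}" by (rule perm) (simp add: p'_def p0r')
  have "q' permutes E" unfolding q'_def by (rule transpose_comp_permutes[OF H(3,4) r'E])
  then have q': "q' permutes E - {r}" by (rule perm) (simp add: q'_def r'_def)
  have rn: "r \<notin> E - {r}" and Ei: "E = insert r (E - {r})" and r'n: "r' \<in> E - {r}" and fin: "finite (E - {r})"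
    using H \<open>r' \<noteq> r\<close> r'E by auto
  have p0e: "p0 = p' \<circ> transpose r r'" unfolding p'_def comp_transpose_cancel ..
  have qe: "q = transpose r r' \<circ> q'" unfolding q'_def transpose_comp_cancel ..
  note L = p' q' fin rn r'n Ei p0e qe w0_def w'_def
  have h': "hmap (E - {r}) p' q' r'" using leaf_hmap[OF L] h0 by simp
  show ?thesis
  proof (cases "d = r")
    case True
    have "attach (r, (p', q', r'), 0) = (p, q, r)"
      unfolding attach_simp using pp True p0e qe by simp
    then show ?thesis using h' by blast
  next
    case False
    have do: "d \<in> orbit p0 r" using open_hmap[OF h s d_def False p0_def] by simp
    define k where "k = funpow_dist1 p0 r d"
    have k: "0 < k" "(p0 ^^ k) r = d" unfolding k_def using funpow_dist1_prop[OF do] by simp_all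
    have av: "\<forall>i. 0 < i \<and> i < k \<longrightarrow> (p0 ^^ i) r \<noteq> r \<and> (p0 ^^ i) r \<noteq> d"
      using first_hit_avoids[OF do] unfolding k_def by blast
    note C = h0(1) w0_def refl h0(2) pp k False av
    have walk: "(p0 ^^ i) r = (p' ^^ i) r' \<and> (\<forall>j. 0 < j \<and> j < i \<longrightarrow> (p' ^^ j) r' \<noteq> r')" if "0 < i" "i \<le> k" for i
      using that
    proof (induction i rule: nat_induct_non_zero)
      case 1 show ?case using leaf_values(1)[OF L] by auto
    next
      case (Suc i)
      have "(p' ^^ i) r' \<noteq> r'"
      proof
        assume "(p' ^^ i) r' = r'"
        then have "(p0 ^^ Suc i) r = r" using Suc p0r' by simp
        moreover have "Suc i = k \<or> Suc i < k" using Suc.prems by linarith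
        ultimately show False using av k(2) False zero_less_Suc by metis
      qed
      then have *: "\<forall>j. 0 < j \<and> j < Suc i \<longrightarrow> (p' ^^ j) r' \<noteq> r'" using Suc by (metis Suc_leD less_Suc_eq)
      then show ?case using leaf_walk[OF L, of "Suc i"] by blast
    qed
    have dk: "d = (p' ^^ k) r'" using walk[of k] k by simp
    \<comment> \<open>An earlier visit to the face of \<open>d\<close> would contradict the
      simplicity of the root.\<close>
    have "\<forall>i. 0 < i \<and> i < k \<longrightarrow> orbit w' ((p' ^^ i) r') \<noteq> orbit w' ((p' ^^ k) r')"
    proof (intro allI impI notI)
      fix i assume i: "0 < i \<and> i < k" and eq: "orbit w' ((p' ^^ i) r') = orbit w' ((p' ^^ k) r')"
      have "(p' ^^ i) r' \<in> orbit w' ((p' ^^ i) r')" by (rule orbit_self[OF leaf_w'[OF L] fin])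
      then have "(p' ^^ i) r' \<in> orbit w0 d" using eq dk leaf_w0[OF L] by simp
      moreover have "(p0 ^^ i) r = (p' ^^ i) r'" using walk[of i] i by simp
      ultimately show False using close_simple[OF C] s i by metis
    qed
    then have "k \<in> corners (p', q', r')"
      using k(1) unfolding corners_def first_occ_def w'_def by simp
    moreover have "attach (r, (p', q', r'), k) = (p, q, r)"
      unfolding attach_simp using pp p0e qe k(1) dk by simp
    ultimately show ?thesis using h' by blast
  qed
qed

text \<open>A single point leaves no smaller hypermap behind, so carriers of size one enter the
  equation separately.\<close>

lemma attach_bij:
  assumes "card E \<ge> 2"
  shows "bij_betw attach (SIGMA r:E. SIGMA M:hmaps (E - {r}). insert 0 (corners M)) (simple_hmaps E)"
    (is "bij_betw attach ?D ?R")
proof -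
  have fwd: "attach a \<in> ?R \<and> detach (attach a) = a" if a: "a \<in> ?D" for a
  proof -
    obtain r p' q' r' k where eq: "a = (r, (p', q', r'), k)" by (metis prod_cases5 prod.collapse)
    obtain p q s where at: "attach (r, (p', q', r'), k) = (p, q, s)" by (metis prod_cases3)
    have "r \<in> E" "hmap (E - {r}) p' q' r'" "k \<in> insert 0 (corners (p', q', r'))"
      using a unfolding eq hmaps_def by auto
    from attach_correct(1)[OF this at] show ?thesis unfolding eq at simple_hmaps_def by simp
  qed
  have "b \<in> attach ` ?D" if "b \<in> ?R" for b
  proof -
    obtain p q r where b: "b = (p, q, r)" by (metis prod_cases3)
    have h: "hmap E p q r" "simple_root p q r" using that unfolding b simple_hmaps_def by auto
    moreover have "E \<noteq> {r}" using assms by auto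
    ultimately obtain p' q' r' k where u:
      "hmap (E - {r}) p' q' r'" "k \<in> insert 0 (corners (p', q', r'))" "attach (r, (p', q', r'), k) = (p, q, r)"
      using detach_correct by metis
    then have "(r, (p', q', r'), k) \<in> ?D" using hmapD(4)[OF h(1)] by (simp add: hmaps_def)
    then show ?thesis unfolding b using u(3)[symmetric] by (rule image_eqI[rotated])
  qed
  then have "attach ` ?D = ?R" using fwd by (intro equalityI subsetI) auto
  moreover have "inj_on attach ?D"
  proof (rule inj_onI)
    fix a b assume "a \<in> ?D" "b \<in> ?D" "attach a = attach b"
    then show "a = b" using fwd[of a] fwd[of b] by metis
  qed
  ultimately show ?thesis unfolding bij_betw_def by blast
qed

text \<open>
  The permutations \<open>p\<close>, \<open>q\<close> and \<open>inv (p \<circ> q)\<close> have product 1, hence can be rotated cyclically; on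
  bicubic maps this turns the root around the root vertex.
\<close>

definition rot :: "'a hypermap \<Rightarrow> 'a hypermap" where
  "rot = (\<lambda>(p, q, r). (q, inv (p \<circ> q), r))"

lemma ncyc_inv: "f permutes E \<Longrightarrow> finite E \<Longrightarrow> ncyc E (inv f) = ncyc E f"
  unfolding ncyc_def using orbit_inv_eq permutation_permutes by (metis (no_types, lifting) image_cong)

lemma inv_closed:
  assumes "f permutes E" "finite E" "A \<subseteq> E" "inv f ` A \<subseteq> A" shows "f ` A \<subseteq> A"
proof -
  have "finite A" by (rule finite_subset[OF assms(3,2)])
  moreover have "inj_on (inv f) A"
    by (rule inj_on_subset[OF permutes_inj[OF permutes_inv[OF assms(1)]] subset_UNIV])
  ultimately have A: "A = inv f ` A" using endo_inj_surj assms(4) by metis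
  show ?thesis
  proof
    fix y assume "y \<in> f ` A"
    then obtain x where "x \<in> A" "y = f x" by blast
    moreover obtain z where "z \<in> A" "x = inv f z" using A \<open>x \<in> A\<close> by blast
    ultimately show "y \<in> A" using permutes_inverses(1)[OF assms(1)] by metis
  qed
qed

text \<open>With \<open>s = inv (p \<circ> q)\<close> the product \<open>q \<circ> s\<close> is
  \<open>inv p\<close>, and inversion preserves cycles: the three systems of cycles trade places. In
  particular the cycles of \<open>inv p\<close> met by the root cycle of \<open>q\<close> are those
  counted by \<open>cst\<close>.\<close>

lemma rot_hmap:
  assumes h: "hmap E p q r" and s: "s = inv (p \<circ> q)"
  shows "hmap E q s r" "ast q s r = cst p q r" "q \<circ> s = inv p"
proof -
  note D = hmapD[OF h]
  have w: "p \<circ> q permutes E" by (rule hmap_comp_permutes[OF h])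
  have sE: "s permutes E" unfolding s by (rule permutes_inv[OF w])
  have "s = inv q \<circ> inv p" unfolding s using o_inv_distrib D permutes_bij by metis
  then show qs: "q \<circ> s = inv p" using permutes_inv_o(1)[OF D(3)] by (simp add: comp_assoc[symmetric])
  have "conn E q s"
  proof (rule conn_rootI[OF D(3) sE D(1,4)])
    fix A assume A: "A \<subseteq> E" "r \<in> A" "q ` A \<subseteq> A" "s ` A \<subseteq> A"
    have "inv p ` A \<subseteq> A" unfolding qs[symmetric] by (rule comp_closed[OF A(3,4)])
    then have "p ` A \<subseteq> A" by (rule inv_closed[OF D(2,1) A(1)])
    then show "A = E" using connD[OF D(5) A(1,2)] A(3) by blast
  qed
  moreover have "chi E q s = chi E p q"
    unfolding chi_def qs unfolding s using ncyc_inv[OF w D(1)] ncyc_inv[OF D(2,1)] by simp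
  ultimately show "hmap E q s r" using D sE by (simp add: hmap_def)
  have "orbit (inv p) = orbit p" using orbit_inv_eq[of p] D permutation_permutes by blast
  then show "ast q s r = cst p q r" unfolding ast_def cst_def qs by simp
qed

text \<open>\<open>rot\<close> has order three on hypermaps, so \<open>rot \<circ> rot\<close> is
  its inverse.\<close>

lemma rot_bij: "bij_betw rot (hmaps E) (hmaps E)"
proof (rule bij_betw_byWitness[where f' = "rot \<circ> rot"])
  have *: "rot (rot (rot M)) = M \<and> rot M \<in> hmaps E" if "M \<in> hmaps E" for M
  proof -
    obtain p q r where M: "M = (p, q, r)" by (metis prod_cases3)
    have h: "hmap E p q r" using that M by (simp add: hmaps_def)
    note r1 = rot_hmap[OF h refl]
    note r2 = rot_hmap[OF r1(1) refl]
    note r3 = rot_hmap[OF r2(1) refl]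
    have i: "inv (inv f) = f" if "f permutes E" for f using that permutes_inv_inv by blast
    have "inv (q \<circ> inv (p \<circ> q)) = p" unfolding r1(3) using i hmapD[OF h] by blast
    moreover have "inv (inv (p \<circ> q) \<circ> inv (q \<circ> inv (p \<circ> q))) = q"
      unfolding r2(3) using i hmapD[OF h] by blast
    ultimately show ?thesis unfolding M rot_def using r1(1) by (simp add: hmaps_def)
  qed
  show "\<forall>a\<in>hmaps E. (rot \<circ> rot) (rot a) = a" "\<forall>a\<in>hmaps E. rot ((rot \<circ> rot) a) = a" using * by simp_all
  show "rot ` hmaps E \<subseteq> hmaps E" "(rot \<circ> rot) ` hmaps E \<subseteq> hmaps E"
    using * by (blast, metis comp_apply image_subsetI)
qed

section \<open>Relabelling\<close>

text \<open>Bijections are taken on the whole type, so that conjugation makes no reference to a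
  carrier and is undone by \<open>inv h\<close>.\<close>

definition conj_by :: "('a \<Rightarrow> 'b) \<Rightarrow> ('a \<Rightarrow> 'a) \<Rightarrow> 'b \<Rightarrow> 'b" where
  "conj_by h f = h \<circ> f \<circ> inv h"

context
  fixes h :: "'a \<Rightarrow> 'b"
  assumes h: "bij h"
begin

lemma conj_by_apply: "conj_by h f (h x) = h (f x)"
  using h by (simp add: conj_by_def bij_is_inj)

lemma conj_by_comp: "conj_by h f \<circ> conj_by h g = conj_by h (f \<circ> g)"
  using h by (auto simp: conj_by_def fun_eq_iff bij_is_inj)

lemma conj_by_permutes:
  assumes "f permutes E" shows "conj_by h f permutes h ` E"
proof (rule bij_imp_permutes)
  have "bij f" using assms permutes_bij by blast
  have "conj_by h f ` (h ` E) = h ` E"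
    using conj_by_apply permutes_image[OF assms] by (metis (no_types, lifting) image_cong image_image)
  moreover have "inj (conj_by h f)" unfolding conj_by_def
    using h \<open>bij f\<close> by (intro inj_compose bij_is_inj) (auto intro: bij_imp_bij_inv)
  ultimately show "bij_betw (conj_by h f) (h ` E) (h ` E)"
    by (simp add: bij_betw_def inj_on_subset[OF _ subset_UNIV])
  fix y assume "y \<notin> h ` E"
  obtain x where x: "y = h x" using h by (metis bij_pointE)
  then have "x \<notin> E" using \<open>y \<notin> h ` E\<close> by auto
  then show "conj_by h f y = y" using x conj_by_apply permutes_not_in[OF assms] by simp
qed

lemma orbit_conj_by:
  assumes "x \<in> orbit f x" shows "orbit (conj_by h f) (h x) = h ` orbit f x"
  using orbit_inverse[OF assms, of "conj_by h f" h] conj_by_apply by simp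

lemma image_h_inj: "inj_on (image h) S"
  using h by (metis bij_is_inj inj_image_eq_iff inj_onI)

lemma image_closed_iff: "conj_by h f ` (h ` A) \<subseteq> h ` A \<longleftrightarrow> f ` A \<subseteq> A"
proof -
  have "conj_by h f ` (h ` A) = h ` (f ` A)" using conj_by_apply by (auto simp: image_iff)
  then show ?thesis using h by (simp add: bij_is_inj inj_image_subset_iff)
qed

lemma ncyc_conj_by:
  assumes "f permutes E" "finite E" shows "ncyc (h ` E) (conj_by h f) = ncyc E f"
proof -
  have "orbit (conj_by h f) ` (h ` E) = image h ` (orbit f ` E)"
    unfolding image_image using orbit_conj_by orbit_self[OF assms] by (intro image_cong[OF refl]) blast
  then show ?thesis unfolding ncyc_def by (simp only: card_image[OF image_h_inj])
qed

lemma hmap_conj_by: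
  assumes H: "hmap E p q r"
  shows "hmap (h ` E) (conj_by h p) (conj_by h q) (h r)" "ast (conj_by h p) (conj_by h q) (h r) = ast p q r"
    "cst (conj_by h p) (conj_by h q) (h r) = cst p q r"
    "simple_root (conj_by h p) (conj_by h q) (h r) = simple_root p q r"
proof -
  note D = hmapD[OF H]
  have w: "p \<circ> q permutes E" by (rule hmap_comp_permutes[OF H])
  note so = orbit_self[OF D(2,1)] orbit_self[OF D(3,1)] orbit_self[OF w D(1)]
  have "conn (h ` E) (conj_by h p) (conj_by h q)"
    unfolding conn_def
  proof (intro allI impI)
    fix B assume B: "B \<subseteq> h ` E" "B \<noteq> {}" "conj_by h p ` B \<subseteq> B" "conj_by h q ` B \<subseteq> B"
    then obtain A where A: "A \<subseteq> E" "B = h ` A" by (metis subset_imageE)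
    then have "A \<noteq> {}" "p ` A \<subseteq> A" "q ` A \<subseteq> A" using B image_closed_iff by auto
    then show "B = h ` E" using D(5) A unfolding conn_def by blast
  qed
  moreover have "chi (h ` E) (conj_by h p) (conj_by h q) = chi E p q"
    unfolding chi_def conj_by_comp using ncyc_conj_by D w by metis
  moreover have "card (h ` E) = card E" using h by (simp add: card_image bij_is_inj inj_on_subset[OF _ subset_UNIV])
  ultimately show "hmap (h ` E) (conj_by h p) (conj_by h q) (h r)"
    using D conj_by_permutes unfolding hmap_def by auto
  have op: "orbit (conj_by h p) (h x) = h ` orbit p x" and oq: "orbit (conj_by h q) (h x) = h ` orbit q x"
    and ow: "orbit (conj_by h (p \<circ> q)) (h x) = h ` orbit (p \<circ> q) x" for x
    using orbit_conj_by so by auto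
  have "orbit (conj_by h (p \<circ> q)) ` orbit (conj_by h p) (h r) = image h ` (orbit (p \<circ> q) ` orbit p r)"
    unfolding op image_image ow ..
  then show "ast (conj_by h p) (conj_by h q) (h r) = ast p q r"
    unfolding ast_def conj_by_comp by (simp only: card_image[OF image_h_inj])
  have "orbit (conj_by h p) ` orbit (conj_by h q) (h r) = image h ` (orbit p ` orbit q r)"
    unfolding oq image_image op ..
  then show "cst (conj_by h p) (conj_by h q) (h r) = cst p q r"
    unfolding cst_def by (simp only: card_image[OF image_h_inj])
  have "h ` orbit (p \<circ> q) r \<inter> h ` orbit p r = h ` (orbit (p \<circ> q) r \<inter> orbit p r)"
    using h by (simp add: bij_is_inj image_Int)
  moreover have "h ` S = {h r} \<longleftrightarrow> S = {r}" for S
    using h inj_image_eq_iff[of h S "{r}"] by (simp add: bij_is_inj)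
  ultimately show "simple_root (conj_by h p) (conj_by h q) (h r) = simple_root p q r"
    unfolding simple_root_def conj_by_comp op ow by simp
qed

end

lemma conj_by_inv: "bij h \<Longrightarrow> conj_by (inv h) (conj_by h f) = f"
  by (simp add: conj_by_def fun_eq_iff bij_is_inj inv_inv_eq)

definition relabel :: "('a \<Rightarrow> 'b) \<Rightarrow> 'a hypermap \<Rightarrow> 'b hypermap" where
  "relabel h = (\<lambda>(p, q, r). (conj_by h p, conj_by h q, h r))"

lemma relabel_inv: "bij h \<Longrightarrow> relabel (inv h) (relabel h M) = M"
  by (cases M) (simp add: relabel_def conj_by_inv bij_is_inj)

lemma relabel_bij:
  assumes h: "bij h"
  shows "bij_betw (relabel h) (hmaps E) (hmaps (h ` E))" "bij_betw (relabel h) (simple_hmaps E) (simple_hmaps (h ` E))"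
proof -
  have 1: "relabel h ` hmaps E \<subseteq> hmaps (h ` E) \<and> relabel h ` simple_hmaps E \<subseteq> simple_hmaps (h ` E)"
    if "bij h" for h :: "'c \<Rightarrow> 'd" and E
    using hmap_conj_by[OF that] by (auto simp: relabel_def hmaps_def simple_hmaps_def)
  have i: "bij (inv h)" "inv h ` h ` E = E" "inv (inv h) = h"
    using h by (auto simp: bij_imp_bij_inv image_image bij_is_inj inv_inv_eq)
  have 2: "\<forall>b. relabel h (relabel (inv h) b) = b" using relabel_inv[OF i(1)] i(3) by simp
  have 3: "\<forall>a. relabel (inv h) (relabel h a) = a" using relabel_inv[OF h] by blast
  show "bij_betw (relabel h) (hmaps E) (hmaps (h ` E))"
    by (rule bij_betw_byWitness[where f' = "relabel (inv h)"]) (use 1[OF h, of E] 1[OF i(1), of "h ` E"] 2 3 i in auto)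
  show "bij_betw (relabel h) (simple_hmaps E) (simple_hmaps (h ` E))"
    by (rule bij_betw_byWitness[where f' = "relabel (inv h)"]) (use 1[OF h, of E] 1[OF i(1), of "h ` E"] 2 3 i in auto)
qed

text \<open>Swapping \<open>A - B\<close> with \<open>B - A\<close> and fixing everything else gives
  an involution of the whole type, as relabelling requires.\<close>

lemma finite_bij_extends:
  assumes "finite A" "finite B" "card A = card B"
  obtains h :: "'a \<Rightarrow> 'a" where "bij h" "h ` A = B"
proof -
  have "card (A - B) = card (B - A)"
    using assms by (metis card_Diff_subset_Int finite_Int inf_commute)
  then obtain f where f: "bij_betw f (A - B) (B - A)"
    using assms by (metis finite_same_card_bij finite_Diff)
  let ?g = "inv_into (A - B) f"
  have g: "bij_betw ?g (B - A) (A - B)" by (rule bij_betw_inv_into[OF f])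
  define h where "h x = (if x \<in> A - B then f x else if x \<in> B - A then ?g x else x)" for x
  have fg: "x \<in> A - B \<Longrightarrow> f x \<in> B - A \<and> ?g (f x) = x" "x \<in> B - A \<Longrightarrow> ?g x \<in> A - B \<and> f (?g x) = x" for x
    using f g bij_betwE bij_betw_inv_into_left[OF f] bij_betw_inv_into_right[OF f] by metis+
  have hh: "h (h x) = x" for x
    using fg[of x] unfolding h_def by auto
  have "bij h" by (rule o_bij[of h]) (auto simp: hh)
  moreover have "h ` A = B"
  proof -
    have "x \<in> A \<longleftrightarrow> h x \<in> B" for x using fg[of x] unfolding h_def by auto
    then show ?thesis using hh by (metis image_iff subsetI subset_antisym image_subset_iff)
  qed
  ultimately show thesis using that by blast
qed

section \<open>Generating functions\<close>

text \<open>Multiplying the equation for \<open>F\<close> by the last factor of the one for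
  \<open>f\<close> allows \<open>T\<close> to be replaced, and \<open>F\<close> becomes a quotient
  with denominator \<open>dF\<close>; likewise \<open>G\<close> with \<open>dG\<close>. Equality of
  the two quotients is then the compatibility of the equations for \<open>f\<close> and
  \<open>g\<close>, which share the same \<open>T\<close>.\<close>

lemma symmetric_solution:
  fixes X Y :: real and T F G f g p :: "real fps"
  defines "x \<equiv> fps_const X" and "y \<equiv> fps_const Y"
  assumes X: "X \<noteq> 1" and Y: "Y \<noteq> 1" and T: "T \<noteq> 0"
    and zero: "fps_nth f 0 = 0" "fps_nth g 0 = 0" "fps_nth p 0 = 0"
    and F: "(x - 1) * F = T * (x + f) * ((x - 1) * y + (x - 1 + y) * F - y * g)"
    and G: "(y - 1) * G = T * (y + g) * ((y - 1) * x + (y - 1 + x) * G - x * f)"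
    and f: "(x - 1) * f = T * (x + f) * ((x - 1) + x * f - p)"
    and g: "(y - 1) * g = T * (y + g) * ((y - 1) + y * g - p)"
  shows "F = G"
proof -
  \<comment> \<open>The denominators left by the elimination; exchanging \<open>x\<close>,
    \<open>f\<close> with \<open>y\<close>, \<open>g\<close> swaps them.\<close>
  define dF where "dF = x - 1 - p - f * (y - 1)"
  define dG where "dG = y - 1 - p - g * (x - 1)"
  have x1: "x - 1 \<noteq> 0" and y1: "y - 1 \<noteq> 0"
    using X Y unfolding x_def y_def by (simp_all add: fps_const_sub[symmetric] del: fps_const_sub)
  have "(x - 1) * (F * dF) = (x - 1) * (y * f * (x - 1 - g))"
  proof -
    have "(x - 1) * F * (x - 1 + x * f - p) = T * (x + f) * (x - 1 + x * f - p) * ((x - 1) * y + (x - 1 + y) * F - y * g)"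
      unfolding F by (simp only: mult_ac)
    also have "\<dots> = (x - 1) * f * ((x - 1) * y + (x - 1 + y) * F - y * g)" unfolding f ..
    finally show ?thesis unfolding dF_def by algebra
  qed
  then have 1: "F * dF = y * f * (x - 1 - g)" using x1 by simp
  have "(y - 1) * (G * dG) = (y - 1) * (x * g * (y - 1 - f))"
  proof -
    have "(y - 1) * G * (y - 1 + y * g - p) = T * (y + g) * (y - 1 + y * g - p) * ((y - 1) * x + (y - 1 + x) * G - x * f)"
      unfolding G by (simp only: mult_ac)
    also have "\<dots> = (y - 1) * g * ((y - 1) * x + (y - 1 + x) * G - x * f)" unfolding g ..
    finally show ?thesis unfolding dG_def by algebra
  qed
  then have 2: "G * dG = x * g * (y - 1 - f)" using y1 by simp
  \<comment> \<open>Both equations carry the factor \<open>T\<close>; multiplying them crosswise and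
    cancelling it leaves a relation free of \<open>T\<close>.\<close>
  have "T * (f * (x - 1) * (y + g) * ((y - 1) + y * g - p)) = (x - 1) * f * (T * (y + g) * ((y - 1) + y * g - p))"
    by (simp only: mult_ac)
  also have "\<dots> = (y - 1) * g * ((x - 1) * f)" unfolding g[symmetric] by (simp only: mult_ac)
  also have "\<dots> = T * (g * (y - 1) * (x + f) * ((x - 1) + x * f - p))" unfolding f by (simp only: mult_ac)
  finally have "f * (x - 1) * (y + g) * ((y - 1) + y * g - p) = g * (y - 1) * (x + f) * ((x - 1) + x * f - p)"
    using T by simp
  then have "y * f * (x - 1 - g) * dG = x * g * (y - 1 - f) * dF"
    unfolding dF_def dG_def by algebra
  then have "F * (dF * dG) = G * (dF * dG)" using 1 2 by algebra
  \<comment> \<open>Since \<open>f\<close>, \<open>g\<close> and \<open>p\<close> have no constant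
    term, those of the denominators are \<open>X - 1\<close> and \<open>Y - 1\<close>.\<close>
  moreover have "fps_nth dF 0 \<noteq> 0" "fps_nth dG 0 \<noteq> 0"
    using X Y zero unfolding dF_def dG_def x_def y_def by simp_all
  then have "dF * dG \<noteq> 0" by auto
  ultimately show ?thesis by simp
qed

text \<open>The identities are obtained for arguments above 1, where \<open>x - 1\<close> may be
  cancelled; infinitely many values determine a polynomial.\<close>

lemma polyfun_coeffs_eq:
  fixes a b :: "nat \<Rightarrow> real"
  assumes "\<And>x. x > 1 \<Longrightarrow> (\<Sum>i\<le>n. a i * x ^ i) = (\<Sum>i\<le>n. b i * x ^ i)" "k \<le> n"
  shows "a k = b k"
proof (rule ccontr)
  assume "a k \<noteq> b k"
  then have "finite {x. (\<Sum>i\<le>n. (a i - b i) * x ^ i) = 0}"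
    using assms(2) polyfun_rootbound[of "\<lambda>i. a i - b i" k n] by simp
  moreover have "{1<..} \<subseteq> {x. (\<Sum>i\<le>n. (a i - b i) * x ^ i) = 0}"
    using assms(1) by (auto simp: left_diff_distrib sum_subtractf)
  ultimately show False using finite_subset infinite_Ioi by blast
qed

text \<open>Coefficients are compared one variable at a time: for fixed \<open>y\<close> as
  polynomials in \<open>x\<close>, then the coefficient of \<open>x ^ i\<close> as a polynomial in
  \<open>y\<close>.\<close>

lemma weighted_sum_eq_imp_card_eq:
  fixes a c :: "'m \<Rightarrow> nat"
  assumes fin: "finite S"
    and eq: "\<And>x y :: real. x > 1 \<Longrightarrow> y > 1 \<Longrightarrow> (\<Sum>M\<in>S. x ^ a M * y ^ c M) = (\<Sum>M\<in>S. x ^ c M * y ^ a M)"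
  shows "card {M \<in> S. a M = i \<and> c M = j} = card {M \<in> S. c M = i \<and> a M = j}"
proof -
  obtain n where n: "\<forall>M\<in>S. a M \<le> n \<and> c M \<le> n" and ij: "i \<le> n" "j \<le> n"
  proof
    let ?A = "insert i (insert j (a ` S \<union> c ` S))"
    have "m \<le> Max ?A" if "m \<in> ?A" for m by (rule Max_ge) (use fin that in auto)
    then show "\<forall>M\<in>S. a M \<le> Max ?A \<and> c M \<le> Max ?A" "i \<le> Max ?A" "j \<le> Max ?A" by blast+
  qed
  have expand: "(\<Sum>M\<in>S. x ^ u M * y ^ v M) = (\<Sum>k\<le>n. (\<Sum>l\<le>n. real (card {M \<in> S. u M = k \<and> v M = l}) * y ^ l) * x ^ k)"
    if uv: "\<forall>M\<in>S. u M \<le> n \<and> v M \<le> n" for u v and x y :: real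
  proof -
    have 1: "(\<Sum>M\<in>S. x ^ u M * y ^ v M) = (\<Sum>kl\<in>{..n} \<times> {..n}. \<Sum>M\<in>{M \<in> S. (u M, v M) = kl}. x ^ u M * y ^ v M)"
      by (rule sum.group[symmetric]) (use fin uv in auto)
    also have "\<dots> = (\<Sum>k\<le>n. \<Sum>l\<le>n. \<Sum>M\<in>{M \<in> S. (u M, v M) = (k, l)}. x ^ u M * y ^ v M)"
      unfolding sum.cartesian_product
    proof (rule sum.cong[OF refl])
      fix kl :: "nat \<times> nat"
      show "(\<Sum>M\<in>{M \<in> S. (u M, v M) = kl}. x ^ u M * y ^ v M) =
          (case kl of (k, l) \<Rightarrow> \<Sum>M\<in>{M \<in> S. (u M, v M) = (k, l)}. x ^ u M * y ^ v M)"
        by (cases kl) (simp only: prod.case)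
    qed
    also have "\<dots> = (\<Sum>k\<le>n. \<Sum>l\<le>n. real (card {M \<in> S. u M = k \<and> v M = l}) * y ^ l * x ^ k)"
      by (intro sum.cong refl) simp
    finally show ?thesis by (simp add: sum_distrib_right)
  qed
  have "(\<Sum>l\<le>n. real (card {M \<in> S. a M = i \<and> c M = l}) * y ^ l) = (\<Sum>l\<le>n. real (card {M \<in> S. c M = i \<and> a M = l}) * y ^ l)"
    if "y > 1" for y :: real
  proof (rule polyfun_coeffs_eq[OF _ ij(1)])
    fix x :: real assume "x > 1"
    have "\<forall>M\<in>S. c M \<le> n \<and> a M \<le> n" using n by blast
    from eq[OF \<open>x > 1\<close> that, unfolded expand[OF n] expand[OF this]]
    show "(\<Sum>k\<le>n. (\<Sum>l\<le>n. real (card {M \<in> S. a M = k \<and> c M = l}) * y ^ l) * x ^ k) =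
        (\<Sum>k\<le>n. (\<Sum>l\<le>n. real (card {M \<in> S. c M = k \<and> a M = l}) * y ^ l) * x ^ k)" .
  qed
  then have "real (card {M \<in> S. a M = i \<and> c M = j}) = real (card {M \<in> S. c M = i \<and> a M = j})"
    by (rule polyfun_coeffs_eq[OF _ ij(2)])
  then show ?thesis by simp
qed

section \<open>Weighted sums over labelled hypermaps\<close>

definition weight :: "real \<Rightarrow> real \<Rightarrow> 'a hypermap \<Rightarrow> real" where
  "weight x y = (\<lambda>(p, q, r). x ^ ast p q r * y ^ cst p q r)"

definition hsum :: "real \<Rightarrow> real \<Rightarrow> 'a set \<Rightarrow> real" where
  "hsum x y E = (\<Sum>M\<in>hmaps E. weight x y M)"

definition simple_hsum :: "real \<Rightarrow> real \<Rightarrow> 'a set \<Rightarrow> real" where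
  "simple_hsum x y E = (\<Sum>M\<in>simple_hmaps E. weight x y M)"

lemma finite_hmaps: assumes "finite E" shows "finite (hmaps E)"
proof (rule finite_subset)
  show "hmaps E \<subseteq> {p. p permutes E} \<times> {p. p permutes E} \<times> E"
    by (auto simp: hmaps_def hmap_def)
qed (use assms finite_permutations in blast)

lemma simple_hmaps_subset: "simple_hmaps E \<subseteq> hmaps E"
  by (auto simp: simple_hmaps_def hmaps_def)

text \<open>Relabelling preserves weights, so the sums depend only on the number of labels.\<close>

lemma hsum_cong_card:
  fixes A B :: "'a set"
  assumes "finite A" "finite B" "card A = card B"
  shows "hsum x y A = hsum x y B" "simple_hsum x y A = simple_hsum x y B"
proof -
  obtain h :: "'a \<Rightarrow> 'a" where h: "bij h" "h ` A = B" using finite_bij_extends[OF assms] .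
  have w: "weight x y (relabel h M) = weight x y M" if "M \<in> hmaps A" for M
    using that hmap_conj_by(2,3)[OF h(1)] by (auto simp: weight_def relabel_def hmaps_def)
  have "hsum x y B = (\<Sum>M\<in>hmaps A. weight x y (relabel h M))"
    unfolding hsum_def h(2)[symmetric] by (rule sum.reindex_bij_betw[OF relabel_bij(1)[OF h(1)], symmetric])
  also have "\<dots> = hsum x y A" unfolding hsum_def by (rule sum.cong[OF refl w])
  finally show "hsum x y A = hsum x y B" ..
  have "simple_hsum x y B = (\<Sum>M\<in>simple_hmaps A. weight x y (relabel h M))"
    unfolding simple_hsum_def h(2)[symmetric] by (rule sum.reindex_bij_betw[OF relabel_bij(2)[OF h(1)], symmetric])
  also have "\<dots> = simple_hsum x y A"
    unfolding simple_hsum_def by (rule sum.cong[OF refl w]) (use simple_hmaps_subset in blast)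
  finally show "simple_hsum x y A = simple_hsum x y B" ..
qed

lemma hsum_rot:
  assumes "finite E" shows "hsum 1 y E = hsum y 1 E"
proof -
  have "hsum y 1 E = (\<Sum>M\<in>hmaps E. weight y 1 (rot M))"
    unfolding hsum_def by (rule sum.reindex_bij_betw[OF rot_bij, symmetric])
  also have "\<dots> = hsum 1 y E" unfolding hsum_def
  proof (rule sum.cong[OF refl])
    fix M assume "M \<in> hmaps E"
    then obtain p q r where "M = (p, q, r)" "hmap E p q r" by (auto simp: hmaps_def)
    then show "weight y 1 (rot M) = weight 1 y M"
      using rot_hmap(2)[of E p q r] by (simp add: weight_def rot_def)
  qed
  finally show ?thesis ..
qed

text \<open>The second statistic comes from the simple part alone, hence \<open>hsum x 1\<close> for
  the other part; the factor \<open>x\<close> compensates for the face of colour 1 shared by both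
  parts.\<close>

lemma hsum_glue:
  assumes fin: "finite E"
  shows "x * hsum x y E = x * simple_hsum x y E + (\<Sum>E1\<in>Pow E. simple_hsum x y E1 * hsum x 1 (E - E1))"
proof -
  let ?D = "SIGMA E1:Pow E. simple_hmaps E1 \<times> hmaps (E - E1)"
  have finP: "finite (Pow E)" using fin by simp
  have finS: "finite (simple_hmaps A)" "finite (hmaps (E - A))" if "A \<in> Pow E" for A
    using that fin finite_hmaps finite_subset[OF simple_hmaps_subset finite_hmaps] finite_subset by blast+
  have "hsum x y E = simple_hsum x y E + (\<Sum>M\<in>hmaps E - simple_hmaps E. weight x y M)"
    unfolding hsum_def simple_hsum_def
    using sum.subset_diff[OF simple_hmaps_subset finite_hmaps[OF fin], of "weight x y"] by (simp add: add.commute)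
  moreover have "x * (\<Sum>M\<in>hmaps E - simple_hmaps E. weight x y M) = (\<Sum>a\<in>?D. x * weight x y (glue a))"
    unfolding sum_distrib_left by (rule sum.reindex_bij_betw[OF glue_bij, symmetric])
  moreover have "(\<Sum>a\<in>?D. x * weight x y (glue a)) = (\<Sum>(E1, N, P)\<in>?D. weight x y N * weight x 1 P)"
  proof (rule sum.cong[OF refl])
    fix a assume a: "a \<in> ?D"
    obtain E1 p1 q1 r1 p2 q2 e where eq: "a = (E1, (p1, q1, r1), (p2, q2, e))" by (metis prod_cases7 prod.collapse)
    obtain p q r where g: "glue (E1, (p1, q1, r1), (p2, q2, e)) = (p, q, r)" by (metis prod_cases3)
    note st = glue_stats[OF a[unfolded eq] g]
    have "x * x ^ ast p q r = x ^ ast p1 q1 r1 * x ^ ast p2 q2 e"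
      unfolding power_Suc[symmetric] st(1) power_add ..
    then show "x * weight x y (glue a) = (case a of (E1, N, P) \<Rightarrow> weight x y N * weight x 1 P)"
      unfolding eq g weight_def by (simp add: st(2))
  qed
  moreover have "(\<Sum>(E1, N, P)\<in>?D. weight x y N * weight x 1 P) =
      (\<Sum>E1\<in>Pow E. \<Sum>(N, P)\<in>simple_hmaps E1 \<times> hmaps (E - E1). weight x y N * weight x 1 P)"
    using finP finS by (subst sum.Sigma) (auto simp: case_prod_unfold)
  moreover have "\<dots> = (\<Sum>E1\<in>Pow E. simple_hsum x y E1 * hsum x 1 (E - E1))"
    unfolding simple_hsum_def hsum_def by (simp add: sum_product sum.cartesian_product)
  ultimately show ?thesis by (simp add: distrib_left)
qed

text \<open>The ranks of the elements of \<open>C\<close> run through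
  \<open>0, ..., card C - 1\<close>, so this is a geometric sum; multiplying by \<open>x - 1\<close>
  avoids a division.\<close>

lemma sum_power_ranks:
  fixes x :: real
  assumes "finite C"
  shows "(x - 1) * (\<Sum>k\<in>C. x ^ card (C \<inter> {..<k::nat})) = x ^ card C - 1"
  using assms
proof (induction C rule: finite_linorder_max_induct)
  case (insert b C)
  have "insert b C \<inter> {..<k} = C \<inter> {..<k}" if "k \<in> C" for k using insert that by fastforce
  moreover have "insert b C \<inter> {..<b} = C" using insert by auto
  moreover have "b \<notin> C" using insert by auto
  ultimately have "(\<Sum>k\<in>insert b C. x ^ card (insert b C \<inter> {..<k})) = x ^ card C + (\<Sum>k\<in>C. x ^ card (C \<inter> {..<k}))"
    using insert by simp
  then show ?case using insert \<open>b \<notin> C\<close> by (simp add: algebra_simps)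
qed simp

lemma finite_corners: assumes "M \<in> hmaps E" shows "finite (corners M)"
proof -
  obtain p q r where M: "M = (p, q, r)" "hmap E p q r" using assms by (auto simp: hmaps_def)
  note D = hmapD[OF M(2)]
  let ?g = "\<lambda>i. orbit (p \<circ> q) ((p ^^ i) r)"
  have "(p ^^ i) r \<in> E" for i
    using funpow_in_orbit[OF orbit_self[OF D(2,1)]] permutes_orbit_subset[OF D(2,4)] by blast
  then have "?g ` first_occ ?g \<subseteq> orbit (p \<circ> q) ` E" by auto
  then have "finite (?g ` first_occ ?g)" using D(1) finite_subset by (metis finite_imageI)
  then show ?thesis unfolding M corners_def by (simp add: finite_image_iff[OF first_occ_inj])
qed

text \<open>Inserting without closing contributes \<open>x\<close> times the weight of the smaller
  hypermap; closing at its corners gives a geometric sum, which produces the difference from the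
  weight at \<open>x = 1\<close>.\<close>

lemma simple_hsum_attach:
  assumes fin: "finite E" and "card E \<ge> 2"
  shows "(x - 1) * simple_hsum x y E =
    (\<Sum>r\<in>E. x * ((x - 1) * hsum x y (E - {r}) + y * (hsum x y (E - {r}) - hsum 1 y (E - {r}))))"
proof -
  let ?D = "SIGMA r:E. SIGMA M:hmaps (E - {r}). insert 0 (corners M)"
  have inner: "(\<Sum>k\<in>insert 0 (corners M). (x - 1) * weight x y (attach (r, M, k))) =
      x * ((x - 1) * weight x y M + y * (weight x y M - weight 1 y M))"
    if r: "r \<in> E" and M: "M \<in> hmaps (E - {r})" for r M
  proof -
    obtain p' q' r' where eq: "M = (p', q', r')" and h: "hmap (E - {r}) p' q' r'" using M by (auto simp: hmaps_def)
    let ?C = "corners M"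
    have w: "weight x y (attach (r, M, k)) =
        (if k = 0 then x * weight x y M else x * y * y ^ cst p' q' r' * x ^ card (?C \<inter> {..<k}))"
      if "k \<in> insert 0 ?C" for k
    proof -
      obtain p q s where at: "attach (r, (p', q', r'), k) = (p, q, s)" by (metis prod_cases3)
      note st = attach_correct[OF r h that[unfolded eq] at]
      show ?thesis unfolding eq at weight_def using st by simp
    qed
    have "0 \<notin> ?C" unfolding eq corners_def first_occ_def by simp
    then have "(\<Sum>k\<in>insert 0 ?C. (x - 1) * weight x y (attach (r, M, k))) =
        (x - 1) * (x * weight x y M) + (\<Sum>k\<in>?C. (x - 1) * weight x y (attach (r, M, k)))"
      using finite_corners[OF M] w[of 0] by simp
    also have "(\<Sum>k\<in>?C. (x - 1) * weight x y (attach (r, M, k))) =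
        x * y * y ^ cst p' q' r' * ((x - 1) * (\<Sum>k\<in>?C. x ^ card (?C \<inter> {..<k})))"
      unfolding sum_distrib_left
    proof (rule sum.cong[OF refl])
      fix k assume k: "k \<in> ?C"
      then have "k \<noteq> 0" using \<open>0 \<notin> ?C\<close> by metis
      then show "(x - 1) * weight x y (attach (r, M, k)) = x * y * y ^ cst p' q' r' * ((x - 1) * x ^ card (?C \<inter> {..<k}))"
        using w[of k] k by simp
    qed
    also have "(x - 1) * (\<Sum>k\<in>?C. x ^ card (?C \<inter> {..<k})) = x ^ ast p' q' r' - 1"
      using sum_power_ranks[OF finite_corners[OF M]] card_corners[of p' q' r'] eq by simp
    finally show ?thesis by (simp add: eq weight_def algebra_simps)
  qed
  have finM: "finite (hmaps (E - {r}))" for r using fin finite_hmaps by blast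
  have "(x - 1) * simple_hsum x y E = (\<Sum>a\<in>?D. (x - 1) * weight x y (attach a))"
    unfolding simple_hsum_def sum_distrib_left by (rule sum.reindex_bij_betw[OF attach_bij[OF assms(2)], symmetric])
  also have "\<dots> = (\<Sum>r\<in>E. \<Sum>b\<in>(SIGMA M:hmaps (E - {r}). insert 0 (corners M)). (x - 1) * weight x y (attach (r, b)))"
    using fin finM finite_corners by (subst sum.Sigma) (auto simp: case_prod_unfold intro!: finite_SigmaI)
  also have "\<dots> = (\<Sum>r\<in>E. \<Sum>M\<in>hmaps (E - {r}). \<Sum>k\<in>insert 0 (corners M). (x - 1) * weight x y (attach (r, M, k)))"
    using finM finite_corners by (intro sum.cong refl, subst sum.Sigma) (auto simp: case_prod_unfold)
  also have "\<dots> = (\<Sum>r\<in>E. \<Sum>M\<in>hmaps (E - {r}). x * ((x - 1) * weight x y M + y * (weight x y M - weight 1 y M)))"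
    by (intro sum.cong refl inner)
  also have "\<dots> = (\<Sum>r\<in>E. x * ((x - 1) * hsum x y (E - {r}) + y * (hsum x y (E - {r}) - hsum 1 y (E - {r}))))"
    unfolding hsum_def by (simp add: sum_distrib_left[symmetric] sum.distrib sum_subtractf)
  finally show ?thesis .
qed

lemma hsum_empty: "hsum x y ({} :: 'a set) = 0" "simple_hsum x y ({} :: 'a set) = 0"
proof -
  have "hmaps ({} :: 'a set) = {}" by (auto simp: hmaps_def hmap_def)
  then show "hsum x y ({} :: 'a set) = 0" "simple_hsum x y ({} :: 'a set) = 0"
    using simple_hmaps_subset[of "{} :: 'a set"] by (simp_all add: hsum_def simple_hsum_def)
qed

lemma simple_hsum_single: "simple_hsum x y {e} = x * y"
proof -
  have o: "orbit id z = {z}" for z :: 'a by (simp add: orbit_eq_singleton_iff)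
  have p: "p permutes {e} \<longleftrightarrow> p = id" for p by (metis permutes_id permutes_sing)
  have "hmap {e} id id e" by (auto simp: hmap_def conn_def chi_def ncyc_id permutes_id)
  moreover have "simple_root id id e" by (simp add: simple_root_def o)
  ultimately have "simple_hmaps {e} = {(id, id, e)}"
    unfolding simple_hmaps_def by (auto simp: hmap_def p)
  then show ?thesis by (simp add: simple_hsum_def weight_def ast_def cst_def o)
qed

section \<open>Exponential generating functions and the functional equation\<close>

definition hgf :: "real \<Rightarrow> real \<Rightarrow> real fps" where
  "hgf x y = Abs_fps (\<lambda>n. hsum x y {..<n} / fact n)"

definition simple_hgf :: "real \<Rightarrow> real \<Rightarrow> real fps" where
  "simple_hgf x y = Abs_fps (\<lambda>n. simple_hsum x y {..<n} / fact n)"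

text \<open>The product formula for labelled structures: distributing \<open>n\<close> labels over
  sets of sizes \<open>k\<close> and \<open>n - k\<close> gives the binomial coefficient that the
  factorials absorb.\<close>

lemma hgf_glue: "fps_const x * hgf x y = simple_hgf x y * (fps_const x + hgf x 1)"
proof -
  have "(\<Sum>E1\<in>Pow {..<n}. simple_hsum x y E1 * hsum x 1 ({..<n} - E1)) / fact n = fps_nth (simple_hgf x y * hgf x 1) n" for n
  proof -
    let ?g = "\<lambda>k. simple_hsum x y {..<k} * hsum x 1 {..<n - k}"
    have "(\<Sum>E1\<in>Pow {..<n}. simple_hsum x y E1 * hsum x 1 ({..<n} - E1)) = (\<Sum>E1\<in>Pow {..<n}. ?g (card E1))"
    proof (rule sum.cong[OF refl])
      fix A assume "A \<in> Pow {..<n}"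
      then have A: "A \<subseteq> {..<n}" "finite A" using finite_subset by auto
      have "simple_hsum x y A = simple_hsum x y {..<card A}" by (rule hsum_cong_card) (use A in auto)
      moreover have "hsum x 1 ({..<n} - A) = hsum x 1 {..<n - card A}"
        by (rule hsum_cong_card) (use A in \<open>auto simp: card_Diff_subset\<close>)
      ultimately show "simple_hsum x y A * hsum x 1 ({..<n} - A) = ?g (card A)" by simp
    qed
    also have "\<dots> = (\<Sum>k\<le>n. \<Sum>E1\<in>{A \<in> Pow {..<n}. card A = k}. ?g (card E1))"
      by (rule sum.group[symmetric]) (auto intro!: subset_eq_atLeast0_lessThan_card simp: atLeast0LessThan)
    also have "\<dots> = (\<Sum>k\<le>n. real (n choose k) * ?g k)"
    proof (rule sum.cong[OF refl])
      fix k
      have "{A \<in> Pow {..<n}. card A = k} = {A. A \<subseteq> {..<n} \<and> card A = k}" by auto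
      then show "(\<Sum>E1\<in>{A \<in> Pow {..<n}. card A = k}. ?g (card E1)) = real (n choose k) * ?g k"
        using n_subsets[of "{..<n}" k] by simp
    qed
    also have "\<dots> / fact n = (\<Sum>k\<le>n. (simple_hsum x y {..<k} / fact k) * (hsum x 1 {..<n - k} / fact (n - k)))"
      unfolding sum_divide_distrib by (rule sum.cong[OF refl]) (simp add: binomial_fact field_simps)
    finally show ?thesis by (simp add: fps_mult_nth simple_hgf_def hgf_def atMost_atLeast0)
  qed
  then have "fps_nth (fps_const x * hgf x y) n = fps_nth (simple_hgf x y * (fps_const x + hgf x 1)) n" for n
    using hsum_glue[of "{..<n}" x y]
    by (simp add: distrib_left hgf_def add_divide_distrib mult.commute simple_hgf_def)
  then show ?thesis by (rule fps_ext)
qed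

text \<open>The root carries one of \<open>n\<close> labels, and this factor turns
  \<open>1 / fact n\<close> into \<open>1 / fact (n - 1)\<close>, that is, into multiplication by
  \<open>fps_X\<close>. The term without \<open>hgf\<close> stands for the one-point
  hypermap.\<close>

lemma hgf_attach:
  "(fps_const x - 1) * simple_hgf x y = fps_X * (fps_const x * ((fps_const x - 1) * fps_const y
     + (fps_const x - 1) * hgf x y + fps_const y * (hgf x y - hgf 1 y)))"
proof (rule fps_ext)
  fix n
  have c: "fps_const x - 1 = fps_const (x - 1)" by (simp add: fps_const_sub[symmetric] del: fps_const_sub)
  show "fps_nth ((fps_const x - 1) * simple_hgf x y) n = fps_nth (fps_X * (fps_const x * ((fps_const x - 1) * fps_const y
     + (fps_const x - 1) * hgf x y + fps_const y * (hgf x y - hgf 1 y)))) n"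
  proof (cases n)
    case 0
    then show ?thesis by (simp add: c simple_hgf_def hsum_empty)
  next
    case (Suc m)
    show ?thesis
    proof (cases "m = 0")
      case True
      have "{..<Suc 0} = {0::nat}" by auto
      then show ?thesis using Suc True by (simp add: c simple_hgf_def hgf_def hsum_empty simple_hsum_single)
    next
      case False
      have "hsum x y ({..<n} - {r}) = hsum x y {..<m}" if "r < n" for r x y
        by (rule hsum_cong_card) (use that Suc in auto)
      moreover define R where "R = x * ((x - 1) * hsum x y {..<m} + y * (hsum x y {..<m} - hsum 1 y {..<m}))"
      ultimately have "(x - 1) * simple_hsum x y {..<n} = real (Suc m) * R"
        using simple_hsum_attach[of "{..<n}" x y] Suc False by simp
      then have "(x - 1) * simple_hsum x y {..<n} / fact n = real (Suc m) * R / (real (Suc m) * fact m)"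
        unfolding Suc fact_Suc by (simp only:)
      also have "\<dots> = R / fact m" by (rule mult_divide_mult_cancel_left) simp
      finally have "(x - 1) * simple_hsum x y {..<n} / fact n = R / fact m" .
      moreover have "fps_nth (fps_const y) m = 0" "fps_nth (fps_const (x - 1) * fps_const y) m = 0" using False by simp_all
      ultimately show ?thesis unfolding c using Suc
        by (simp add: simple_hgf_def hgf_def R_def add_divide_distrib[symmetric] diff_divide_distrib[symmetric])
    qed
  qed
qed

text \<open>Gluing expresses all hypermaps through the simple ones, attaching expresses these
  through all; \<open>simple_hgf\<close> is eliminated, and \<open>hgf 1 y\<close> is rewritten by
  turning the root.\<close>

lemma hgf_functional_equation:
  assumes "x \<noteq> 0"
  shows "(fps_const x - 1) * hgf x y = fps_X * (fps_const x + hgf x 1) *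
    ((fps_const x - 1) * fps_const y + (fps_const x - 1 + fps_const y) * hgf x y - fps_const y * hgf y 1)"
proof -
  have r: "hgf 1 y = hgf y 1" unfolding hgf_def by (simp add: hsum_rot)
  have "fps_const x * ((fps_const x - 1) * hgf x y) = (fps_const x - 1) * simple_hgf x y * (fps_const x + hgf x 1)"
    unfolding mult.assoc hgf_glue[symmetric] by (simp only: mult_ac)
  also have "\<dots> = fps_const x * (fps_X * (fps_const x + hgf x 1) *
    ((fps_const x - 1) * fps_const y + (fps_const x - 1 + fps_const y) * hgf x y - fps_const y * hgf y 1))"
    unfolding hgf_attach r by (simp only: algebra_simps)
  finally show ?thesis using assms by simp
qed

lemma hgf_symmetric:
  assumes "x > 1" "y > 1" shows "hgf x y = hgf y x"
proof (rule symmetric_solution[where T = fps_X and f = "hgf x 1" and g = "hgf y 1" and p = "hgf 1 1" and X = x and Y = y])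
  show "fps_nth (hgf x 1) 0 = 0" "fps_nth (hgf y 1) 0 = 0" "fps_nth (hgf 1 1) 0 = 0" by (simp_all add: hgf_def hsum_empty)
qed (use assms hgf_functional_equation[of x y] hgf_functional_equation[of y x]
    hgf_functional_equation[of x 1] hgf_functional_equation[of y 1] in simp_all)

lemma hmaps_equidistributed:
  "card {(p, q, r) \<in> hmaps {..<n::nat}. ast p q r = i \<and> cst p q r = j} =
   card {(p, q, r) \<in> hmaps {..<n}. cst p q r = i \<and> ast p q r = j}"
proof -
  let ?a = "\<lambda>(p, q, r). ast p q r" and ?c = "\<lambda>(p, q, r). cst p q r"
  have "(\<Sum>M\<in>hmaps {..<n}. x ^ ?a M * y ^ ?c M) = (\<Sum>M\<in>hmaps {..<n}. x ^ ?c M * y ^ ?a M)"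
    if "x > 1" "y > 1" for x y :: real
  proof -
    have "hsum x y {..<n} / fact n = hsum y x {..<n} / fact n"
      using arg_cong[OF hgf_symmetric[OF that], of "\<lambda>F. fps_nth F n"] by (simp add: hgf_def)
    then have "hsum x y {..<n} = hsum y x {..<n}" by simp
    then show ?thesis by (simp add: hsum_def weight_def case_prod_unfold mult.commute)
  qed
  from weighted_sum_eq_imp_card_eq[where S = "hmaps {..<n}" and a = ?a and c = ?c and i = i and j = j, OF finite_hmaps this]
  show ?thesis by (simp add: case_prod_unfold)
qed

section \<open>Properly coloured cubic maps\<close>

definition nxt :: "nat \<Rightarrow> nat" where "nxt k = k mod 3 + 1"
text \<open>Adding 1 before and after the reduction amounts to subtracting 1 modulo 3.\<close>

definition prv :: "nat \<Rightarrow> nat" where "prv k = (k + 1) mod 3 + 1"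

lemma nxt_prv:
  "k \<in> {1, 2, 3} \<Longrightarrow> nxt (prv k) = k" "k \<in> {1, 2, 3} \<Longrightarrow> prv (nxt k) = k"
  "nxt k \<noteq> k" "prv k \<noteq> k" "nxt k \<in> {1, 2, 3}" "prv k \<in> {1, 2, 3}"
proof -
  have "k mod 3 < 3" "(k + 1) mod 3 < 3" by simp_all
  then show "nxt k \<in> {1, 2, 3}" "prv k \<in> {1, 2, 3}" unfolding nxt_def prv_def by auto
  show "nxt k \<noteq> k" "prv k \<noteq> k" unfolding nxt_def prv_def by presburger+
qed (auto simp: nxt_def prv_def)

lemma prv_values: "prv 3 = 2" "prv 2 = 1" "prv 1 = 3" "nxt 1 = 2" "nxt 2 = 3" "nxt 3 = 1"
  by (simp_all add: prv_def nxt_def)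

locale dart_map =
  fixes M :: "'d rooted_map" and D c t r
  assumes wf: "wf_map M"
  defines "D \<equiv> darts M" and "c \<equiv> ccw M" and "t \<equiv> opp M" and "r \<equiv> root_dart M"
begin

lemma finD: "finite D" and rD: "r \<in> D" and cD: "c permutes D" and tD: "t permutes D"
  and t_neq: "d \<in> D \<Longrightarrow> t d \<noteq> d" and tt: "d \<in> D \<Longrightarrow> t (t d) = d"
  using wf unfolding wf_map_def D_def c_def t_def r_def by auto

lemma in_D: "d \<in> D \<Longrightarrow> c d \<in> D" "d \<in> D \<Longrightarrow> t d \<in> D"
  using permutes_in_image[OF cD] permutes_in_image[OF tD] by auto

lemma connected_iff: "connected_map M \<longleftrightarrow> conn D c t"
proof
  let ?R = "{(d, e). e = c d \<or> e = t d}"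
  assume con: "connected_map M"
  have rt: "e \<in> A" if "(d, e) \<in> ?R\<^sup>*" "d \<in> A" "c ` A \<subseteq> A" "t ` A \<subseteq> A" for A d e
    using that by (induction rule: rtrancl_induct) auto
  show "conn D c t"
    unfolding conn_def
  proof (intro allI impI)
    fix A assume A: "A \<subseteq> D" "A \<noteq> {}" "c ` A \<subseteq> A" "t ` A \<subseteq> A"
    then obtain d where d: "d \<in> A" by blast
    have "e \<in> A" if "e \<in> D" for e
    proof (rule rt[OF _ d A(3,4)])
      show "(d, e) \<in> ?R\<^sup>*" using con d A(1) that unfolding connected_map_def D_def c_def t_def by blast
    qed
    then show "A = D" using A(1) by blast
  qed
next
  assume con: "conn D c t"
  let ?R = "{(d, e). e = c d \<or> e = t d}"
  have "(d, e) \<in> ?R\<^sup>*" if d: "d \<in> D" and e: "e \<in> D" for d e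
  proof -
    let ?A = "{x \<in> D. (d, x) \<in> ?R\<^sup>*}"
    have step: "(d, y) \<in> ?R\<^sup>*" if "(d, x) \<in> ?R\<^sup>*" "y = c x \<or> y = t x" for x y
      by (rule rtrancl_into_rtrancl[OF that(1)]) (use that(2) in simp)
    have "?A = D"
      by (rule connD[OF con, of ?A d]) (use d in_D step in auto)
    then show ?thesis using e by blast
  qed
  then show "connected_map M" unfolding connected_map_def D_def c_def t_def by blast
qed

definition phi where "phi = c \<circ> t"

lemma phiD: "phi permutes D" unfolding phi_def by (rule permutes_compose[OF tD cD])

lemma phi_in: "d \<in> D \<Longrightarrow> phi d \<in> D" using permutes_in_image[OF phiD] by simp

lemma face_eq: "face M d = orbit phi d" unfolding face_def phi_def c_def t_def ..

lemma vertex_eq: "vertex M d = orbit c d" unfolding vertex_def c_def ..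

lemma face_self: "d \<in> face M d" unfolding face_eq by (rule orbit_self[OF phiD finD])

lemma vertex_self: "d \<in> vertex M d" unfolding vertex_eq by (rule orbit_self[OF cD finD])

lemma face_mem_iff: "face M d = face M e \<longleftrightarrow> d \<in> face M e"
  unfolding face_eq by (rule orbit_eq_iff[OF phiD finD])

lemma vertex_mem_iff: "vertex M d = vertex M e \<longleftrightarrow> d \<in> vertex M e"
  unfolding vertex_eq by (rule orbit_eq_iff[OF cD finD])

lemma face_phi: "face M (phi d) = face M d"
  unfolding face_mem_iff unfolding face_eq by (rule orbit.base)

lemma vertex_c: "vertex M (c d) = vertex M d"
  unfolding vertex_mem_iff unfolding vertex_eq by (rule orbit.base)

text \<open>The face to the left of \<open>d\<close> is the one to the right of both
  \<open>t d\<close> and \<open>c d\<close>, so an edge separates the faces of \<open>d\<close> and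
  \<open>c d\<close>.\<close>

lemma face_t: assumes "d \<in> D" shows "face M (t d) = face M (c d)"
  using face_phi[of "t d"] tt[OF assms] unfolding phi_def by simp

end

text \<open>Colours sit on darts: \<open>col d\<close> belongs to the face on the right of
  \<open>d\<close>, and \<open>blk d\<close> says that \<open>d\<close> starts at a black vertex.
  Around black vertices the cyclic order is reversed, hence \<open>prv\<close>. That
  \<open>col\<close> is constant on faces is derived from these rules.\<close>

locale coloured_map = dart_map +
  fixes blk :: "'a \<Rightarrow> bool" and col :: "'a \<Rightarrow> nat"
  assumes con: "conn D c t"
    and c3: "d \<in> D \<Longrightarrow> c (c (c d)) = d"
    and blk_c: "d \<in> D \<Longrightarrow> blk (c d) = blk d" and blk_t: "d \<in> D \<Longrightarrow> blk (t d) = (\<not> blk d)"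
    and col_range: "d \<in> D \<Longrightarrow> col d \<in> {1, 2, 3}"
    and col_c: "d \<in> D \<Longrightarrow> col (c d) = (if blk d then prv (col d) else nxt (col d))"
    and col_t: "d \<in> D \<Longrightarrow> col (t d) = col (c d)"
    and blk_r: "blk r" and col_r: "col r = 3"
begin

lemma connD': "r \<in> A \<Longrightarrow> (\<And>d. d \<in> A \<Longrightarrow> d \<in> D \<Longrightarrow> c d \<in> A) \<Longrightarrow> (\<And>d. d \<in> A \<Longrightarrow> d \<in> D \<Longrightarrow> t d \<in> A) \<Longrightarrow> D \<subseteq> A"
  using connD[OF con, of "A \<inter> D" r] rD in_D by auto

text \<open>Crossing the edge turns the colour one way, and the step around the vertex at its other
  end, which has the opposite vertex colour, turns it back.\<close>

lemma phi_blk: "d \<in> D \<Longrightarrow> blk (phi d) = (\<not> blk d)" and phi_col: "d \<in> D \<Longrightarrow> col (phi d) = col d"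
proof -
  assume d: "d \<in> D"
  note td = in_D(2)[OF d]
  show "blk (phi d) = (\<not> blk d)" unfolding phi_def using blk_c[OF td] blk_t[OF d] by simp
  show "col (phi d) = col d"
    unfolding phi_def using col_c[OF td] blk_t[OF d] col_t[OF d] col_c[OF d] col_range[OF d] nxt_prv by simp
qed

lemma col_c_neq: "d \<in> D \<Longrightarrow> col (c d) \<noteq> col d" using col_c nxt_prv(3,4) by simp

lemma col_cc_neq: assumes "d \<in> D" shows "col (c (c d)) \<noteq> col d"
  using col_c[OF in_D(1)[OF assms]] col_c[OF assms] blk_c[OF assms] col_range[OF assms]
  by (auto simp: prv_def nxt_def)

lemma c_neq: "d \<in> D \<Longrightarrow> c d \<noteq> d" "d \<in> D \<Longrightarrow> c (c d) \<noteq> d"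
  using col_c_neq col_cc_neq by metis+

lemma vertex_three: assumes "d \<in> D" shows "vertex M d = {d, c d, c (c d)}"
  unfolding vertex_eq by (rule orbit_period_3[where f = c, OF c3[OF assms]])

lemma cubic: "cubic M"
proof -
  have "card (vertex M d) = 3" if d: "d \<in> D" for d
    unfolding vertex_three[OF d] using c_neq[OF d] c_neq(1)[OF in_D(1)[OF d]] by auto
  then show ?thesis unfolding cubic_def vertices_def D_def[symmetric] by auto
qed

lemma col_face: assumes d: "d \<in> D" and e: "e \<in> face M d" shows "col e = col d"
proof -
  have "e \<in> D \<and> col e = col d" using e unfolding face_eq
    by induction (use d phi_in phi_col in auto)
  then show ?thesis by simp
qed

definition B where "B = vertex M ` {d \<in> D. blk d}"

lemma B_iff: assumes d: "d \<in> D" shows "vertex M d \<in> B \<longleftrightarrow> blk d"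
proof
  assume "vertex M d \<in> B"
  then obtain e where e: "e \<in> D" "blk e" "vertex M d = vertex M e" unfolding B_def by auto
  then have "d \<in> {e, c e, c (c e)}" using vertex_self[of d] vertex_three by simp
  then show "blk d" using e(1,2) blk_c[OF e(1)] blk_c[OF in_D(1)[OF e(1)]] by auto
qed (use d in \<open>auto simp: B_def\<close>)

lemma bicolouring_B: "bicolouring M B"
  unfolding bicolouring_def D_def[symmetric] t_def[symmetric] vertices_def
  using B_iff in_D blk_t by (auto simp: B_def D_def)

lemma bicolouring_unique:
  assumes b: "bicolouring M B'" and rt: "root_vertex M \<in> B'" shows "B' = B"
proof -
  have "D \<subseteq> {d. vertex M d \<in> B' \<longleftrightarrow> blk d}"
  proof (rule connD')
    show "r \<in> {d. vertex M d \<in> B' \<longleftrightarrow> blk d}" using rt blk_r unfolding root_vertex_def r_def by simp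
    fix d assume d: "d \<in> {d. vertex M d \<in> B' \<longleftrightarrow> blk d}" "d \<in> D"
    show "c d \<in> {d. vertex M d \<in> B' \<longleftrightarrow> blk d}" using d vertex_c blk_c by simp
    show "t d \<in> {d. vertex M d \<in> B' \<longleftrightarrow> blk d}"
      using d blk_t b unfolding bicolouring_def D_def[symmetric] t_def[symmetric] by auto
  qed
  moreover have "B' \<subseteq> vertex M ` D" "B \<subseteq> vertex M ` D" using b unfolding bicolouring_def vertices_def D_def B_def by auto
  ultimately show ?thesis using B_iff by blast
qed

lemma black_eq: "black_vertices M = B"
  unfolding black_vertices_def
proof (rule the_equality)
  show "bicolouring M B \<and> root_vertex M \<in> B"
    using bicolouring_B B_iff[OF rD] blk_r unfolding root_vertex_def r_def by simp
qed (use bicolouring_unique in blast)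

lemma white_iff: "d \<in> D \<Longrightarrow> vertex M d \<in> white_vertices M \<longleftrightarrow> \<not> blk d"
  unfolding white_vertices_def black_eq vertices_def using B_iff D_def by auto

text \<open>Any dart of the face gives the same value by \<open>col_face\<close>; the restriction
  makes the function extensional, as \<open>face_colouring\<close> demands.\<close>

definition fcol where "fcol = restrict (\<lambda>f. col (SOME d. d \<in> f)) (faces M)"

lemma fcol_face: assumes d: "d \<in> D" shows "fcol (face M d) = col d"
proof -
  have "(SOME e. e \<in> face M d) \<in> face M d" using face_self by (rule someI)
  then show ?thesis using col_face[OF d] d unfolding fcol_def faces_def D_def by simp
qed

lemma touch_iff:
  "touch M f g \<longleftrightarrow> (\<exists>d\<in>D. (d \<in> f \<or> t d \<in> f) \<and> (d \<in> g \<or> t d \<in> g))"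
  unfolding touch_def edges_def edge_def D_def[symmetric] t_def[symmetric] by auto

lemma fcol_colouring: "face_colouring M fcol"
  unfolding face_colouring_def
proof (intro conjI ballI impI)
  show "fcol \<in> faces M \<rightarrow>\<^sub>E {1, 2, 3}"
  proof
    fix f assume "f \<in> faces M"
    then obtain d where "d \<in> D" "f = face M d" unfolding faces_def D_def by auto
    then show "fcol f \<in> {1, 2, 3}" using fcol_face col_range by simp
  qed (simp add: fcol_def)
next
  fix f g assume fg: "f \<in> faces M" "g \<in> faces M" "f \<noteq> g \<and> touch M f g"
  obtain x y where x: "x \<in> D" "f = face M x" and y: "y \<in> D" "g = face M y"
    using fg(1,2) unfolding faces_def D_def by auto
  obtain d where d: "d \<in> D" "d \<in> f \<or> t d \<in> f" "d \<in> g \<or> t d \<in> g" using fg(3) touch_iff by auto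
  have f: "e \<in> f \<Longrightarrow> f = face M e" "e \<in> g \<Longrightarrow> g = face M e" for e using x y face_mem_iff by metis+
  then have "f = face M d \<and> g = face M (t d) \<or> f = face M (t d) \<and> g = face M d" using d fg(3) by metis
  then show "fcol f \<noteq> fcol g" using fcol_face[OF d(1)] fcol_face[OF in_D(2)[OF d(1)]] col_t[OF d(1)] col_c_neq[OF d(1)] by auto
next
  fix d assume d: "d \<in> darts M" "vertex M d \<in> white_vertices M"
  then have dD: "d \<in> D" by (simp add: D_def)
  then show "fcol (face M (ccw M d)) = fcol (face M d) mod 3 + 1"
    using d(2) white_iff fcol_face[OF dD] fcol_face[OF in_D(1)[OF dD]] col_c[OF dD] unfolding c_def nxt_def by simp
next
  show "fcol (root_face M) = 3" using fcol_face[OF rD] col_r unfolding root_face_def r_def by simp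
qed

text \<open>The colour of the root face propagates along \<open>c\<close> and \<open>t\<close>. The
  definition prescribes the cyclic order at white vertices; at a black vertex it is taken from the
  white end of the edge.\<close>

lemma colouring_unique: assumes k: "face_colouring M k" shows "k = fcol"
proof -
  have kr: "k (face M d) \<in> {1, 2, 3}" if "d \<in> D" for d
    using k that unfolding face_colouring_def faces_def D_def by (auto simp: PiE_def Pi_def)
  have kw: "k (face M (c d)) = nxt (k (face M d))" if "d \<in> D" "\<not> blk d" for d
    using k that white_iff unfolding face_colouring_def D_def c_def nxt_def by auto
  have "D \<subseteq> {d. k (face M d) = col d}"
  proof (rule connD')
    show "r \<in> {d. k (face M d) = col d}" using k col_r unfolding face_colouring_def root_face_def r_def by simp
    fix d assume d: "d \<in> {d. k (face M d) = col d}" "d \<in> D"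
    have ct: "k (face M (c d)) = col (c d)"
    proof (cases "blk d")
      case True
      \<comment> \<open>\<open>c (t d)\<close> lies on the face of \<open>d\<close>, and
        \<open>t d\<close> on that of \<open>c d\<close>, so the white rule at the other end relates
        the same two faces.\<close>
      have "k (face M (c (t d))) = nxt (k (face M (t d)))" using kw[of "t d"] in_D d blk_t True by simp
      then have "col d = nxt (k (face M (c d)))" using face_phi[of d] d face_t unfolding phi_def by simp
      then show ?thesis using nxt_prv(2)[OF kr] in_D d col_c[OF d(2)] True by simp
    next
      case False
      then show ?thesis using kw[OF d(2)] col_c[OF d(2)] d by simp
    qed
    then show "c d \<in> {d. k (face M d) = col d}" by simp
    show "t d \<in> {d. k (face M d) = col d}" using ct face_t col_t d by simp
  qed
  then have "k f = fcol f" if "f \<in> faces M" for f using that fcol_face unfolding faces_def D_def by auto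
  moreover have "k \<in> extensional (faces M)" "fcol \<in> extensional (faces M)"
    using k fcol_colouring unfolding face_colouring_def by (auto simp: PiE_def)
  ultimately show ?thesis by (metis extensionalityI)
qed

lemma face_colour_face: "d \<in> D \<Longrightarrow> face_colour M (face M d) = col d"
  using fcol_face the_equality[of "face_colouring M" fcol] fcol_colouring colouring_unique
  unfolding face_colour_def by metis

lemma root_cols: "col (c r) = 2" "col (c (c r)) = 1"
  using col_c[OF rD] col_c[OF in_D(1)[OF rD]] blk_c[OF rD] blk_r col_r prv_values by simp_all

lemma face_at_root_eq:
  assumes "d \<in> root_vertex M" shows "face_at_root M (col d) = face M d"
proof -
  have rv: "root_vertex M = {r, c r, c (c r)}" unfolding root_vertex_def r_def[symmetric] by (rule vertex_three[OF rD])
  have rvD: "root_vertex M \<subseteq> D" unfolding rv using rD in_D by auto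
  show ?thesis unfolding face_at_root_def
  proof (rule the_equality)
    show "face M d \<in> faces M \<and> face M d \<inter> root_vertex M \<noteq> {} \<and> face_colour M (face M d) = col d"
      using assms rvD face_self face_colour_face unfolding faces_def D_def[symmetric] by auto
    fix f assume f: "f \<in> faces M \<and> f \<inter> root_vertex M \<noteq> {} \<and> face_colour M f = col d"
    then obtain e where e: "e \<in> f" "e \<in> root_vertex M" by blast
    then have "f = face M e" using f face_mem_iff unfolding faces_def by auto
    moreover have "col e = col d" using calculation f face_colour_face e rvD by auto
    then have "e = d" using e(2) assms root_cols col_r unfolding rv by auto
    ultimately show "f = face M d" by simp
  qed
qed

lemma face_at_root_3: "face_at_root M 3 = face M r" and face_at_root_2: "face_at_root M 2 = face M (c r)"
proof -
  have "r \<in> root_vertex M" "c r \<in> root_vertex M"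
    unfolding root_vertex_def r_def[symmetric] vertex_three[OF rD] by auto
  from this[THEN face_at_root_eq] show "face_at_root M 3 = face M r" "face_at_root M 2 = face M (c r)"
    using col_r root_cols by simp_all
qed

text \<open>Representatives of the black vertices, one dart each; \<open>c e\<close> and
  \<open>c (c e)\<close> carry the colours 2 and 1.\<close>

definition E where "E = {d \<in> D. blk d \<and> col d = 3}"
text \<open>Vertex colours alternate along a face, so the next black vertex is two steps of
  \<open>phi\<close> away. \<open>P\<close> is this double step along the face of \<open>e\<close>;
  \<open>Q\<close> is its conjugate by \<open>c\<close>, following the face of
  \<open>c e\<close>.\<close>

definition P where "P = c \<circ> t \<circ> c \<circ> t"
definition Q where "Q = t \<circ> c \<circ> t \<circ> c"
definition p where "p = perm_restrict P E"
definition q where "q = perm_restrict Q E"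

lemma E_sub: "E \<subseteq> D" and rE: "r \<in> E" unfolding E_def using rD blk_r col_r by auto

lemma finE: "finite E" by (rule finite_subset[OF E_sub finD])

lemma E_cols: assumes "e \<in> E"
  shows "e \<in> D" "blk e" "col e = 3" "blk (c e)" "col (c e) = 2" "blk (c (c e))" "col (c (c e)) = 1"
  using assms col_c[of e] col_c[of "c e"] blk_c[of e] blk_c[of "c e"] in_D[of e] in_D[of "c e"] prv_values
  unfolding E_def by auto

lemma black_cases:
  assumes d: "d \<in> D" "blk d"
  obtains e where "e \<in> E" "d = e" | e where "e \<in> E" "d = c e" | e where "e \<in> E" "d = c (c e)"
proof -
  have "col d = 1 \<or> col d = 2 \<or> col d = 3" using col_range[OF d(1)] by auto
  then consider "col d = 3" | "col d = 2" | "col d = 1" by blast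
  then show thesis
  proof cases
    case 1 then show ?thesis using that(1) d unfolding E_def by blast
  next
    case 2
    have "col (c d) = 1" using col_c[OF d(1)] d 2 prv_values by simp
    then have "c (c d) \<in> E" using col_c[of "c d"] blk_c in_D d prv_values unfolding E_def by simp
    then show ?thesis using that(2)[of "c (c d)"] c3[OF d(1)] by simp
  next
    case 3
    have "c d \<in> E" using col_c[OF d(1)] d 3 prv_values blk_c in_D unfolding E_def by simp
    then show ?thesis using that(3)[of "c d"] c3[OF d(1)] by simp
  qed
qed

lemma P_phi: "P = phi \<circ> phi" unfolding P_def phi_def by (simp add: comp_assoc)

lemma P_in: "P ` E \<subseteq> E" unfolding P_phi E_def using phi_in phi_blk phi_col by auto

lemma c_Q: assumes "e \<in> D" shows "c (Q e) = phi (phi (c e))"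
  unfolding Q_def phi_def by simp

lemma Q_in: "Q ` E \<subseteq> E"
proof
  fix y assume "y \<in> Q ` E"
  then obtain e where e: "e \<in> E" "y = Q e" by blast
  note ec = E_cols[OF e(1)]
  have yD: "y \<in> D" unfolding e(2) Q_def using ec(1) in_D by simp
  have "c y = phi (phi (c e))" unfolding e(2) by (rule c_Q[OF ec(1)])
  then have "blk (c y)" "col (c y) = 2" using ec phi_blk phi_col phi_in in_D by auto
  then show "y \<in> E" using blk_c[OF yD] col_c[OF yD] col_range[OF yD] yD prv_values unfolding E_def by (auto simp: prv_def)
qed

lemma PD: "P permutes D" and QD: "Q permutes D"
  unfolding P_def Q_def using permutes_compose cD tD by blast+

lemma pE: "p permutes E" and qE: "q permutes E"
  unfolding p_def q_def
  using perm_restrict_permutes[OF PD finD E_sub P_in] perm_restrict_permutes[OF QD finD E_sub Q_in] by auto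

lemma p_apply: "e \<in> E \<Longrightarrow> p e = P e" and q_apply: "e \<in> E \<Longrightarrow> q e = Q e"
  unfolding p_def q_def perm_restrict_def by auto

lemma wE: "p \<circ> q permutes E" by (rule permutes_compose[OF qE pE])

text \<open>The product moves around the face of colour 1 against the direction of
  \<open>phi\<close>; its cycles are therefore compared with faces through the inverse.\<close>

lemma phi_cc: assumes e: "e \<in> E" shows "phi (phi (c (c ((p \<circ> q) e)))) = c (c e)"
proof -
  have q: "q e \<in> E" "q e \<in> D" "e \<in> D" using permutes_in_image[OF qE] e E_sub by auto
  have "(p \<circ> q) e = P (Q e)" using p_apply q_apply q e by simp
  also have "\<dots> = c (t (c (c (t (c e)))))" unfolding P_def Q_def using tt in_D q by simp
  finally have "c (c ((p \<circ> q) e)) = t (c (c (t (c e))))" using c3 in_D q by simp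
  then show ?thesis unfolding phi_def using tt in_D q c3 by simp
qed

lemma phi_pow: assumes "d \<in> D" shows "(phi ^^ n) d \<in> D \<and> (blk ((phi ^^ n) d) \<longleftrightarrow> (blk d \<longleftrightarrow> even n))"
  by (induction n) (use assms phi_in phi_blk in auto)

text \<open>\<open>g e\<close> stands for the dart at the black vertex of \<open>e\<close> on the
  face of a given colour, and \<open>f\<close> for the induced double step. Two black darts of one
  face differ by an even power of \<open>phi\<close>, because \<open>phi\<close> alternates the
  vertex colours; hence faces correspond to cycles of \<open>f\<close>.\<close>

lemma face_orbit_iff:
  assumes f: "f permutes E" and g: "\<And>e. e \<in> E \<Longrightarrow> g e \<in> D \<and> blk (g e)" "inj_on g E"
    and fg: "\<And>e. e \<in> E \<Longrightarrow> g (f e) = phi (phi (g e))"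
    and e: "e \<in> E" "e' \<in> E"
  shows "face M (g e) = face M (g e') \<longleftrightarrow> orbit f e = orbit f e'"
proof
  assume "orbit f e = orbit f e'"
  then have "e \<in> orbit f e'" using orbit_eq_iff[OF f finE] by simp
  then have "e \<in> E \<and> face M (g e) = face M (g e')"
    by induction (use e fg face_phi permutes_in_image[OF f] in auto)
  then show "face M (g e) = face M (g e')" by simp
next
  assume "face M (g e) = face M (g e')"
  then have "g e \<in> orbit phi (g e')" using face_mem_iff unfolding face_eq by simp
  then obtain n where n: "g e = (phi ^^ n) (g e')" unfolding orbit_altdef by blast
  then have "even n" using phi_pow[of "g e'" n] g(1)[OF e(1)] g(1)[OF e(2)] by auto
  then obtain m where m: "n = 2 * m" by blast
  have it: "(phi ^^ (2 * m)) (g e') = g ((f ^^ m) e') \<and> (f ^^ m) e' \<in> E" for m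
    by (induction m) (use e fg permutes_in_image[OF f] in auto)
  have "e = (f ^^ m) e'" using it[of m] n m g(2) e(1) by (metis inj_onD)
  then have "e \<in> orbit f e'" using funpow_in_orbit[OF orbit_self[OF f finE]] by metis
  then show "orbit f e = orbit f e'" using orbit_eq_iff[OF f finE] by simp
qed

lemma c_inj: "inj c" by (rule permutes_inj[OF cD])

lemma face_E_iff:
  assumes "e \<in> E" "e' \<in> E"
  shows "face M e = face M e' \<longleftrightarrow> orbit p e = orbit p e'"
    "face M (c e) = face M (c e') \<longleftrightarrow> orbit q e = orbit q e'"
    "face M (c (c e)) = face M (c (c e')) \<longleftrightarrow> orbit (p \<circ> q) e = orbit (p \<circ> q) e'"
proof -
  show "face M e = face M e' \<longleftrightarrow> orbit p e = orbit p e'"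
    by (rule face_orbit_iff[OF pE, of "\<lambda>e. e"]) (use assms E_cols p_apply P_phi in auto)
  show "face M (c e) = face M (c e') \<longleftrightarrow> orbit q e = orbit q e'"
    by (rule face_orbit_iff[OF qE, of c])
      (use assms E_cols q_apply c_Q in_D inj_on_subset[OF c_inj] in auto)
  have w: "inv (p \<circ> q) permutes E" by (rule permutes_inv[OF wE])
  have "face M (c (c e)) = face M (c (c e')) \<longleftrightarrow> orbit (inv (p \<circ> q)) e = orbit (inv (p \<circ> q)) e'"
  proof (rule face_orbit_iff[OF w, of "\<lambda>e. c (c e)"])
    show "inj_on (\<lambda>e. c (c e)) E" using c_inj by (auto simp: inj_on_def inj_def)
    fix x assume x: "x \<in> E"
    have "inv (p \<circ> q) x \<in> E" using permutes_in_image[OF w] x by simp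
    from phi_cc[OF this] show "c (c (inv (p \<circ> q) x)) = phi (phi (c (c x)))"
      unfolding permutes_inverses(1)[OF wE] by simp
  qed (use assms E_cols in_D in auto)
  then show "face M (c (c e)) = face M (c (c e')) \<longleftrightarrow> orbit (p \<circ> q) e = orbit (p \<circ> q) e'"
    using orbit_inv_eq[of "p \<circ> q"] wE finE permutation_permutes by metis
qed

end

lemma card_image_same_kernel:
  assumes "\<And>e e'. e \<in> A \<Longrightarrow> e' \<in> A \<Longrightarrow> F e = F e' \<longleftrightarrow> G e = G e'"
  shows "card (F ` A) = card (G ` A)"
proof -
  have i: "inv_into A F X \<in> A \<and> F (inv_into A F X) = X" if "X \<in> F ` A" for X
    using that by (simp add: inv_into_into f_inv_into_f)
  let ?h = "\<lambda>X. G (inv_into A F X)"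
  have "?h (F e) = G e" if "e \<in> A" for e
    using assms[of "inv_into A F (F e)" e] i[of "F e"] that by blast
  then have "?h ` (F ` A) = G ` A" unfolding image_image by (rule image_cong[OF refl])
  moreover have "inj_on ?h (F ` A)"
  proof (rule inj_onI)
    fix X Y assume X: "X \<in> F ` A" and Y: "Y \<in> F ` A" and eq: "?h X = ?h Y"
    have "F (inv_into A F X) = F (inv_into A F Y)" using assms i[OF X] i[OF Y] eq by blast
    then show "X = Y" using i[OF X] i[OF Y] by simp
  qed
  ultimately show ?thesis using card_image by fastforce
qed

context coloured_map
begin

lemma white_cases:
  assumes d: "d \<in> D" "\<not> blk d"
  obtains e where "e \<in> E" "d = t e" | e where "e \<in> E" "d = c (t e)" | e where "e \<in> E" "d = c (c (t e))"
proof -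
  have *: "t x \<in> E \<and> t (t x) = x" if "x \<in> D" "\<not> blk x" "col x = 2" for x
    using that in_D blk_t col_t col_c tt prv_values unfolding E_def by auto
  have "col d = 1 \<or> col d = 2 \<or> col d = 3" using col_range[OF d(1)] by auto
  then consider "col d = 3" | "col d = 2" | "col d = 1" by blast
  then show thesis
  proof cases
    case 1
    have "col (c (c d)) = 2" using col_c[OF d(1)] col_c[OF in_D(1)[OF d(1)]] blk_c[OF d(1)] d 1 prv_values by simp
    then show ?thesis using that(2)[of "t (c (c d))"] *[of "c (c d)"] in_D d blk_c c3 by simp
  next
    case 2
    then show ?thesis using that(1)[of "t d"] *[of d] d by simp
  next
    case 3
    have "col (c d) = 2" using col_c[OF d(1)] d 3 prv_values by simp
    then show ?thesis using that(3)[of "t (c d)"] *[of "c d"] in_D d blk_c c3 by simp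
  qed
qed

lemma t_E_cols: assumes "e \<in> E"
  shows "t e \<in> D" "\<not> blk (t e)" "col (t e) = 2" "col (c (t e)) = 3" "col (c (c (t e))) = 1"
    "\<not> blk (c (t e))" "\<not> blk (c (c (t e)))"
proof -
  note ec = E_cols[OF assms]
  show 1: "t e \<in> D" "\<not> blk (t e)" "col (t e) = 2" using ec in_D blk_t col_t by auto
  then show 2: "col (c (t e)) = 3" "\<not> blk (c (t e))" using col_c blk_c prv_values by simp_all
  then show "col (c (c (t e))) = 1" "\<not> blk (c (c (t e)))" using 1 col_c[of "c (t e)"] blk_c[of "c (t e)"] in_D prv_values by simp_all
qed

lemma t_inj: "inj t" by (rule permutes_inj[OF tD])

text \<open>The edges \<open>{e, t e}\<close> with \<open>e\<close> in \<open>E\<close> form a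
  perfect matching between black and white vertices.\<close>

lemma card_vertices: "card (vertices M) = 2 * card E"
proof -
  have V: "vertices M = vertex M ` E \<union> (\<lambda>e. vertex M (t e)) ` E"
  proof
    show "vertex M ` E \<union> (\<lambda>e. vertex M (t e)) ` E \<subseteq> vertices M"
      using E_cols(1) t_E_cols(1) unfolding vertices_def D_def[symmetric] by blast
    show "vertices M \<subseteq> vertex M ` E \<union> (\<lambda>e. vertex M (t e)) ` E"
    proof
      fix v assume "v \<in> vertices M"
      then obtain d where d: "d \<in> D" "v = vertex M d" unfolding vertices_def D_def by auto
      show "v \<in> vertex M ` E \<union> (\<lambda>e. vertex M (t e)) ` E"
      proof (cases "blk d")
        case True
        then show ?thesis by (rule black_cases[OF d(1)]) (use d(2) vertex_c in auto)
      next
        case False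
        then show ?thesis by (rule white_cases[OF d(1)]) (use d(2) vertex_c in auto)
      qed
    qed
  qed
  have "inj_on (vertex M) E"
  proof (rule inj_onI)
    fix e e' assume e: "e \<in> E" "e' \<in> E" "vertex M e = vertex M e'"
    then have "e \<in> {e', c e', c (c e')}" using vertex_self[of e] vertex_three[OF E_cols(1)[OF e(2)]] by simp
    then show "e = e'" using E_cols[OF e(1)] E_cols[OF e(2)] by auto
  qed
  moreover have "inj_on (\<lambda>e. vertex M (t e)) E"
  proof (rule inj_onI)
    fix e e' assume e: "e \<in> E" "e' \<in> E" "vertex M (t e) = vertex M (t e')"
    then have "t e \<in> {t e', c (t e'), c (c (t e'))}"
      using vertex_self[of "t e"] vertex_three[OF t_E_cols(1)[OF e(2)]] by simp
    then have "t e = t e'" using t_E_cols[OF e(1)] t_E_cols[OF e(2)] by auto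
    then show "e = e'" using t_inj by (simp add: inj_eq)
  qed
  moreover have "vertex M ` E \<inter> (\<lambda>e. vertex M (t e)) ` E = {}"
  proof -
    have "vertex M e \<noteq> vertex M (t e')" if "e \<in> E" "e' \<in> E" for e e'
      using B_iff[OF E_cols(1)[OF that(1)]] B_iff[OF t_E_cols(1)[OF that(2)]] E_cols(2)[OF that(1)] t_E_cols(2)[OF that(2)] by auto
    then show ?thesis by blast
  qed
  ultimately show ?thesis unfolding V using finE by (simp add: card_Un_disjoint card_image)
qed

text \<open>Each edge has exactly one black dart, and three of these leave every black
  vertex.\<close>

lemma card_edges: "card (edges M) = 3 * card E"
proof -
  let ?K = "{d \<in> D. blk d}"
  have K: "?K = E \<union> c ` E \<union> (\<lambda>e. c (c e)) ` E"
  proof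
    show "?K \<subseteq> E \<union> c ` E \<union> (\<lambda>e. c (c e)) ` E"
    proof
      fix d assume "d \<in> ?K"
      then have "d \<in> D" "blk d" by auto
      then show "d \<in> E \<union> c ` E \<union> (\<lambda>e. c (c e)) ` E" by (rule black_cases) auto
    qed
  qed (use E_cols in_D in auto)
  have cols: "E \<inter> c ` E = {}" "(E \<union> c ` E) \<inter> (\<lambda>e. c (c e)) ` E = {}"
    using E_cols(3,5,7) by fastforce+
  have "inj_on (\<lambda>e. c (c e)) E" "inj_on c E" using c_inj by (auto simp: inj_on_def inj_def)
  then have cK: "card ?K = 3 * card E"
    unfolding K using cols finE by (simp add: card_Un_disjoint card_image)
  have ed: "edge M d = {d, t d}" for d unfolding edge_def t_def ..
  have "edges M = edge M ` ?K"
  proof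
    show "edges M \<subseteq> edge M ` ?K"
    proof
      fix x assume "x \<in> edges M"
      then obtain d where d: "d \<in> D" "x = {d, t d}" unfolding edges_def D_def ed by auto
      show "x \<in> edge M ` ?K"
      proof (cases "blk d")
        case True then show ?thesis using d ed by auto
      next
        case False
        then have "t d \<in> ?K" "x = edge M (t d)" using d ed blk_t in_D tt by auto
        then show ?thesis by blast
      qed
    qed
  qed (auto simp: edges_def D_def)
  moreover have "inj_on (edge M) ?K"
  proof (rule inj_onI)
    fix d e assume "d \<in> ?K" "e \<in> ?K" "edge M d = edge M e"
    then show "d = e" unfolding ed using blk_t by (metis (no_types, lifting) doubleton_eq_iff mem_Collect_eq)
  qed
  ultimately show ?thesis using cK by (simp add: card_image)
qed

text \<open>The colour classes of faces are disjoint and correspond to the cycles of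
  \<open>p\<close>, \<open>q\<close> and the product. With \<open>2 m\<close> vertices and
  \<open>3 m\<close> edges, Euler's formula becomes \<open>chi = m + 2\<close>.\<close>

lemma card_faces: "card (faces M) = chi E p q"
proof -
  let ?F1 = "(\<lambda>e. face M e) ` E" and ?F2 = "(\<lambda>e. face M (c e)) ` E" and ?F3 = "(\<lambda>e. face M (c (c e))) ` E"
  have F: "faces M = ?F1 \<union> ?F2 \<union> ?F3"
  proof
    show "?F1 \<union> ?F2 \<union> ?F3 \<subseteq> faces M" using E_cols(1) in_D unfolding faces_def D_def[symmetric] by blast
    show "faces M \<subseteq> ?F1 \<union> ?F2 \<union> ?F3"
    proof
      fix f assume "f \<in> faces M"
      then obtain d where d: "d \<in> D" "f = face M d" unfolding faces_def D_def by auto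
      obtain b where b: "b \<in> D" "blk b" "f = face M b"
      proof (cases "blk d")
        case False
        then show ?thesis using that[of "phi d"] phi_in phi_blk face_phi d by simp
      qed (use d that in blast)
      from b(1,2) show "f \<in> ?F1 \<union> ?F2 \<union> ?F3" by (rule black_cases) (use b(3) in auto)
    qed
  qed
  have fc: "face_colour M (face M e) = 3" "face_colour M (face M (c e)) = 2" "face_colour M (face M (c (c e))) = 1" if "e \<in> E" for e
    using that E_cols in_D face_colour_face by metis+
  have dis: "?F1 \<inter> ?F2 = {}" "(?F1 \<union> ?F2) \<inter> ?F3 = {}" using fc by fastforce+
  have "card ?F1 = ncyc E p" "card ?F2 = ncyc E q" "card ?F3 = ncyc E (p \<circ> q)"
    unfolding ncyc_def by (rule card_image_same_kernel, rule face_E_iff; assumption)+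
  then show ?thesis unfolding F chi_def using dis finE by (simp add: card_Un_disjoint)
qed

text \<open>For a closed set \<open>A\<close>, the six darts at the black vertex of each
  \<open>a\<close> and at its matched white vertex form a set closed under \<open>c\<close> and
  \<open>t\<close>, hence everything.\<close>

lemma conn_E: "conn E p q"
proof (rule conn_rootI[OF pE qE finE rE])
  fix A assume A: "A \<subseteq> E" "r \<in> A" "p ` A \<subseteq> A" "q ` A \<subseteq> A"
  have AD: "a \<in> D" "a \<in> E" if "a \<in> A" for a using that A(1) E_sub by auto
  have fA: "finite A" by (rule finite_subset[OF A(1) finE])
  have img: "p ` A = A" "q ` A = A"
    using endo_inj_surj[OF fA A(3) inj_on_subset[OF permutes_inj[OF pE]]]
      endo_inj_surj[OF fA A(4) inj_on_subset[OF permutes_inj[OF qE]]] by auto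
  let ?N = "\<lambda>a. {a, c a, c (c a), t a, c (t a), c (c (t a))}"
  define S where "S = (\<Union>a\<in>A. ?N a)"
  have SI: "d \<in> S" if "a \<in> A" "d \<in> ?N a" for a d unfolding S_def using that by (rule UN_I)
  have SE: "\<exists>a\<in>A. d \<in> ?N a" if "d \<in> S" for d using that unfolding S_def by (rule UN_E) (rule bexI)
  have "D \<subseteq> S"
  proof (rule connD')
    show "r \<in> S" by (rule SI[OF A(2)]) simp
    fix d assume d: "d \<in> S" "d \<in> D"
    obtain a where a: "a \<in> A" "d \<in> ?N a" using SE[OF d(1)] by (rule bexE)
    note aD = AD[OF a(1)]
    have "c d \<in> {a, c a, c (c a), t a, c (t a), c (c (t a))}"
      using a(2) c3[OF aD(1)] c3[OF in_D(2)[OF aD(1)]] by auto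
    then show "c d \<in> S" by (rule SI[OF a(1)])
    \<comment> \<open>Apart from the matching edge, \<open>t\<close> leads from the darts of
      \<open>a\<close> to those of \<open>p a\<close>, of \<open>q a\<close> and of the preimages of
      \<open>a\<close>, which lie in \<open>A\<close> because \<open>p\<close> and \<open>q\<close>
      map \<open>A\<close> onto itself.\<close>
    have 1: "t (c a) \<in> S"
    proof -
      have "q a \<in> A" using A(4) a(1) by blast
      moreover have "t (q a) = c (t (c a))" unfolding q_apply[OF aD(2)] Q_def using tt in_D aD by simp
      then have "c (c (t (q a))) = t (c a)" using c3 in_D aD by simp
      ultimately show ?thesis by (intro SI[of "q a"]) auto
    qed
    have 2: "t (c (c a)) \<in> S"
    proof -
      have "a \<in> p ` A" using img(1) a(1) by simp
      then obtain b where b: "b \<in> A" "p b = a" by blast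
      have "c (c a) = t (c (t b))" unfolding b(2)[symmetric] p_apply[OF AD(2)[OF b(1)]] P_def using c3 in_D AD[OF b(1)] by simp
      then have "t (c (c a)) = c (t b)" using tt in_D AD[OF b(1)] by simp
      then show ?thesis by (intro SI[OF b(1)]) auto
    qed
    have 3: "t (c (t a)) \<in> S"
    proof -
      have "p a \<in> A" using A(3) a(1) by blast
      moreover have "c (c (p a)) = t (c (t a))" unfolding p_apply[OF aD(2)] P_def using c3 in_D aD by simp
      ultimately show ?thesis by (intro SI[of "p a"]) auto
    qed
    have 4: "t (c (c (t a))) \<in> S"
    proof -
      have "a \<in> q ` A" using img(2) a(1) by simp
      then obtain b where b: "b \<in> A" "q b = a" by blast
      have "t a = c (t (c b))" unfolding b(2)[symmetric] q_apply[OF AD(2)[OF b(1)]] Q_def using tt in_D AD[OF b(1)] by simp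
      then have "c (c (t a)) = t (c b)" using c3 in_D AD[OF b(1)] by simp
      then have "t (c (c (t a))) = c b" using tt in_D AD[OF b(1)] by simp
      then show ?thesis by (intro SI[OF b(1)]) auto
    qed
    have 5: "t a \<in> S" "t (t a) \<in> S" by (rule SI[OF a(1)], simp add: tt[OF aD(1)])+
    have "d = a \<or> d = c a \<or> d = c (c a) \<or> d = t a \<or> d = c (t a) \<or> d = c (c (t a))" using a(2) by simp
    then show "t d \<in> S" by (elim disjE) (simp_all only: 1 2 3 4 5)
  qed
  moreover have "e \<in> A" if e: "e \<in> E" "e \<in> S" for e
  proof -
    obtain a where a: "a \<in> A" "e \<in> ?N a" using SE[OF e(2)] by (rule bexE)
    then show "e \<in> A" using E_cols[OF AD(2)[OF a(1)]] t_E_cols[OF AD(2)[OF a(1)]] E_cols[OF e(1)] by auto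
  qed
  ultimately show "A = E" using A(1) E_sub by blast
qed

lemma planar_iff: "planar_map M \<longleftrightarrow> chi E p q = card E + 2"
  unfolding planar_map_def card_vertices card_edges card_faces using wf con connected_iff by auto

lemma planar_hmap: "planar_map M \<Longrightarrow> hmap E p q r"
  using planar_iff conn_E finE pE qE rE by (simp add: hmap_def)

lemma bicubic_iff: "bicubic_map M \<longleftrightarrow> chi E p q = card E + 2"
  unfolding bicubic_map_def using planar_iff cubic bicolouring_B unfolding bipartite_def by blast

lemma faces_mem: "f \<in> faces M \<Longrightarrow> x \<in> f \<Longrightarrow> f = face M x"
  using face_mem_iff unfolding faces_def by auto

lemma touch_black:
  assumes "touch M f g" "f \<in> faces M" "g \<in> faces M" "f \<noteq> g"
  obtains b where "b \<in> D" "blk b" "b \<in> f" "t b \<in> g" | b where "b \<in> D" "blk b" "b \<in> g" "t b \<in> f"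
proof -
  have f: "e \<in> f \<Longrightarrow> f = face M e" "e \<in> g \<Longrightarrow> g = face M e" for e
    using assms(2,3) faces_mem by auto
  obtain d where d: "d \<in> D" "d \<in> f \<or> t d \<in> f" "d \<in> g \<or> t d \<in> g" using assms(1) touch_iff by auto
  have "d \<in> f \<and> t d \<in> g \<or> t d \<in> f \<and> d \<in> g" using d f assms(4) by metis
  then show thesis using that(1)[of d] that(2)[of d] that(1)[of "t d"] that(2)[of "t d"] d(1) in_D(2) tt blk_t by metis
qed

text \<open>An edge between faces of colours 1 and 3 has colour 1 to the right of its black dart,
  which is therefore \<open>c (c e)\<close> for some \<open>e\<close>, with the face of
  \<open>e\<close> on its left.\<close>

lemma a_stat_eq: "a_stat M = ast p q r"
proof -
  let ?g = "face M r"
  let ?S = "{f \<in> faces M. face_colour M f = 1 \<and> touch M f ?g}"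
  have osub: "orbit p r \<subseteq> E" by (rule permutes_orbit_subset[OF pE rE])
  have gf: "?g \<in> faces M" "face_colour M ?g = 3" using rD face_colour_face col_r unfolding faces_def D_def by auto
  have "?S = (\<lambda>e. face M (c (c e))) ` orbit p r"
  proof
    show "?S \<subseteq> (\<lambda>e. face M (c (c e))) ` orbit p r"
    proof
      fix f assume f: "f \<in> ?S"
      have mem: "x \<in> f \<Longrightarrow> f = face M x" "x \<in> ?g \<Longrightarrow> ?g = face M x" for x
        using f gf(1) faces_mem by auto
      have "touch M f ?g" "f \<in> faces M" "f \<noteq> ?g" using f gf by auto
      then show "f \<in> (\<lambda>e. face M (c (c e))) ` orbit p r"
      proof (rule touch_black[OF _ _ gf(1)])
        fix b assume b: "b \<in> D" "blk b" "b \<in> f" "t b \<in> ?g"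
        have "col b = 1" using mem(1)[OF b(3)] f face_colour_face[OF b(1)] by simp
        then obtain e where e: "e \<in> E" "b = c (c e)"
          by (rule_tac black_cases[OF b(1,2)]) (use E_cols in auto)
        have "?g = face M (c b)" using mem(2)[OF b(4)] face_t[OF b(1)] by simp
        then have "face M e = face M r" using e c3 E_cols(1) by simp
        then have "e \<in> orbit p r" using face_E_iff(1)[OF e(1) rE] orbit_eq_iff[OF pE finE] by simp
        then show ?thesis using mem(1)[OF b(3)] e(2) by blast
      next
        \<comment> \<open>Impossible: to the left of a black dart of colour 3 lies colour 2.\<close>
        fix b assume b: "b \<in> D" "blk b" "b \<in> ?g" "t b \<in> f"
        have "col b = 3" using mem(2)[OF b(3)] gf(2) face_colour_face[OF b(1)] by simp
        moreover have "col (t b) = 1" using mem(1)[OF b(4)] f face_colour_face[OF in_D(2)[OF b(1)]] by simp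
        ultimately show ?thesis using col_t[OF b(1)] col_c[OF b(1)] b(2) prv_values by simp
      qed
    qed
    show "(\<lambda>e. face M (c (c e))) ` orbit p r \<subseteq> ?S"
    proof
      fix f assume "f \<in> (\<lambda>e. face M (c (c e))) ` orbit p r"
      then obtain e where e: "e \<in> orbit p r" "f = face M (c (c e))" by blast
      have eE: "e \<in> E" using e(1) osub by blast
      have ec: "c (c e) \<in> D" using E_cols(1)[OF eE] in_D by simp
      have "face M (t (c (c e))) = face M e" using face_t[OF ec] c3[OF E_cols(1)[OF eE]] by simp
      also have "\<dots> = ?g" using face_E_iff(1)[OF eE rE] orbit_eq[OF pE finE e(1)] by simp
      finally have "t (c (c e)) \<in> ?g" using face_self by metis
      then have "touch M f ?g" unfolding touch_iff e(2) using ec face_self by blast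
      then show "f \<in> ?S" using e(2) ec face_colour_face[OF ec] E_cols(7)[OF eE] unfolding faces_def D_def by simp
    qed
  qed
  then have "a_stat M = card ((\<lambda>e. face M (c (c e))) ` orbit p r)" unfolding a_stat_def face_at_root_3 by simp
  also have "\<dots> = ast p q r" unfolding ast_def
    by (rule card_image_same_kernel) (use face_E_iff(3) osub in blast)
  finally show ?thesis .
qed

text \<open>Here the black dart of a common edge is \<open>e\<close> itself, with colour 3 on its
  right and the face of \<open>c e\<close> on its left.\<close>

lemma c_stat_eq: "c_stat M = cst p q r"
proof -
  let ?g = "face M (c r)"
  let ?S = "{f \<in> faces M. face_colour M f = 3 \<and> touch M f ?g}"
  have osub: "orbit q r \<subseteq> E" by (rule permutes_orbit_subset[OF qE rE])
  have gf: "?g \<in> faces M" "face_colour M ?g = 2" using rD in_D face_colour_face root_cols unfolding faces_def D_def by auto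
  have "?S = face M ` orbit q r"
  proof
    show "?S \<subseteq> face M ` orbit q r"
    proof
      fix f assume f: "f \<in> ?S"
      have mem: "x \<in> f \<Longrightarrow> f = face M x" "x \<in> ?g \<Longrightarrow> ?g = face M x" for x
        using f gf(1) faces_mem by auto
      have "touch M f ?g" "f \<in> faces M" "f \<noteq> ?g" using f gf by auto
      then show "f \<in> face M ` orbit q r"
      proof (rule touch_black[OF _ _ gf(1)])
        fix b assume b: "b \<in> D" "blk b" "b \<in> f" "t b \<in> ?g"
        have "col b = 3" using mem(1)[OF b(3)] f face_colour_face[OF b(1)] by simp
        then have e: "b \<in> E" using b unfolding E_def by simp
        have "?g = face M (c b)" using mem(2)[OF b(4)] face_t[OF b(1)] by simp
        then have "b \<in> orbit q r" using face_E_iff(2)[OF e rE] orbit_eq_iff[OF qE finE] by simp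
        then show ?thesis using mem(1)[OF b(3)] by blast
      next
        fix b assume b: "b \<in> D" "blk b" "b \<in> ?g" "t b \<in> f"
        have "col b = 2" using mem(2)[OF b(3)] gf(2) face_colour_face[OF b(1)] by simp
        moreover have "col (t b) = 3" using mem(1)[OF b(4)] f face_colour_face[OF in_D(2)[OF b(1)]] by simp
        ultimately show ?thesis using col_t[OF b(1)] col_c[OF b(1)] b(2) prv_values by simp
      qed
    qed
    show "face M ` orbit q r \<subseteq> ?S"
    proof
      fix f assume "f \<in> face M ` orbit q r"
      then obtain e where e: "e \<in> orbit q r" "f = face M e" by blast
      have eE: "e \<in> E" using e(1) osub by blast
      note ec = E_cols(1)[OF eE]
      have "face M (t e) = face M (c e)" using face_t[OF ec] .
      also have "\<dots> = ?g" using face_E_iff(2)[OF eE rE] orbit_eq[OF qE finE e(1)] by simp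
      finally have "t e \<in> ?g" using face_self by metis
      then have "touch M f ?g" unfolding touch_iff e(2) using ec face_self by blast
      then show "f \<in> ?S" using e(2) ec face_colour_face[OF ec] E_cols(3)[OF eE] unfolding faces_def D_def by simp
    qed
  qed
  then have "c_stat M = card (face M ` orbit q r)" unfolding c_stat_def face_at_root_2 by simp
  also have "\<dots> = cst p q r" unfolding cst_def
    by (rule card_image_same_kernel) (use face_E_iff(1) osub in blast)
  finally show ?thesis .
qed

end

section \<open>Existence of the face colouring\<close>

lemma ncyc_uniform:
  assumes "f permutes S" "finite S" "\<And>x. x \<in> S \<Longrightarrow> card (orbit f x) = m"
  shows "m * ncyc S f = card S"
proof -
  have U: "\<Union> (orbit f ` S) = S"
    using permutes_orbit_subset[OF assms(1)] orbit_self[OF assms(1,2)] by blast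
  have "m * card (orbit f ` S) = card (\<Union> (orbit f ` S))"
  proof (rule card_partition)
    show "finite (orbit f ` S)" "finite (\<Union> (orbit f ` S))" using assms(2) U by simp_all
    show "card C = m" if "C \<in> orbit f ` S" for C using that assms(3) by auto
    show "C1 \<inter> C2 = {}" if C: "C1 \<in> orbit f ` S" "C2 \<in> orbit f ` S" "C1 \<noteq> C2" for C1 C2
    proof (rule ccontr)
      assume "C1 \<inter> C2 \<noteq> {}"
      then obtain z x y where "z \<in> orbit f x" "z \<in> orbit f y" "C1 = orbit f x" "C2 = orbit f y" using C by auto
      then have "C1 = C2" using orbit_eq[OF assms(1,2)] by metis
      then show False using C(3) by simp
    qed
  qed
  then show ?thesis unfolding U ncyc_def .
qed

lemma card_orbit_funpow:
  assumes "f permutes S" "finite S" "card (orbit f x) = n"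
  shows "(f ^^ n) x = x"
proof -
  have self: "x \<in> orbit f x" by (rule orbit_self[OF assms(1,2)])
  have "card (orbit f x) = funpow_dist1 f x x"
    by (subst orbit_conv_funpow_dist1[OF self]) (simp add: card_image[OF inj_on_funpow_dist1[OF self]] del: funpow.simps)
  then show ?thesis using funpow_dist1_prop[OF self] assms(3) by metis
qed

lemma closed_imp_image_eq:
  assumes "f permutes S" "finite S" "A \<subseteq> S" "f ` A \<subseteq> A" shows "f ` A = A"
  using endo_inj_surj[OF finite_subset[OF assms(3,2)] assms(4) inj_on_subset[OF permutes_inj[OF assms(1)]]] by simp

lemma prv_nxt_commute: "nxt (prv k) = prv (nxt k)"
proof -
  have "((k + 1) mod 3 + 1) mod 3 = (k + 1 + 1) mod 3" by (rule mod_add_left_eq)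
  moreover have "(k mod 3 + (1 + 1)) mod 3 = (k + (1 + 1)) mod 3" by (rule mod_add_left_eq)
  ultimately show ?thesis unfolding nxt_def prv_def add.assoc by simp
qed

locale bicubic_cover = dart_map M D c t r for M :: "'d rooted_map" and D c t r +
  fixes blk :: "'d \<Rightarrow> bool"
  assumes conD: "conn D c t" and chiD: "chi D c t = card D + 2" and cub: "\<And>d. d \<in> D \<Longrightarrow> card (orbit c d) = 3"
    and blk_c: "\<And>d. d \<in> D \<Longrightarrow> blk (c d) = blk d" and blk_t: "\<And>d. d \<in> D \<Longrightarrow> blk (t d) = (\<not> blk d)"
begin

text \<open>The same rule serves \<open>c\<close> and \<open>t\<close>, since \<open>c d\<close> and
  \<open>t d\<close> have the same face on their right.\<close>

definition turn :: "'d \<Rightarrow> nat \<Rightarrow> nat" where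
  "turn d k = (if blk d then prv k else nxt k)"

text \<open>
  The threefold cover whose sheets are the candidate colours of the face to the right of a dart.
  It is unramified over vertices, edges and faces, so its Euler characteristic is 6 and it cannot
  be connected.
\<close>

definition cover :: "('d \<times> nat) set" where "cover = D \<times> {1, 2, 3}"

definition cc :: "'d \<times> nat \<Rightarrow> 'd \<times> nat" where
  "cc = perm_restrict (\<lambda>(d, k). (c d, turn d k)) cover"

definition ct :: "'d \<times> nat \<Rightarrow> 'd \<times> nat" where
  "ct = perm_restrict (\<lambda>(d, k). (t d, turn d k)) cover"

lemma turn_range: "turn d k \<in> {1, 2, 3}" unfolding turn_def using nxt_prv by simp

lemma turn_inj: "k \<in> {1, 2, 3} \<Longrightarrow> k' \<in> {1, 2, 3} \<Longrightarrow> turn d k = turn d k' \<Longrightarrow> k = k'"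
  by (cases "blk d") (auto simp: turn_def nxt_def prv_def)

lemma cover_finite: "finite cover" unfolding cover_def using finD by simp

lemma cover_lift_permutes:
  assumes f: "f permutes D"
  shows "perm_restrict (\<lambda>(d, k). (f d, turn d k)) cover permutes cover"
proof (rule bij_imp_permutes)
  let ?f = "perm_restrict (\<lambda>(d, k). (f d, turn d k)) cover"
  have "?f ` cover \<subseteq> cover"
    using turn_range permutes_in_image[OF f] by (auto simp: perm_restrict_def cover_def)
  moreover have "inj_on ?f cover"
  proof (rule inj_onI)
    fix x y assume x: "x \<in> cover" and y: "y \<in> cover" and eq: "?f x = ?f y"
    obtain d k e l where xy: "x = (d, k)" "y = (e, l)" by (cases x, cases y)
    have "f d = f e" "turn d k = turn e l" using eq x y unfolding xy by (auto simp: perm_restrict_def)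
    then have "d = e" using permutes_inj[OF f] by (metis injD)
    then show "x = y" using turn_inj[of k l d] x y \<open>turn d k = turn e l\<close> unfolding xy cover_def by simp
  qed
  ultimately show "bij_betw ?f cover cover"
    unfolding bij_betw_def using endo_inj_surj[OF cover_finite] by blast
qed (simp add: perm_restrict_def)

lemma cover_c_perm: "cc permutes cover" and cover_t_perm: "ct permutes cover"
  unfolding cc_def ct_def by (rule cover_lift_permutes[OF cD], rule cover_lift_permutes[OF tD])

lemma cover_apply:
  "d \<in> D \<Longrightarrow> k \<in> {1, 2, 3} \<Longrightarrow> cc (d, k) = (c d, turn d k)"
  "d \<in> D \<Longrightarrow> k \<in> {1, 2, 3} \<Longrightarrow> ct (d, k) = (t d, turn d k)"
  unfolding cc_def ct_def by (auto simp: perm_restrict_def cover_def)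

lemma c_cubed: assumes "d \<in> D" shows "c (c (c d)) = d"
  using card_orbit_funpow[OF cD finD cub[OF assms]] by (simp add: numeral_3_eq_3)

lemma c_neq: assumes d: "d \<in> D" shows "c d \<noteq> d" "c (c d) \<noteq> d"
proof -
  have "orbit c d \<noteq> {d}" using cub[OF d] by auto
  then show "c d \<noteq> d" by (simp add: orbit_eq_singleton_iff)
  then show "c (c d) \<noteq> d" using c_cubed[OF d] by metis
qed

lemma turn_cubed: assumes "d \<in> D" "k \<in> {1, 2, 3}"
  shows "turn (c (c d)) (turn (c d) (turn d k)) = k"
  using assms(2) blk_c[OF assms(1)] blk_c[OF in_D(1)[OF assms(1)]] prv_values unfolding turn_def by auto

lemma card_cover_orbit_c: assumes x: "x \<in> cover" shows "card (orbit cc x) = 3"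
proof -
  obtain d k where dk: "x = (d, k)" "d \<in> D" "k \<in> {1, 2, 3}" using x unfolding cover_def by auto
  note D2 = in_D(1)[OF dk(2)] in_D(1)[OF in_D(1)[OF dk(2)]]
  let ?k1 = "turn d k" let ?k2 = "turn (c d) ?k1"
  have s: "cc x = (c d, ?k1)" "cc (c d, ?k1) = (c (c d), ?k2)" "cc (c (c d), ?k2) = x"
    using cover_apply(1) dk D2 turn_range turn_cubed[OF dk(2,3)] c_cubed[OF dk(2)] by auto
  have "orbit cc x = {x, (c d, ?k1), (c (c d), ?k2)}"
    using orbit_period_3[of cc x] s by simp
  then show ?thesis using dk(1) c_neq[OF dk(2)] c_neq(1)[OF D2(1)] by auto
qed

lemma orbit_t: "d \<in> D \<Longrightarrow> orbit t d = {d, t d}"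
  by (rule orbit_involution[where f = t, OF tt])

lemma turn_t: assumes "d \<in> D" "k \<in> {1, 2, 3}" shows "turn (t d) (turn d k) = k"
  using assms(2) blk_t[OF assms(1)] nxt_prv unfolding turn_def by auto

lemma card_cover_orbit_t: assumes x: "x \<in> cover" shows "card (orbit ct x) = 2"
proof -
  obtain d k where dk: "x = (d, k)" "d \<in> D" "k \<in> {1, 2, 3}" using x unfolding cover_def by auto
  let ?k1 = "turn d k"
  have s: "ct x = (t d, ?k1)" "ct (t d, ?k1) = x"
    using cover_apply(2) dk in_D turn_range turn_t[OF dk(2,3)] tt[OF dk(2)] by auto
  have "orbit ct x = {x, (t d, ?k1)}"
    using orbit_involution[of ct x] s by simp
  then show ?thesis using dk(1) t_neq[OF dk(2)] by auto
qed

text \<open>The turns at the two ends of an edge cancel, so the product keeps the sheet and every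
  face lifts to three copies.\<close>

lemma cover_phi: assumes "d \<in> D" "k \<in> {1, 2, 3}" shows "(cc \<circ> ct) (d, k) = (phi d, k)"
  using cover_apply assms in_D turn_range turn_t[OF assms] unfolding phi_def by simp

lemma orbit_cover_phi: assumes d: "d \<in> D" "k \<in> {1, 2, 3}" shows "orbit (cc \<circ> ct) (d, k) = orbit phi d \<times> {k}"
proof -
  have "orbit (cc \<circ> ct) ((\<lambda>d. (d, k)) d) = (\<lambda>d. (d, k)) ` orbit phi d"
  proof (rule orbit_inverse[symmetric])
    show "d \<in> orbit phi d" by (rule orbit_self[OF phiD finD])
    fix x assume "x \<in> orbit phi d"
    then have "x \<in> D" using permutes_orbit_subset[OF phiD d(1)] by blast
    then show "(cc \<circ> ct) (x, k) = (phi x, k)" using cover_phi d(2) by blast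
  qed
  then show ?thesis by auto
qed

lemma ncyc_cover_phi: "ncyc cover (cc \<circ> ct) = 3 * ncyc D phi"
proof -
  have "orbit (cc \<circ> ct) ` cover = (\<lambda>(X, k). X \<times> {k}) ` ((orbit phi ` D) \<times> {1, 2, 3})"
    unfolding cover_def using orbit_cover_phi by (auto simp: image_iff)
  moreover have "inj_on (\<lambda>(X, k). X \<times> {k}) ((orbit phi ` D) \<times> {1, 2, 3::nat})"
  proof (rule inj_onI)
    fix a b assume a: "a \<in> (orbit phi ` D) \<times> {1, 2, 3::nat}" and b: "b \<in> (orbit phi ` D) \<times> {1, 2, 3}"
      and eq: "(case a of (X, k) \<Rightarrow> X \<times> {k}) = (case b of (X, k) \<Rightarrow> X \<times> {k})"
    obtain X k Y l where ab: "a = (X, k)" "b = (Y, l)" by (cases a, cases b)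
    have "X \<noteq> {}" "Y \<noteq> {}" using a b unfolding ab by (auto simp: orbit_nonempty)
    moreover have "X \<times> {k} = Y \<times> {l}" using eq unfolding ab by simp
    ultimately show "a = b" unfolding ab times_eq_iff by simp
  qed
  ultimately show ?thesis unfolding ncyc_def by (simp add: card_image card_cartesian_product)
qed

text \<open>Vertices, edges and faces are all tripled, and \<open>3 * 2 = 6\<close> exceeds the
  value 2 that bounds a connected pair.\<close>

lemma cover_chi: "chi cover cc ct = card cover + 6"
proof -
  have "3 * ncyc D c = card D" by (rule ncyc_uniform[OF cD finD cub])
  moreover have "2 * ncyc D t = card D"
    by (rule ncyc_uniform[OF tD finD]) (use orbit_t t_neq in \<open>simp add: eq_commute[of _ "t _"]\<close>)
  moreover have "3 * ncyc cover cc = card cover"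
    by (rule ncyc_uniform[OF cover_c_perm cover_finite card_cover_orbit_c])
  moreover have "2 * ncyc cover ct = card cover"
    by (rule ncyc_uniform[OF cover_t_perm cover_finite card_cover_orbit_t])
  moreover have "card cover = 3 * card D" unfolding cover_def by (simp add: card_cartesian_product)
  ultimately show ?thesis using chiD ncyc_cover_phi unfolding chi_def phi_def by simp
qed

lemma cover_not_conn: "\<not> conn cover cc ct"
  using genus_nonneg[OF cover_c_perm cover_t_perm cover_finite] cover_chi by auto

lemma cover_base: "(r, 3) \<in> cover" using rD unfolding cover_def by simp

text \<open>The component of the root in the cover; it turns out to be the graph of the
  colouring.\<close>

definition sheet where "sheet = joint_orbit cc ct (r, 3)"

lemma sheet_base: "(r, 3) \<in> sheet" and sheet_closed: "cc ` sheet \<subseteq> sheet" "ct ` sheet \<subseteq> sheet"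
  unfolding sheet_def by (fact joint_orbit_base joint_orbit_closed)+

lemma sheet_least: "(r, 3) \<in> A \<Longrightarrow> cc ` A \<subseteq> A \<Longrightarrow> ct ` A \<subseteq> A \<Longrightarrow> sheet \<subseteq> A"
  unfolding sheet_def by (rule joint_orbit_least)

lemma sheet_sub: "sheet \<subseteq> cover"
  by (rule sheet_least) (use cover_base permutes_image[OF cover_c_perm] permutes_image[OF cover_t_perm] in auto)

lemma sheet_onto: assumes "d \<in> D" shows "\<exists>k. (d, k) \<in> sheet"
proof -
  let ?A = "fst ` sheet"
  have "?A = D"
  proof (rule connD[OF conD])
    show "?A \<subseteq> D" using sheet_sub unfolding cover_def by auto
    show "r \<in> ?A" using sheet_base by force
    show "c ` ?A \<subseteq> ?A"
    proof
      fix y assume "y \<in> c ` ?A"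
      then obtain d k where dk: "(d, k) \<in> sheet" "y = c d" by auto
      then have "cc (d, k) \<in> sheet" using sheet_closed(1) by blast
      then show "y \<in> ?A" using cover_apply(1)[of d k] dk sheet_sub unfolding cover_def by force
    qed
    show "t ` ?A \<subseteq> ?A"
    proof
      fix y assume "y \<in> t ` ?A"
      then obtain d k where dk: "(d, k) \<in> sheet" "y = t d" by auto
      then have "ct (d, k) \<in> sheet" using sheet_closed(2) by blast
      then show "y \<in> ?A" using cover_apply(2)[of d k] dk sheet_sub unfolding cover_def by force
    qed
  qed
  then show ?thesis using assms by force
qed

text \<open>Rotating the sheets commutes with the lifted permutations. If the root occurred with a
  second colour, its component would be invariant under a nontrivial rotation, hence under all, and
  would be the whole cover, which is not connected.\<close>

lemma sheet_root: assumes "(r, k) \<in> sheet" shows "k = 3"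
proof (rule ccontr)
  assume "k \<noteq> 3"
  moreover have "k \<in> {1, 2, 3}" using assms sheet_sub unfolding cover_def by auto
  \<comment> \<open>The rotation of the three sheets that takes 3 to \<open>k\<close>.\<close>
  ultimately obtain g where g: "g = nxt \<or> g = prv" "g 3 = k" using prv_values by auto
  have gr: "g l \<in> {1, 2, 3}" for l using g(1) nxt_prv(5,6) by metis
  have gt: "turn d (g l) = g (turn d l)" for d l
    using g(1) prv_nxt_commute unfolding turn_def by auto
  let ?A = "{(d, l). (d, l) \<in> cover \<and> (d, g l) \<in> sheet}"
  have "sheet \<subseteq> ?A"
  proof (rule sheet_least)
    show "(r, 3) \<in> ?A" using cover_base assms g(2) by simp
    show "cc ` ?A \<subseteq> ?A"
    proof
      fix y assume "y \<in> cc ` ?A"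
      then obtain d l where dl: "d \<in> D" "l \<in> {1, 2, 3}" "(d, g l) \<in> sheet" "y = cc (d, l)" unfolding cover_def by auto
      have "cc (d, g l) \<in> sheet" using dl(3) sheet_closed(1) by blast
      then show "y \<in> ?A" using dl in_D turn_range cover_apply(1)[OF dl(1) gr] cover_apply(1)[OF dl(1,2)] gt
        unfolding cover_def by auto
    qed
    show "ct ` ?A \<subseteq> ?A"
    proof
      fix y assume "y \<in> ct ` ?A"
      then obtain d l where dl: "d \<in> D" "l \<in> {1, 2, 3}" "(d, g l) \<in> sheet" "y = ct (d, l)" unfolding cover_def by auto
      have "ct (d, g l) \<in> sheet" using dl(3) sheet_closed(2) by blast
      then show "y \<in> ?A" using dl in_D turn_range cover_apply(2)[OF dl(1) gr] cover_apply(2)[OF dl(1,2)] gt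
        unfolding cover_def by auto
    qed
  qed
  then have shift: "(d, l) \<in> sheet \<Longrightarrow> (d, g l) \<in> sheet" for d l by auto
  have all: "{l, g l, g (g l)} = {1, 2, 3}" if "l \<in> {1, 2, 3}" for l
    using that g(1) by (auto simp: nxt_def prv_def)
  have "cover \<subseteq> sheet"
  proof
    fix x assume "x \<in> cover"
    then obtain d l where x: "x = (d, l)" "d \<in> D" "l \<in> {1, 2, 3}" unfolding cover_def by auto
    obtain m where m: "(d, m) \<in> sheet" using sheet_onto[OF x(2)] by blast
    then have "m \<in> {1, 2, 3}" using sheet_sub unfolding cover_def by auto
    then have "l \<in> {m, g m, g (g m)}" using all x(3) by blast
    then show "x \<in> sheet" using m shift x(1) by auto
  qed
  have "conn cover cc ct"
  proof (rule conn_rootI[OF cover_c_perm cover_t_perm cover_finite cover_base])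
    fix A assume A: "A \<subseteq> cover" "(r, 3) \<in> A" "cc ` A \<subseteq> A" "ct ` A \<subseteq> A"
    show "A = cover" using sheet_least[OF A(2-4)] A(1) \<open>cover \<subseteq> sheet\<close> by blast
  qed
  then show False using cover_not_conn by simp
qed

text \<open>Uniqueness of the colour is passed on from the root by \<open>c\<close> and
  \<open>t\<close>: the lifts permute the component, so each of its points over \<open>f d\<close>
  comes from one over \<open>d\<close>.\<close>

lemma sheet_unique: assumes "(d, k) \<in> sheet" "(d, l) \<in> sheet" shows "k = l"
proof -
  let ?A = "{d \<in> D. \<forall>k l. (d, k) \<in> sheet \<longrightarrow> (d, l) \<in> sheet \<longrightarrow> k = l}"
  have pre: "\<exists>k'. k' \<in> {1, 2, 3} \<and> (d, k') \<in> sheet \<and> k = turn d k'"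
    if "d \<in> D" "(f d, k) \<in> sheet" "fc ` sheet \<subseteq> sheet" "fc permutes cover" "f permutes D"
      "\<And>d k. d \<in> D \<Longrightarrow> k \<in> {1, 2, 3} \<Longrightarrow> fc (d, k) = (f d, turn d k)" for f fc d k
  proof -
    have "fc ` sheet = sheet" by (rule closed_imp_image_eq[OF that(4) cover_finite sheet_sub that(3)])
    then have "(f d, k) \<in> fc ` sheet" using that(2) by simp
    then obtain x where "x \<in> sheet" "fc x = (f d, k)" by (metis imageE)
    moreover obtain d' k' where x: "x = (d', k')" by (cases x)
    ultimately have dk: "d' \<in> D" "k' \<in> {1, 2, 3}" "(f d', turn d' k') = (f d, k)" "(d', k') \<in> sheet"
      using sheet_sub that(6)[of d' k'] unfolding cover_def by auto
    then have "d' = d" using permutes_inj[OF that(5)] by (metis injD prod.inject)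
    then show ?thesis using dk by auto
  qed
  have cl: "f d \<in> ?A" if dA: "d \<in> ?A" and f: "fc ` sheet \<subseteq> sheet" "fc permutes cover" "f permutes D"
      "\<And>d k. d \<in> D \<Longrightarrow> k \<in> {1, 2, 3} \<Longrightarrow> fc (d, k) = (f d, turn d k)" for f fc d
  proof -
    have d: "d \<in> D" using dA by simp
    have "k = l" if kl: "(f d, k) \<in> sheet" "(f d, l) \<in> sheet" for k l
    proof -
      obtain k' l' where "(d, k') \<in> sheet" "k = turn d k'" "(d, l') \<in> sheet" "l = turn d l'"
        using pre[OF d kl(1) f] pre[OF d kl(2) f] by blast
      then show ?thesis using dA by blast
    qed
    then show ?thesis using permutes_in_image[OF f(3)] d by blast
  qed
  have "?A = D"
  proof (rule connD[OF conD])
    show "?A \<subseteq> D" by (rule Collect_restrict)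
    show "r \<in> ?A" using sheet_root rD by blast
    show "c ` ?A \<subseteq> ?A"
      using cl[OF _ sheet_closed(1) cover_c_perm cD cover_apply(1)] by (rule image_subsetI)
    show "t ` ?A \<subseteq> ?A"
      using cl[OF _ sheet_closed(2) cover_t_perm tD cover_apply(2)] by (rule image_subsetI)
  qed
  moreover have "d \<in> D" using assms(1) sheet_sub unfolding cover_def by auto
  ultimately show ?thesis using assms by blast
qed

lemma colouring_exists:
  "\<exists>col. col r = 3 \<and> (\<forall>d\<in>D. col d \<in> {1, 2, 3} \<and> col (c d) = turn d (col d) \<and> col (t d) = turn d (col d))"
proof (intro exI conjI ballI)
  let ?col = "\<lambda>d. THE k. (d, k) \<in> sheet"
  have col: "(d, ?col d) \<in> sheet" if "d \<in> D" for d
    using theI[of "\<lambda>k. (d, k) \<in> sheet"] sheet_onto[OF that] sheet_unique by metis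
  have eq: "?col d = k" if "(d, k) \<in> sheet" for d k using that sheet_unique by blast
  show "?col r = 3" by (rule eq[OF sheet_base])
  fix d assume d: "d \<in> D"
  show k: "?col d \<in> {1, 2, 3}" using col[OF d] sheet_sub unfolding cover_def by auto
  have "cc (d, ?col d) \<in> sheet" "ct (d, ?col d) \<in> sheet" using col[OF d] sheet_closed by blast+
  then show "?col (c d) = turn d (?col d)" "?col (t d) = turn d (?col d)"
    using eq cover_apply[OF d k] by auto
qed

end

lemma bicubic_coloured:
  assumes "bicubic_map M"
  obtains blk col where "coloured_map M blk col"
proof -
  have wf: "wf_map M" and pl: "planar_map M" and cu: "cubic M" and bi: "bipartite M"
    using assms unfolding bicubic_map_def planar_map_def by auto
  interpret dart_map M "darts M" "ccw M" "opp M" "root_dart M" by unfold_locales (fact wf)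
  let ?D = "darts M" and ?c = "ccw M" and ?t = "opp M" and ?r = "root_dart M"
  have con: "conn ?D ?c ?t" using pl connected_iff unfolding planar_map_def by simp
  have cub: "card (orbit ?c d) = 3" if "d \<in> ?D" for d
    using cu that unfolding cubic_def vertices_def vertex_def by auto
  have ot: "orbit ?t d = {d, ?t d}" if "d \<in> ?D" for d
    by (rule orbit_involution[where f = ?t, OF tt[OF that]])
  have "card (vertices M) = ncyc ?D ?c" "card (faces M) = ncyc ?D (?c \<circ> ?t)"
    unfolding ncyc_def vertices_def faces_def vertex_def face_def by simp_all
  moreover have "card (edges M) = ncyc ?D ?t"
    unfolding ncyc_def edges_def edge_def using ot by (metis (no_types, lifting) image_cong)
  moreover have "2 * ncyc ?D ?t = card ?D"
    by (rule ncyc_uniform[OF tD finD]) (use ot t_neq in \<open>simp add: eq_commute[of _ "?t _"]\<close>)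
  ultimately have chi: "chi ?D ?c ?t = card ?D + 2" using pl unfolding planar_map_def chi_def by linarith
  obtain B where B: "bicolouring M B" using bi unfolding bipartite_def by blast
  \<comment> \<open>Vertex colours are measured relative to the root, which is thus black whichever
    bicolouring was chosen.\<close>
  define blk where "blk d = (vertex M d \<in> B \<longleftrightarrow> vertex M ?r \<in> B)" for d
  have b: "blk (?c d) = blk d" "blk (?t d) = (\<not> blk d)" if "d \<in> ?D" for d
    using that B vertex_c unfolding blk_def bicolouring_def by auto
  interpret BC: bicubic_cover M "darts M" "ccw M" "opp M" "root_dart M" blk
    by unfold_locales (use con chi cub b in auto)
  obtain col where col: "col ?r = 3" "\<forall>d\<in>?D. col d \<in> {1, 2, 3} \<and> col (?c d) = BC.turn d (col d) \<and> col (?t d) = BC.turn d (col d)"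
    using BC.colouring_exists by blast
  have "coloured_map M blk col"
  proof
    show "?c (?c (?c d)) = d" if "d \<in> ?D" for d using BC.c_cubed[OF that] .
    show "conn ?D ?c ?t" by (rule con)
    show "blk (?c d) = blk d" "blk (?t d) = (\<not> blk d)" if "d \<in> ?D" for d using b[OF that] by auto
    show "col d \<in> {1, 2, 3}" if "d \<in> ?D" for d using col(2) that by blast
    show "col (?c d) = (if blk d then prv (col d) else nxt (col d))" "col (?t d) = col (?c d)" if "d \<in> ?D" for d
      using col(2) that unfolding BC.turn_def by auto
    show "blk ?r" unfolding blk_def by simp
    show "col ?r = 3" by (rule col(1))
  qed
  then show thesis by (rule that)
qed

section \<open>Bicubic maps as hypermaps\<close>

definition sim :: "'a hypermap \<Rightarrow> 'a hypermap \<Rightarrow> bool" where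
  "sim H H' \<longleftrightarrow> (\<exists>g. bij g \<and> relabel g H = H')"

lemma relabel_comp: "bij g \<Longrightarrow> bij h \<Longrightarrow> relabel g (relabel h H) = relabel (g \<circ> h) H"
  by (cases H) (simp add: relabel_def conj_by_def o_inv_distrib comp_assoc)

lemma sim_sym: "sim H H' \<Longrightarrow> sim H' H"
  unfolding sim_def using relabel_inv bij_imp_bij_inv by metis

lemma sim_trans: "sim H H' \<Longrightarrow> sim H' H'' \<Longrightarrow> sim H H''"
  unfolding sim_def using relabel_comp bij_comp by metis

lemma relabel_hmaps: "bij g \<Longrightarrow> H \<in> hmaps E \<Longrightarrow> relabel g H \<in> hmaps (g ` E)"
  using relabel_bij(1) bij_betwE by metis

text \<open>By connectedness the carrier is the joint orbit of the root, so the triple determines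
  it.\<close>

lemma hmaps_unique: assumes "H \<in> hmaps E" "H \<in> hmaps E'" shows "E = E'"
proof -
  obtain p q r where "H = (p, q, r)" "hmap E p q r" "hmap E' p q r" using assms by (auto simp: hmaps_def)
  then show ?thesis using conn_joint_orbit hmapD by metis
qed

lemma sim_stats:
  assumes "sim (p, q, r) (p', q', r')" "(p, q, r) \<in> hmaps E"
  shows "ast p' q' r' = ast p q r" "cst p' q' r' = cst p q r"
proof -
  obtain g where g: "bij g" "relabel g (p, q, r) = (p', q', r')" using assms(1) unfolding sim_def by blast
  then show "ast p' q' r' = ast p q r" "cst p' q' r' = cst p q r"
    using hmap_conj_by(2,3)[OF g(1), of E p q r] assms(2) by (auto simp: relabel_def hmaps_def)
qed

lemma permutes_eqI:
  assumes "f permutes A" "g permutes A" "\<And>x. x \<in> A \<Longrightarrow> f x = g x" shows "f = g"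
  using assms permutes_not_in by (metis ext)

lemma relabel_cong:
  assumes H: "hmap E p q r" and g: "bij g" "bij g'" and eq: "\<And>x. x \<in> E \<Longrightarrow> g x = g' x"
  shows "relabel g (p, q, r) = relabel g' (p, q, r)"
proof -
  note D = hmapD[OF H]
  have im: "g ` E = g' ` E" using eq by (rule image_cong[OF refl])
  have "conj_by g f = conj_by g' f" if f: "f permutes E" for f
  proof (rule permutes_eqI[OF conj_by_permutes[OF g(1) f]])
    show "conj_by g' f permutes g ` E" unfolding im by (rule conj_by_permutes[OF g(2) f])
    fix y assume "y \<in> g ` E"
    then obtain x where x: "x \<in> E" "y = g x" by blast
    then show "conj_by g f y = conj_by g' f y"
      using conj_by_apply[OF g(1)] conj_by_apply[OF g(2), of f x] eq permutes_in_image[OF f] by metis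
  qed
  then show ?thesis using D eq by (simp add: relabel_def)
qed

text \<open>The points fixed by a root-preserving automorphism form a closed set containing the
  root.\<close>

lemma relabel_rigid:
  assumes H: "hmap E p q r" and g: "bij g" "relabel g (p, q, r) = (p, q, r)" and x: "x \<in> E"
  shows "g x = x"
proof -
  note D = hmapD[OF H]
  have eq: "conj_by g p = p" "conj_by g q = q" "g r = r" using g(2) by (auto simp: relabel_def)
  have "{x \<in> E. g x = x} = E"
  proof (rule connD[OF D(5)])
    have "p y \<in> E \<and> g (p y) = p y" if "y \<in> E" "g y = y" for y
      using that conj_by_apply[OF g(1), of p y] eq(1) permutes_in_image[OF D(2)] by simp
    then show "p ` {x \<in> E. g x = x} \<subseteq> {x \<in> E. g x = x}" by blast
    have "q y \<in> E \<and> g (q y) = q y" if "y \<in> E" "g y = y" for y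
      using that conj_by_apply[OF g(1), of q y] eq(2) permutes_in_image[OF D(3)] by simp
    then show "q ` {x \<in> E. g x = x} \<subseteq> {x \<in> E. g x = x}" by blast
  qed (use D eq in auto)
  then show ?thesis using x by blast
qed

text \<open>Isomorphisms are given on darts only, while relabelling acts on the whole type; an
  arbitrary global bijection taking \<open>A\<close> to \<open>B\<close> is corrected by a
  permutation of \<open>B\<close>.\<close>

lemma finite_bij_extends_fun:
  assumes "finite A" "bij_betw f A B"
  obtains h :: "'a \<Rightarrow> 'a" where "bij h" "\<And>x. x \<in> A \<Longrightarrow> h x = f x"
proof -
  have B: "finite B" "card A = card B" using assms bij_betw_finite bij_betw_same_card by metis+
  obtain k :: "'a \<Rightarrow> 'a" where k: "bij k" "k ` A = B" using finite_bij_extends[OF assms(1) B] .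
  have kb: "bij_betw (inv_into A k) B A"
    using inj_on_subset[OF bij_is_inj[OF k(1)] subset_UNIV] k(2) by (intro bij_betw_inv_into) (simp add: bij_betw_def)
  define s where "s = (\<lambda>y. if y \<in> B then f (inv_into A k y) else y)"
  have "s permutes B"
  proof (rule bij_imp_permutes)
    have "bij_betw (f \<circ> inv_into A k) B B" by (rule bij_betw_trans[OF kb assms(2)])
    then show "bij_betw s B B" by (subst bij_betw_cong[of B s "f \<circ> inv_into A k"]) (auto simp: s_def)
  qed (simp add: s_def)
  have "bij (s \<circ> k)" by (rule bij_comp[OF k(1) permutes_bij[OF \<open>s permutes B\<close>]])
  moreover have "(s \<circ> k) x = f x" if "x \<in> A" for x
  proof -
    have "inv_into A k (k x) = x"
      by (rule inv_into_f_f[OF inj_on_subset[OF bij_is_inj[OF k(1)] subset_UNIV] that])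
    moreover have "k x \<in> B" using that k(2) by blast
    ultimately show ?thesis by (simp add: s_def)
  qed
  ultimately show thesis by (rule that)
qed

text \<open>A hypermap has no automorphism fixing the root, so its relabellings are all distinct.\<close>

lemma card_sim_class:
  assumes H0: "H0 \<in> hmaps E"
  shows "card {H \<in> hmaps E. sim H H0} = fact (card E)"
proof -
  obtain p q r where eq: "H0 = (p, q, r)" and h: "hmap E p q r" using H0 by (auto simp: hmaps_def)
  note D = hmapD[OF h]
  have "{H \<in> hmaps E. sim H H0} = (\<lambda>s. relabel s H0) ` {s. s permutes E}"
  proof
    show "(\<lambda>s. relabel s H0) ` {s. s permutes E} \<subseteq> {H \<in> hmaps E. sim H H0}"
    proof
      fix H assume "H \<in> (\<lambda>s. relabel s H0) ` {s. s permutes E}"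
      then obtain s where s: "s permutes E" "H = relabel s H0" by blast
      have "H \<in> hmaps E" using relabel_hmaps[OF permutes_bij[OF s(1)] H0] s permutes_image[OF s(1)] by simp
      moreover have "sim H0 H" unfolding sim_def using s permutes_bij by blast
      ultimately show "H \<in> {H \<in> hmaps E. sim H H0}" using sim_sym by blast
    qed
    show "{H \<in> hmaps E. sim H H0} \<subseteq> (\<lambda>s. relabel s H0) ` {s. s permutes E}"
    proof
      fix H assume "H \<in> {H \<in> hmaps E. sim H H0}"
      then have "H \<in> hmaps E" "sim H0 H" using sim_sym by blast+
      then obtain g where g: "bij g" "relabel g H0 = H" unfolding sim_def by blast
      have gE: "g ` E = E" using relabel_hmaps[OF g(1) H0] hmaps_unique \<open>H \<in> hmaps E\<close> g(2) by metis
      define s where "s = perm_restrict g E"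
      have s: "s permutes E" unfolding s_def
      proof (rule bij_imp_permutes)
        show "bij_betw (perm_restrict g E) E E"
          using gE inj_on_subset[OF bij_is_inj[OF g(1)] subset_UNIV]
          by (subst bij_betw_cong[of E _ g]) (simp_all add: perm_restrict_def bij_betw_def)
      qed (simp add: perm_restrict_def)
      have "relabel s H0 = relabel g H0" unfolding eq
        by (rule relabel_cong[OF h permutes_bij[OF s] g(1)]) (simp add: s_def perm_restrict_def)
      then show "H \<in> (\<lambda>s. relabel s H0) ` {s. s permutes E}"
        using s g(2) by (intro image_eqI[of _ _ s]) simp_all
    qed
  qed
  moreover have "inj_on (\<lambda>s. relabel s H0) {s. s permutes E}"
  proof (rule inj_onI)
    fix s u assume su: "s \<in> {s. s permutes E}" "u \<in> {s. s permutes E}" "relabel s H0 = relabel u H0"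
    then have b: "bij s" "bij u" "bij (inv u)" using permutes_bij bij_imp_bij_inv by auto
    have "relabel (inv u \<circ> s) H0 = relabel (inv u) (relabel s H0)"
      by (rule relabel_comp[OF b(3,1), symmetric])
    also have "\<dots> = relabel (inv u) (relabel u H0)" unfolding su(3) ..
    also have "\<dots> = H0" by (rule relabel_inv[OF b(2)])
    finally have "(inv u \<circ> s) x = x" if "x \<in> E" for x
      using relabel_rigid[OF h bij_comp[OF b(1,3)] _ that] eq by simp
    then have "s x = u x" if "x \<in> E" for x
      using that b(2) by (metis bij_inv_eq_iff comp_apply)
    then show "s = u" using permutes_eqI su by blast
  qed
  ultimately show ?thesis using card_permutations[OF refl D(1)] by (simp add: card_image)
qed

text \<open>The coding is written in terms of \<open>ccw\<close>, \<open>opp\<close> and the root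
  alone, without colours, so that an isomorphism of maps transports it directly.\<close>

definition code_P :: "'d rooted_map \<Rightarrow> 'd \<Rightarrow> 'd" where
  "code_P M = ccw M \<circ> opp M \<circ> ccw M \<circ> opp M"

definition code_Q :: "'d rooted_map \<Rightarrow> 'd \<Rightarrow> 'd" where
  "code_Q M = opp M \<circ> ccw M \<circ> opp M \<circ> ccw M"

text \<open>
  The black darts with a face of colour 3 to their right, one per black vertex; \<open>code_P M\<close> and
  \<open>code_Q M\<close> move around the faces of colour 3 and 2 from one black vertex to the next.
\<close>

definition code_E :: "'d rooted_map \<Rightarrow> 'd set" where
  "code_E M = joint_orbit (code_P M) (code_Q M) (root_dart M)"

definition code :: "'d rooted_map \<Rightarrow> 'd hypermap" where
  "code M = (perm_restrict (code_P M) (code_E M), perm_restrict (code_Q M) (code_E M), root_dart M)"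

text \<open>
  Each dart is reached in a unique way from some \<open>e\<close> in \<open>code_E M\<close>, staying at the black vertex of \<open>e\<close>
  for \<open>k < 3\<close> and at the white vertex opposite to \<open>e\<close> for \<open>3 \<le> k < 6\<close>.
\<close>

definition dart_at :: "'d rooted_map \<Rightarrow> 'd \<Rightarrow> nat \<Rightarrow> 'd" where
  "dart_at M e k = (if k = 0 then e else if k = 1 then ccw M e else if k = 2 then ccw M (ccw M e)
     else if k = 3 then opp M e else if k = 4 then ccw M (opp M e) else ccw M (ccw M (opp M e)))"

definition ccw_index :: "nat \<Rightarrow> nat" where
  "ccw_index k = (if k = 2 then 0 else if k = 5 then 3 else k + 1)"

text \<open>Rotation at a vertex looks the same everywhere, so all information sits in
  \<open>opp\<close>: the three edges at the black vertex of \<open>e\<close> lead to the white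
  vertices attached to \<open>e\<close>, \<open>q e\<close> and \<open>inv p e\<close>.\<close>

definition opp_code :: "('a \<Rightarrow> 'a) \<Rightarrow> ('a \<Rightarrow> 'a) \<Rightarrow> 'a \<Rightarrow> nat \<Rightarrow> 'a \<times> nat" where
  "opp_code p q e k = (if k = 0 then (e, 3) else if k = 1 then (q e, 5) else if k = 2 then (inv p e, 4)
     else if k = 3 then (e, 0) else if k = 4 then (p e, 2) else (inv q e, 1))"

lemma less_6_cases: "(k::nat) < 6 \<Longrightarrow> k = 0 \<or> k = 1 \<or> k = 2 \<or> k = 3 \<or> k = 4 \<or> k = 5"
  by auto

lemma ccw_index_less: "k < 6 \<Longrightarrow> ccw_index k < 6"
  unfolding ccw_index_def by auto

lemma opp_code_in:
  assumes "p permutes E" "q permutes E" "e \<in> E" "k < 6"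
  shows "opp_code p q e k \<in> E \<times> {..<6}"
  using assms permutes_in_image[OF assms(1)] permutes_in_image[OF assms(2)]
    permutes_in_image[OF permutes_inv[OF assms(1)]] permutes_in_image[OF permutes_inv[OF assms(2)]]
  unfolding opp_code_def by auto

context coloured_map
begin

lemma P_code: "P = code_P M" and Q_code: "Q = code_Q M"
  unfolding P_def Q_def code_P_def code_Q_def c_def t_def by simp_all

lemma E_code: "E = code_E M"
proof -
  have "joint_orbit P Q r \<subseteq> E" by (rule joint_orbit_least[OF rE P_in Q_in])
  moreover have "joint_orbit P Q r = E"
  proof (rule connD[OF conn_E calculation joint_orbit_base])
    show "p ` joint_orbit P Q r \<subseteq> joint_orbit P Q r"
      using joint_orbit_closed(1)[of P Q r] calculation p_apply by (auto simp: subset_iff)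
    show "q ` joint_orbit P Q r \<subseteq> joint_orbit P Q r"
      using joint_orbit_closed(2)[of Q P r] calculation q_apply by (auto simp: subset_iff)
  qed
  ultimately show ?thesis unfolding code_E_def P_code Q_code r_def by simp
qed

lemma pqr_code: "(p, q, r) = code M"
  unfolding code_def p_def q_def P_code Q_code E_code r_def ..

lemma dart_at_in: "e \<in> E \<Longrightarrow> dart_at M e k \<in> D"
  using E_cols(1) in_D unfolding dart_at_def c_def t_def by simp

lemma dart_at_c: assumes "e \<in> E" "k < 6" shows "c (dart_at M e k) = dart_at M e (ccw_index k)"
proof -
  have "e \<in> D" "t e \<in> D" using E_cols(1)[OF assms(1)] in_D by auto
  then show ?thesis using less_6_cases[OF assms(2)] c3
    unfolding dart_at_def ccw_index_def c_def[symmetric] t_def[symmetric] by auto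
qed

lemma dart_at_t: assumes e: "e \<in> E" and k: "k < 6"
  shows "t (dart_at M e k) = (case opp_code p q e k of (e', k') \<Rightarrow> dart_at M e' k')"
proof -
  have AD: "a \<in> D" if "a \<in> E" for a using that E_sub by auto
  have q1: "q e \<in> E" "p e \<in> E" using e permutes_in_image[OF qE] permutes_in_image[OF pE] by auto
  have i1: "inv p e \<in> E" "inv q e \<in> E"
    using e permutes_in_image[OF permutes_inv[OF qE]] permutes_in_image[OF permutes_inv[OF pE]] by auto
  have pi: "p (inv p e) = e" "q (inv q e) = e" using permutes_inverses(1)[OF pE] permutes_inverses(1)[OF qE] by auto
  have 1: "t (c e) = c (c (t (q e)))"
    unfolding q_apply[OF e] Q_def using tt c3 in_D AD[OF e] by simp
  have 2: "t (c (c e)) = c (t (inv p e))"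
  proof -
    have "c (c e) = c (c (P (inv p e)))" using pi(1) p_apply[OF i1(1)] by simp
    also have "\<dots> = t (c (t (inv p e)))" unfolding P_def using c3 in_D AD[OF i1(1)] by simp
    finally show ?thesis using tt in_D AD[OF i1(1)] by simp
  qed
  have 4: "t (c (t e)) = c (c (p e))" unfolding p_apply[OF e] P_def using c3 in_D AD[OF e] by simp
  have 5: "t (c (c (t e))) = c (inv q e)"
  proof -
    have "c (c (t e)) = c (c (t (Q (inv q e))))" using pi(2) q_apply[OF i1(2)] by simp
    also have "\<dots> = t (c (inv q e))" unfolding Q_def using tt c3 in_D AD[OF i1(2)] by simp
    finally show ?thesis using tt in_D AD[OF i1(2)] by simp
  qed
  have 3: "t (t e) = e" by (rule tt[OF AD[OF e]])
  show ?thesis using less_6_cases[OF k] 1 2 3 4 5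
    unfolding dart_at_def opp_code_def c_def[symmetric] t_def[symmetric] by auto
qed

text \<open>The pair of \<open>blk\<close> and \<open>col\<close> distinguishes the six positions,
  so the dart determines \<open>k\<close>, and then \<open>e\<close> by injectivity.\<close>

lemma dart_at_bij: "bij_betw (\<lambda>(e, k). dart_at M e k) (E \<times> {..<6}) D"
proof -
  let ?f = "\<lambda>(e, k). dart_at M e k"
  have cols: "dart_at M e 0 = e" "dart_at M e 1 = c e" "dart_at M e 2 = c (c e)" "dart_at M e 3 = t e"
    "dart_at M e 4 = c (t e)" "dart_at M e 5 = c (c (t e))" for e
    unfolding dart_at_def c_def t_def by simp_all
  have inj1: "c a = c b \<longleftrightarrow> a = b" "t a = t b \<longleftrightarrow> a = b" for a b
    using c_inj t_inj by (simp_all add: inj_eq)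
  have "e = e' \<and> k = k'" if "e \<in> E" "e' \<in> E" "k < 6" "k' < 6" "dart_at M e k = dart_at M e' k'" for e e' k k'
  proof -
    have bc: "blk (dart_at M x j) \<longleftrightarrow> j < 3" "col (dart_at M x j) = (if j = 0 \<or> j = 4 then 3 else if j = 1 \<or> j = 3 then 2 else 1)"
      if "x \<in> E" "j < 6" for x j
      using less_6_cases[OF that(2)] E_cols(2-7)[OF that(1)] t_E_cols(2-7)[OF that(1)] cols[of x] by auto
    have "(k < 3) = (k' < 3)" using bc(1)[OF that(1,3)] bc(1)[OF that(2,4)] that(5) by simp
    moreover have "(if k = 0 \<or> k = 4 then 3 else if k = 1 \<or> k = 3 then 2 else 1::nat) = (if k' = 0 \<or> k' = 4 then 3 else if k' = 1 \<or> k' = 3 then 2 else 1)"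
      using bc(2)[OF that(1,3)] bc(2)[OF that(2,4)] that(5) by simp
    ultimately have kk: "k = k'" using less_6_cases[OF that(3)] less_6_cases[OF that(4)] by (elim disjE) simp_all
    have "e = e'" using that(5) less_6_cases[OF that(3)] cols inj1 unfolding kk by (elim disjE) simp_all
    then show ?thesis using kk by simp
  qed
  then have "inj_on ?f (E \<times> {..<6})" by (auto simp: inj_on_def)
  moreover have "?f ` (E \<times> {..<6}) = D"
  proof
    show "?f ` (E \<times> {..<6}) \<subseteq> D" using dart_at_in by auto
    show "D \<subseteq> ?f ` (E \<times> {..<6})"
    proof
      fix d assume d: "d \<in> D"
      have I: "dart_at M e k \<in> ?f ` (E \<times> {..<6})" if "e \<in> E" "k < 6" for e k
        using that by (intro image_eqI[of _ _ "(e, k)"]) auto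
      show "d \<in> ?f ` (E \<times> {..<6})"
      proof (cases "blk d")
        case True
        then show ?thesis
          by (rule black_cases[OF d]) (use I[of _ 0] I[of _ 1] I[of _ 2] cols in auto)
      next
        case False
        then show ?thesis
          by (rule white_cases[OF d]) (use I[of _ 3] I[of _ 4] I[of _ 5] cols in auto)
      qed
    qed
  qed
  ultimately show ?thesis by (simp add: bij_betw_def)
qed

end

lemma bicubic_code:
  assumes "bicubic_map M"
  obtains p q where "code M = (p, q, root_dart M)" "hmap (code_E M) p q (root_dart M)"
    "2 * card (code_E M) = card (vertices M)" "a_stat M = ast p q (root_dart M)" "c_stat M = cst p q (root_dart M)"
    "bij_betw (\<lambda>(e, k). dart_at M e k) (code_E M \<times> {..<6}) (darts M)"
    "\<And>e k. e \<in> code_E M \<Longrightarrow> k < 6 \<Longrightarrow> ccw M (dart_at M e k) = dart_at M e (ccw_index k)"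
    "\<And>e k. e \<in> code_E M \<Longrightarrow> k < 6 \<Longrightarrow> opp M (dart_at M e k) = (case opp_code p q e k of (e', k') \<Rightarrow> dart_at M e' k')"
    "code_E M \<subseteq> darts M" "finite (darts M)" "\<And>d. d \<in> darts M \<Longrightarrow> ccw M d \<in> darts M" "\<And>d. d \<in> darts M \<Longrightarrow> opp M d \<in> darts M"
proof -
  obtain blk col where C: "coloured_map M blk col" using bicubic_coloured[OF assms] .
  interpret coloured_map M "darts M" "ccw M" "opp M" "root_dart M" blk col using C by simp
  have pl: "planar_map M" using assms unfolding bicubic_map_def by simp
  show thesis
  proof (rule that[of p q])
    show "code M = (p, q, root_dart M)" using pqr_code by simp
    show "hmap (code_E M) p q (root_dart M)" using planar_hmap[OF pl] E_code by simp
    show "2 * card (code_E M) = card (vertices M)" using card_vertices E_code by simp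
    show "a_stat M = ast p q (root_dart M)" by (rule a_stat_eq)
    show "c_stat M = cst p q (root_dart M)" by (rule c_stat_eq)
    show "bij_betw (\<lambda>(e, k). dart_at M e k) (code_E M \<times> {..<6}) (darts M)" using dart_at_bij E_code by simp
    show "code_E M \<subseteq> darts M" using E_sub E_code by simp
    show "finite (darts M)" by (rule finD)
  next
    fix e k assume "e \<in> code_E M" "k < (6::nat)"
    then show "ccw M (dart_at M e k) = dart_at M e (ccw_index k)"
      "opp M (dart_at M e k) = (case opp_code p q e k of (e', k') \<Rightarrow> dart_at M e' k')"
      using dart_at_c dart_at_t E_code by simp_all
  qed (fact in_D)+
qed

lemma opp_code_conj_by:
  assumes g: "bij g" and pq: "p permutes E" "q permutes E"
  shows "opp_code (conj_by g p) (conj_by g q) (g e) k = (case opp_code p q e k of (e', k') \<Rightarrow> (g e', k'))"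
proof -
  have "inv (conj_by g f) (g e) = g (inv f e)" if f: "f permutes E" for f
  proof -
    have "conj_by g f (g (inv f e)) = g e"
      using conj_by_apply[OF g, of f "inv f e"] permutes_inverses(1)[OF f] by simp
    then show ?thesis using permutes_inverses(2)[OF conj_by_permutes[OF g f]] by metis
  qed
  then show ?thesis using conj_by_apply[OF g] pq unfolding opp_code_def by auto
qed

text \<open>A relabelling of the black vertices carries the dart at position \<open>k\<close> of
  \<open>e\<close> to the dart at the same position of \<open>g e\<close>.\<close>

lemma sim_imp_map_iso:
  assumes M: "bicubic_map M" and N: "bicubic_map N" and s: "sim (code M) (code N)"
  shows "map_iso M N"
proof -
  obtain p q where m: "code M = (p, q, root_dart M)" "hmap (code_E M) p q (root_dart M)"
    "bij_betw (\<lambda>(e, k). dart_at M e k) (code_E M \<times> {..<6}) (darts M)"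
    "\<And>e k. e \<in> code_E M \<Longrightarrow> k < 6 \<Longrightarrow> ccw M (dart_at M e k) = dart_at M e (ccw_index k)"
    "\<And>e k. e \<in> code_E M \<Longrightarrow> k < 6 \<Longrightarrow> opp M (dart_at M e k) = (case opp_code p q e k of (e', k') \<Rightarrow> dart_at M e' k')"
    using bicubic_code[OF M] by metis
  obtain p' q' where n: "code N = (p', q', root_dart N)" "hmap (code_E N) p' q' (root_dart N)"
    "bij_betw (\<lambda>(e, k). dart_at N e k) (code_E N \<times> {..<6}) (darts N)"
    "\<And>e k. e \<in> code_E N \<Longrightarrow> k < 6 \<Longrightarrow> ccw N (dart_at N e k) = dart_at N e (ccw_index k)"
    "\<And>e k. e \<in> code_E N \<Longrightarrow> k < 6 \<Longrightarrow> opp N (dart_at N e k) = (case opp_code p' q' e k of (e', k') \<Rightarrow> dart_at N e' k')"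
    using bicubic_code[OF N] by metis
  obtain g where g: "bij g" "relabel g (code M) = code N" using s unfolding sim_def by blast
  have p': "p' = conj_by g p" "q' = conj_by g q" "root_dart N = g (root_dart M)"
    using g(2) unfolding m(1) n(1) relabel_def by auto
  have gE: "g ` code_E M = code_E N"
    using hmaps_unique[of "code N" "g ` code_E M" "code_E N"] relabel_hmaps[OF g(1), of "code M" "code_E M"] g(2) m(1,2) n(1,2)
    by (simp add: hmaps_def)
  let ?K = "\<lambda>M. code_E M \<times> {..<6::nat}"
  define F where "F = (\<lambda>M (e, k). dart_at (M :: 'a rooted_map) e k)"
  have bM: "bij_betw (F M) (?K M) (darts M)" and bN: "bij_betw (F N) (?K N) (darts N)"
    using m(3) n(3) unfolding F_def by auto
  define G where "G = (\<lambda>(e, k::nat). (g e, k))"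
  have bG: "bij_betw G (?K M) (?K N)"
    unfolding bij_betw_def
  proof
    show "inj_on G (?K M)" using bij_is_inj[OF g(1)] by (auto simp: G_def inj_on_def inj_def)
    show "G ` ?K M = ?K N" unfolding gE[symmetric] G_def by (auto simp: image_iff)
  qed
  define f where "f = F N \<circ> G \<circ> inv_into (?K M) (F M)"
  have "bij_betw (inv_into (?K M) (F M)) (darts M) (?K M)" by (rule bij_betw_inv_into[OF bM])
  then have bf: "bij_betw f (darts M) (darts N)" unfolding f_def using bG bN by (metis bij_betw_trans comp_assoc)
  have fd: "f (dart_at M e k) = dart_at N (g e) k" if "e \<in> code_E M" "k < 6" for e k
  proof -
    have "inv_into (?K M) (F M) (F M (e, k)) = (e, k)"
      by (rule bij_betw_inv_into_left[OF bM]) (use that in simp)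
    then show ?thesis unfolding f_def F_def G_def by simp
  qed
  note D = hmapD[OF m(2)]
  have "f (ccw M d) = ccw N (f d) \<and> f (opp M d) = opp N (f d)" if d: "d \<in> darts M" for d
  proof -
    have "d \<in> F M ` ?K M" using d bM unfolding bij_betw_def by simp
    then obtain e k where ek: "e \<in> code_E M" "k < 6" "d = dart_at M e k" unfolding F_def by auto
    have ge: "g e \<in> code_E N" using gE ek(1) by blast
    obtain e' k' where o: "opp_code p q e k = (e', k')" by (metis surj_pair)
    then have "e' \<in> code_E M" "k' < 6" using opp_code_in[OF D(2,3) ek(1,2)] by auto
    moreover have "opp_code p' q' (g e) k = (g e', k')"
      unfolding p' using opp_code_conj_by[OF g(1) D(2,3)] o by simp
    ultimately show ?thesis
      unfolding ek(3) using m(4,5)[OF ek(1,2)] n(4,5)[OF ge ek(2)] fd ek(1,2) ccw_index_less[OF ek(2)] o by simp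
  qed
  moreover have "f (root_dart M) = root_dart N"
    using fd[OF D(4), of 0] p'(3) by (simp add: dart_at_def)
  ultimately show ?thesis unfolding map_iso_def using bf by blast
qed

text \<open>An isomorphism commutes with \<open>code_P\<close> and \<open>code_Q\<close> and
  preserves the root, so by minimality of joint orbits it maps \<open>code_E M\<close> onto
  \<open>code_E N\<close>.\<close>

lemma map_iso_imp_sim:
  fixes M N :: "'a rooted_map"
  assumes M: "bicubic_map M" and N: "bicubic_map N" and iso: "map_iso M N"
  shows "sim (code M) (code N)"
proof -
  obtain p q where m: "code M = (p, q, root_dart M)" "hmap (code_E M) p q (root_dart M)"
    "code_E M \<subseteq> darts M" "finite (darts M)" "\<And>d. d \<in> darts M \<Longrightarrow> ccw M d \<in> darts M" "\<And>d. d \<in> darts M \<Longrightarrow> opp M d \<in> darts M"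
    using bicubic_code[OF M] by metis
  obtain p' q' where n: "code N = (p', q', root_dart N)" "hmap (code_E N) p' q' (root_dart N)"
    using bicubic_code[OF N] by metis
  obtain f where f: "bij_betw f (darts M) (darts N)" "f (root_dart M) = root_dart N"
    "\<forall>d\<in>darts M. f (ccw M d) = ccw N (f d) \<and> f (opp M d) = opp N (f d)" using iso unfolding map_iso_def by blast
  obtain g where g: "bij g" "\<And>d. d \<in> darts M \<Longrightarrow> g d = f d" using finite_bij_extends_fun[OF m(4) f(1)] by blast
  have rM: "root_dart M \<in> darts M" using hmapD(4)[OF m(2)] m(3) by blast
  have gr: "g (root_dart M) = root_dart N" using g(2)[OF rM] f(2) by simp
  have P: "g (code_P M d) = code_P N (g d)" "g (code_Q M d) = code_Q N (g d)" if "d \<in> darts M" for d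
    using that f(3) g(2) m(5,6) unfolding code_P_def code_Q_def by simp_all
  have clM: "code_P M ` code_E M \<subseteq> code_E M" "code_Q M ` code_E M \<subseteq> code_E M" "root_dart M \<in> code_E M"
    unfolding code_E_def by (rule joint_orbit_closed joint_orbit_base)+
  have clN: "code_P N ` code_E N \<subseteq> code_E N" "code_Q N ` code_E N \<subseteq> code_E N" "root_dart N \<in> code_E N"
    unfolding code_E_def by (rule joint_orbit_closed joint_orbit_base)+
  have "code_E N \<subseteq> g ` code_E M"
    unfolding code_E_def[of N]
  proof (rule joint_orbit_least)
    show "root_dart N \<in> g ` code_E M" using gr clM(3) by (metis imageI)
    have "code_P N (g x) \<in> g ` code_E M \<and> code_Q N (g x) \<in> g ` code_E M" if x: "x \<in> code_E M" for x
    proof -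
      have xD: "x \<in> darts M" using x m(3) by blast
      have "code_P M x \<in> code_E M" "code_Q M x \<in> code_E M" using x clM by blast+
      then show ?thesis unfolding P[OF xD, symmetric] by (intro conjI imageI)
    qed
    then show "code_P N ` g ` code_E M \<subseteq> g ` code_E M" "code_Q N ` g ` code_E M \<subseteq> g ` code_E M" by blast+
  qed
  moreover have "code_E M \<subseteq> {d \<in> darts M. g d \<in> code_E N}"
    unfolding code_E_def[of M]
  proof (rule joint_orbit_least)
    have "code_P M d \<in> darts M \<and> code_Q M d \<in> darts M \<and> g (code_P M d) \<in> code_E N \<and> g (code_Q M d) \<in> code_E N"
      if d: "d \<in> darts M" "g d \<in> code_E N" for d
    proof -
      have "code_P M d \<in> darts M" "code_Q M d \<in> darts M"
        using d(1) m(5,6) unfolding code_P_def code_Q_def by simp_all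
      then show ?thesis unfolding P[OF d(1)] using clN(1,2) d(2) by blast
    qed
    then show "code_P M ` {d \<in> darts M. g d \<in> code_E N} \<subseteq> {d \<in> darts M. g d \<in> code_E N}"
      "code_Q M ` {d \<in> darts M. g d \<in> code_E N} \<subseteq> {d \<in> darts M. g d \<in> code_E N}"
      by blast+
  qed (use rM gr clN(3) in simp)
  ultimately have gE: "g ` code_E M = code_E N" by blast
  have pd: "p = perm_restrict (code_P M) (code_E M)" "q = perm_restrict (code_Q M) (code_E M)"
    "p' = perm_restrict (code_P N) (code_E N)" "q' = perm_restrict (code_Q N) (code_E N)"
    using m(1) n(1) unfolding code_def by auto
  have "conj_by g p = p'"
  proof (rule permutes_eqI)
    show "conj_by g p permutes code_E N" using conj_by_permutes[OF g(1) hmapD(2)[OF m(2)]] gE by simp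
    show "p' permutes code_E N" by (rule hmapD(2)[OF n(2)])
    fix y assume y: "y \<in> code_E N"
    then obtain x where x: "x \<in> code_E M" "y = g x" using gE by blast
    then show "conj_by g p y = p' y"
      using conj_by_apply[OF g(1), of p x] P(1)[of x] m(3) y unfolding pd perm_restrict_def by auto
  qed
  moreover have "conj_by g q = q'"
  proof (rule permutes_eqI)
    show "conj_by g q permutes code_E N" using conj_by_permutes[OF g(1) hmapD(3)[OF m(2)]] gE by simp
    show "q' permutes code_E N" by (rule hmapD(3)[OF n(2)])
    fix y assume y: "y \<in> code_E N"
    then obtain x where x: "x \<in> code_E M" "y = g x" using gE by blast
    then show "conj_by g q y = q' y"
      using conj_by_apply[OF g(1), of q x] P(2)[of x] m(3) y unfolding pd perm_restrict_def by auto
  qed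
  ultimately have "relabel g (code M) = code N" unfolding m(1) n(1) relabel_def using gr by simp
  then show ?thesis unfolding sim_def using g(1) by blast
qed

text \<open>The dart at position \<open>k\<close> of \<open>e\<close> becomes the number
  \<open>6 * e + k\<close>; vertex and face colours can then be read off from the residue modulo
  6.\<close>

definition encode :: "nat \<Rightarrow> nat hypermap \<Rightarrow> nat rooted_map" where
  "encode m = (\<lambda>(p, q, r). \<lparr>darts = {..<6 * m},
     ccw = (\<lambda>d. if d < 6 * m then 6 * (d div 6) + ccw_index (d mod 6) else d),
     opp = (\<lambda>d. if d < 6 * m then (case opp_code p q (d div 6) (d mod 6) of (e, k) \<Rightarrow> 6 * e + k) else d),
     root_dart = 6 * r\<rparr>)"

lemma opp_code_twice:
  assumes "p permutes E" "q permutes E" "k < 6"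
  shows "(case opp_code p q e k of (e', k') \<Rightarrow> opp_code p q e' k') = (e, k)" "snd (opp_code p q e k) \<noteq> k"
  using less_6_cases[OF assms(3)] permutes_inverses[OF assms(1)] permutes_inverses[OF assms(2)]
  unfolding opp_code_def by auto

lemma permutes_if_period:
  assumes "\<And>d. d \<in> D \<Longrightarrow> f d \<in> D" "\<And>d. d \<in> D \<Longrightarrow> (f ^^ Suc n) d = d" "\<And>d. d \<notin> D \<Longrightarrow> f d = d"
  shows "f permutes D"
proof (rule bij_imp_permutes)
  have i: "(f ^^ n) d \<in> D" if "d \<in> D" for d n using that assms(1) by (induction n) auto
  show "bij_betw f D D"
  proof (rule bij_betw_byWitness[where f' = "f ^^ n"])
    show "\<forall>d\<in>D. (f ^^ n) (f d) = d" using assms(2) by (simp add: funpow_swap1)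
    show "\<forall>d\<in>D. f ((f ^^ n) d) = d" using assms(2) by simp
  qed (use assms(1) i in auto)
qed (fact assms(3))

lemma encode_correct:
  assumes H: "hmap {..<m} p q r"
  shows "bicubic_map (encode m (p, q, r))" "card (vertices (encode m (p, q, r))) = 2 * m"
    "sim (p, q, r) (code (encode m (p, q, r)))"
proof -
  define M where "M = encode m (p, q, r)"
  note D = hmapD[OF H]
  have dM: "darts M = {..<6 * m}" "root_dart M = 6 * r" unfolding M_def encode_def by simp_all
  have in_d: "6 * e + k < 6 * m" if "e < m" "k < 6" for e k :: nat using that by simp
  have dk: "\<exists>e k. d = 6 * e + k \<and> e < m \<and> k < 6" if "d \<in> darts M" for d :: nat
    by (rule exI[of _ "d div 6"], rule exI[of _ "d mod 6"]) (use that dM in \<open>auto simp: less_mult_imp_div_less mult.commute\<close>)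
  have dm: "(6 * e + k) div 6 = e" "(6 * e + k) mod 6 = k" if "k < 6" for e k :: nat using that by simp_all
  have cM: "ccw M (6 * e + k) = 6 * e + ccw_index k" if "e < m" "k < 6" for e k
    unfolding M_def encode_def using in_d[OF that] dm[OF that(2)] by simp
  have tM: "opp M (6 * e + k) = (case opp_code p q e k of (e, k) \<Rightarrow> 6 * e + k)" if "e < m" "k < 6" for e k
    unfolding M_def encode_def using in_d[OF that] dm[OF that(2)] by simp
  have oc: "fst (opp_code p q e k) < m" "snd (opp_code p q e k) < 6" if "e < m" "k < 6" for e k
    using opp_code_in[OF D(2,3), of e k] that by (auto simp: mem_Times_iff)
  have outM: "ccw M d = d" "opp M d = d" if "d \<notin> darts M" for d
    using that unfolding M_def encode_def by simp_all
  have c_in: "ccw M d \<in> darts M" and t_in: "opp M d \<in> darts M" if "d \<in> darts M" for d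
  proof -
    obtain e k where ek: "d = 6 * e + k" "e < m" "k < 6" using dk[OF \<open>d \<in> darts M\<close>] by blast
    show "ccw M d \<in> darts M" unfolding ek(1) cM[OF ek(2,3)] dM using in_d[OF ek(2) ccw_index_less[OF ek(3)]] by simp
    show "opp M d \<in> darts M" unfolding ek(1) tM[OF ek(2,3)] dM using in_d[OF oc[OF ek(2,3)]] by (simp add: case_prod_unfold)
  qed
  have c3: "ccw M (ccw M (ccw M d)) = d" if "d \<in> darts M" for d
  proof -
    obtain e k where ek: "d = 6 * e + k" "e < m" "k < 6" using dk[OF \<open>d \<in> darts M\<close>] by blast
    have "ccw_index (ccw_index (ccw_index k)) = k" using less_6_cases[OF ek(3)] unfolding ccw_index_def by auto
    then show ?thesis unfolding ek(1) using cM ek(2,3) ccw_index_less by simp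
  qed
  have t2: "opp M (opp M d) = d" "opp M d \<noteq> d" if "d \<in> darts M" for d
  proof -
    obtain e k where ek: "d = 6 * e + k" "e < m" "k < 6" using dk[OF \<open>d \<in> darts M\<close>] by blast
    obtain e' k' where o: "opp_code p q e k = (e', k')" by (metis surj_pair)
    have ek': "e' < m" "k' < 6" using oc[OF ek(2,3)] o by auto
    have "opp_code p q e' k' = (e, k)" using opp_code_twice(1)[OF D(2,3) ek(3), of e] o by simp
    then show "opp M (opp M d) = d" unfolding ek(1) tM[OF ek(2,3)] o using tM[OF ek'] by simp
    have "k' \<noteq> k" using opp_code_twice(2)[OF D(2,3) ek(3), of e] o by simp
    then show "opp M d \<noteq> d" unfolding ek(1) tM[OF ek(2,3)] o using dm(2)[OF ek(3)] dm(2)[OF ek'(2)] by (metis case_prod_conv)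
  qed
  have perms: "ccw M permutes darts M" "opp M permutes darts M"
    using permutes_if_period[of "darts M" "ccw M" 2] permutes_if_period[of "darts M" "opp M" 1] c_in t_in c3 t2 outM
    by (simp_all add: numeral_2_eq_2)
  have rm: "r < m" using D(4) by simp
  have wf: "wf_map M" unfolding wf_map_def using perms t2 dM rm by simp
  \<comment> \<open>These tables list the colours that the positions 0 to 5 have in any coloured
    map.\<close>
  define blk where "blk d = (d mod 6 < (3::nat))" for d
  define col where "col d = (if d mod 6 = 0 \<or> d mod 6 = 4 then 3 else if d mod 6 = 1 \<or> d mod 6 = 3 then 2 else (1::nat))" for d :: nat
  have s6: "ccw M (6 * e) = 6 * e + 1" "ccw M (6 * e + 1) = 6 * e + 2" "ccw M (6 * e + 3) = 6 * e + 4" "ccw M (6 * e + 4) = 6 * e + 5"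
    "ccw M (6 * e + 2) = 6 * e" "ccw M (6 * e + 5) = 6 * e + 3"
    "opp M (6 * e) = 6 * e + 3" "opp M (6 * e + 3) = 6 * e" "opp M (6 * e + 4) = 6 * p e + 2" "opp M (6 * e + 1) = 6 * q e + 5" if "e < m" for e
    using cM[OF that, of 0] cM[OF that, of 1] cM[OF that, of 2] cM[OF that, of 3] cM[OF that, of 4] cM[OF that, of 5]
      tM[OF that, of 0] tM[OF that, of 1] tM[OF that, of 3] tM[OF that, of 4]
    by (simp_all add: ccw_index_def opp_code_def)
  have pm: "p e < m" "q e < m" if "e < m" for e using that permutes_in_image[OF D(2)] permutes_in_image[OF D(3)] by auto
  have PM: "code_P M (6 * e) = 6 * p e" "code_Q M (6 * e) = 6 * q e" if "e < m" for e
    unfolding code_P_def code_Q_def using s6[OF that] s6[OF pm(1)[OF that]] s6[OF pm(2)[OF that]] by simp_all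
  interpret W: dart_map M "darts M" "ccw M" "opp M" "root_dart M" by unfold_locales (fact wf)
  \<comment> \<open>Connectedness is inherited from the hypermap: the points \<open>e\<close> with
    \<open>6 * e\<close> in a closed set of darts are closed under \<open>p\<close> and
    \<open>q\<close>.\<close>
  have con: "conn (darts M) (ccw M) (opp M)"
  proof (rule conn_rootI[OF perms])
    show "finite (darts M)" "root_dart M \<in> darts M" using dM rm by simp_all
    fix A assume A: "A \<subseteq> darts M" "root_dart M \<in> A" "ccw M ` A \<subseteq> A" "opp M ` A \<subseteq> A"
    have cl: "ccw M d \<in> A" "opp M d \<in> A" if "d \<in> A" for d using A(3,4) that by auto
    have "{e \<in> {..<m}. 6 * e \<in> A} = {..<m}"
    proof (rule connD[OF D(5), of _ r])
      have "6 * p e \<in> A \<and> 6 * q e \<in> A" if "e < m" "6 * e \<in> A" for e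
      proof -
        have "code_P M (6 * e) \<in> A" "code_Q M (6 * e) \<in> A" unfolding code_P_def code_Q_def using cl that(2) by auto
        then show ?thesis using PM[OF that(1)] by simp
      qed
      then show "p ` {e \<in> {..<m}. 6 * e \<in> A} \<subseteq> {e \<in> {..<m}. 6 * e \<in> A}" "q ` {e \<in> {..<m}. 6 * e \<in> A} \<subseteq> {e \<in> {..<m}. 6 * e \<in> A}"
        using pm by auto
    qed (use A(2) dM rm in auto)
    then have e6: "6 * e \<in> A" if "e < m" for e using that by blast
    have "d \<in> A" if "d \<in> darts M" for d
    proof -
      obtain e k where ek: "d = 6 * e + k" "e < m" "k < 6" using dk[OF \<open>d \<in> darts M\<close>] by blast
      note s = s6[OF ek(2)]
      have 1: "6 * e + 1 \<in> A" using cl(1)[OF e6[OF ek(2)]] s by simp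
      have 2: "6 * e + 2 \<in> A" using cl(1)[OF 1] s by simp
      have 3: "6 * e + 3 \<in> A" using cl(2)[OF e6[OF ek(2)]] s by simp
      have 4: "6 * e + 4 \<in> A" using cl(1)[OF 3] s by simp
      have 5: "6 * e + 5 \<in> A" using cl(1)[OF 4] s by simp
      show ?thesis unfolding ek(1) using less_6_cases[OF ek(3)] 1 2 3 4 5 e6[OF ek(2)] by (elim disjE) simp_all
    qed
    then show "A = darts M" using A(1) by blast
  qed
  have bc: "blk (6 * e + k) = (k < 3)" "col (6 * e + k) = (if k = 0 \<or> k = 4 then 3 else if k = 1 \<or> k = 3 then 2 else 1)"
    if "k < 6" for e k
    unfolding blk_def col_def dm[OF that] by simp_all
  interpret C: coloured_map M "darts M" "ccw M" "opp M" "root_dart M" blk col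
  proof
    show "conn (darts M) (ccw M) (opp M)" by (rule con)
    show "ccw M (ccw M (ccw M d)) = d" if "d \<in> darts M" for d by (rule c3[OF that])
    show "blk (root_dart M)" "col (root_dart M) = 3" unfolding dM blk_def col_def by simp_all
    fix d assume "d \<in> darts M"
    then obtain e k where ek: "d = 6 * e + k" "e < m" "k < 6" using dk by blast
    obtain e' k' where o: "opp_code p q e k = (e', k')" by (metis surj_pair)
    have ek': "k' < 6" using oc[OF ek(2,3)] o by auto
    have k': "k' = (if k = 0 then 3 else if k = 1 then 5 else if k = 2 then 4 else if k = 3 then 0 else if k = 4 then 2 else 1)"
      using o unfolding opp_code_def by (auto split: if_splits)
    have ct: "ccw M d = 6 * e + ccw_index k" "opp M d = 6 * e' + k'"
      unfolding ek(1) cM[OF ek(2,3)] tM[OF ek(2,3)] o by simp_all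
    note b = bc[OF ek(3), of e] bc[OF ccw_index_less[OF ek(3)], of e] bc[OF ek', of e']
    show "blk (ccw M d) = blk d" "blk (opp M d) = (\<not> blk d)" "col d \<in> {1, 2, 3}"
      "col (ccw M d) = (if blk d then prv (col d) else nxt (col d))" "col (opp M d) = col (ccw M d)"
      unfolding ct unfolding ek(1) b using less_6_cases[OF ek(3)] k'
      by (elim disjE; simp add: ccw_index_def prv_def nxt_def)+
  qed
  have EM: "C.E = (\<lambda>e. 6 * e) ` {..<m}"
  proof
    show "(\<lambda>e. 6 * e) ` {..<m} \<subseteq> C.E" unfolding C.E_def dM blk_def col_def by auto
    show "C.E \<subseteq> (\<lambda>e. 6 * e) ` {..<m}"
    proof
      fix d assume d: "d \<in> C.E"
      then obtain e k where ek: "d = 6 * e + k" "e < m" "k < 6" using dk[of d] unfolding C.E_def by blast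
      have "blk d" "col d = 3" using d unfolding C.E_def by auto
      then have "k = 0" unfolding ek(1) bc[OF ek(3)] by (auto split: if_splits)
      then show "d \<in> (\<lambda>e. 6 * e) ` {..<m}" using ek by simp
    qed
  qed
  have b6: "bij_betw (\<lambda>e. 6 * e) {..<m} C.E" unfolding EM by (auto simp: bij_betw_def inj_on_def)
  obtain g where g: "bij g" "\<And>e. e \<in> {..<m} \<Longrightarrow> g e = 6 * e" using finite_bij_extends_fun[OF finite_lessThan b6] by blast
  have gE: "g ` {..<m} = C.E" unfolding EM using g(2) by (rule image_cong[OF refl])
  have "conj_by g p = C.p"
  proof (rule permutes_eqI[OF _ C.pE])
    show "conj_by g p permutes C.E" using conj_by_permutes[OF g(1) D(2)] gE by simp
    fix y assume y: "y \<in> C.E"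
    then obtain e where e: "e < m" "y = g e" using gE by blast
    then show "conj_by g p y = C.p y"
      using conj_by_apply[OF g(1), of p e] C.p_apply[OF y] PM(1)[OF e(1)] g(2) pm[OF e(1)] unfolding C.P_code by simp
  qed
  moreover have "conj_by g q = C.q"
  proof (rule permutes_eqI[OF _ C.qE])
    show "conj_by g q permutes C.E" using conj_by_permutes[OF g(1) D(3)] gE by simp
    fix y assume y: "y \<in> C.E"
    then obtain e where e: "e < m" "y = g e" using gE by blast
    then show "conj_by g q y = C.q y"
      using conj_by_apply[OF g(1), of q e] C.q_apply[OF y] PM(2)[OF e(1)] g(2) pm[OF e(1)] unfolding C.Q_code by simp
  qed
  moreover have "g r = root_dart M" using g(2) rm dM by simp
  ultimately have rel: "relabel g (p, q, r) = (C.p, C.q, root_dart M)" by (simp add: relabel_def)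
  then show "sim (p, q, r) (code (encode m (p, q, r)))"
    unfolding sim_def M_def[symmetric] C.pqr_code[symmetric] using g(1) by blast
  \<comment> \<open>The code of the new map is a relabelling of the given hypermap, whose planarity
    thus yields Euler's formula for the map.\<close>
  have "hmap C.E C.p C.q (root_dart M)"
    using hmap_conj_by(1)[OF g(1) H] rel gE unfolding relabel_def by simp
  then show "bicubic_map (encode m (p, q, r))" unfolding M_def[symmetric] C.bicubic_iff by (rule hmapD(6))
  have "card C.E = m" using bij_betw_same_card[OF b6] by simp
  then show "card (vertices (encode m (p, q, r))) = 2 * m" unfolding M_def[symmetric] C.card_vertices by simp
qed

section \<open>Counting classes of bicubic maps\<close>

lemma map_iso_iff_sim:
  "bicubic_map M \<Longrightarrow> bicubic_map N \<Longrightarrow> map_iso M N \<longleftrightarrow> sim (code M) (code N)" for M N :: "'a rooted_map"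
  using map_iso_imp_sim sim_imp_map_iso by blast

definition map_class :: "nat \<Rightarrow> nat hypermap \<Rightarrow> nat rooted_map set" where
  "map_class m H = {M \<in> labelled_bicubic_maps (2 * m). sim H (code M)}"

lemma code_in_hmaps: "bicubic_map M \<Longrightarrow> code M \<in> hmaps (code_E M)"
  by (erule bicubic_code) (simp add: hmaps_def)

lemma encode_in_class:
  assumes "H \<in> hmaps {..<m}" shows "encode m H \<in> map_class m H"
  using assms encode_correct by (auto simp: map_class_def hmaps_def labelled_bicubic_maps_def)

lemma map_class_eq_iff:
  assumes "H \<in> hmaps {..<m}" "H' \<in> hmaps {..<m}"
  shows "map_class m H = map_class m H' \<longleftrightarrow> sim H H'"
proof
  assume "map_class m H = map_class m H'"
  then have "sim H (code (encode m H'))" "sim H' (code (encode m H'))"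
    using encode_in_class[OF assms(2)] unfolding map_class_def by blast+
  then show "sim H H'" using sim_trans sim_sym by blast
next
  assume "sim H H'"
  then have "sim H K \<longleftrightarrow> sim H' K" for K using sim_trans sim_sym by blast
  then show "map_class m H = map_class m H'" unfolding map_class_def by simp
qed

lemma map_class_quotient:
  assumes H: "H \<in> hmaps {..<m}" shows "map_class m H \<in> bicubic_maps (2 * m)"
  unfolding bicubic_maps_def
proof (rule quotientI[THEN back_subst[of "\<lambda>X. X \<in> _"]])
  let ?M = "encode m H"
  have M: "?M \<in> labelled_bicubic_maps (2 * m)" "sim H (code ?M)"
    using encode_in_class[OF H] unfolding map_class_def by auto
  show "?M \<in> labelled_bicubic_maps (2 * m)" by (rule M(1))
  have "map_iso ?M N \<longleftrightarrow> sim H (code N)" if "N \<in> labelled_bicubic_maps (2 * m)" for N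
    using map_iso_iff_sim[of ?M N] that M sim_trans sim_sym unfolding labelled_bicubic_maps_def by blast
  then show "{(M, N). M \<in> labelled_bicubic_maps (2 * m) \<and> N \<in> labelled_bicubic_maps (2 * m) \<and> map_iso M N} `` {?M} = map_class m H"
    using M(1) unfolding map_class_def by auto
qed

lemma map_class_stats:
  assumes H: "(p, q, r) \<in> hmaps {..<m}"
  shows "a_num (map_class m (p, q, r)) = ast p q r" "c_num (map_class m (p, q, r)) = cst p q r"
proof -
  have st: "a_stat M = ast p q r \<and> c_stat M = cst p q r" if M: "M \<in> map_class m (p, q, r)" for M
  proof -
    have b: "bicubic_map M" "sim (p, q, r) (code M)" using M unfolding map_class_def labelled_bicubic_maps_def by auto
    obtain p' q' where c: "code M = (p', q', root_dart M)" "a_stat M = ast p' q' (root_dart M)" "c_stat M = cst p' q' (root_dart M)"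
      using bicubic_code[OF b(1)] by metis
    show ?thesis using sim_stats[OF b(2)[unfolded c(1)] H] c(2,3) by simp
  qed
  have ne: "map_class m (p, q, r) \<noteq> {}" using encode_in_class[OF H] by blast
  have "a_stat ` map_class m (p, q, r) = {ast p q r}" "c_stat ` map_class m (p, q, r) = {cst p q r}"
    using st ne by (auto simp: image_iff)
  then show "a_num (map_class m (p, q, r)) = ast p q r" "c_num (map_class m (p, q, r)) = cst p q r"
    unfolding a_num_def c_num_def by simp_all
qed

text \<open>Black and white vertices are equally many, so \<open>n\<close> is even; the code is
  moved to the labels below \<open>m\<close>.\<close>

lemma map_class_surj:
  assumes X: "X \<in> bicubic_maps n"
  obtains m H where "n = 2 * m" "H \<in> hmaps {..<m}" "X = map_class m H"
proof -
  obtain M where M: "M \<in> labelled_bicubic_maps n"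
    "X = {(M, N). M \<in> labelled_bicubic_maps n \<and> N \<in> labelled_bicubic_maps n \<and> map_iso M N} `` {M}"
    using X unfolding bicubic_maps_def by (rule quotientE)
  have b: "bicubic_map M" "card (vertices M) = n" using M(1) unfolding labelled_bicubic_maps_def by auto
  define m where "m = card (code_E M)"
  have n: "n = 2 * m" using bicubic_code[OF b(1)] b(2) m_def by metis
  have hM: "code M \<in> hmaps (code_E M)" by (rule code_in_hmaps[OF b(1)])
  have fin: "finite (code_E M)" using hM by (auto simp: hmaps_def hmap_def)
  have "card (code_E M) = card {..<m}" by (simp add: m_def)
  obtain g :: "nat \<Rightarrow> nat" where g: "bij g" "g ` code_E M = {..<m}"
    using finite_bij_extends[OF fin finite_lessThan \<open>card (code_E M) = card {..<m}\<close>] .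
  define H where "H = relabel g (code M)"
  have H: "H \<in> hmaps {..<m}" unfolding H_def using relabel_hmaps[OF g(1) hM] g(2) by simp
  have s: "sim (code M) H" unfolding sim_def H_def using g(1) by blast
  have "map_iso M N \<longleftrightarrow> sim H (code N)" if "N \<in> labelled_bicubic_maps n" for N
    using map_iso_iff_sim[OF b(1)] that s sim_trans sim_sym unfolding labelled_bicubic_maps_def by blast
  then have "X = map_class m H" unfolding M(2) map_class_def n[symmetric] using M(1) by auto
  with n H show thesis by (rule that)
qed

lemma bicubic_maps_eq: "bicubic_maps (2 * m) = map_class m ` hmaps {..<m}"
proof
  show "bicubic_maps (2 * m) \<subseteq> map_class m ` hmaps {..<m}"
  proof
    fix X assume "X \<in> bicubic_maps (2 * m)"
    then obtain k H where "2 * m = 2 * k" "H \<in> hmaps {..<k}" "X = map_class k H" by (rule map_class_surj)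
    then show "X \<in> map_class m ` hmaps {..<m}" by simp
  qed
qed (use map_class_quotient in blast)

lemma finite_bicubic_maps: "finite (bicubic_maps n)"
proof (cases "bicubic_maps n = {}")
  case False
  then obtain X where "X \<in> bicubic_maps n" by blast
  then obtain m H where n: "n = 2 * m" by (rule map_class_surj)
  show ?thesis unfolding n bicubic_maps_eq by (rule finite_imageI[OF finite_hmaps[OF finite_lessThan]])
qed simp

text \<open>By rigidity every class contains exactly \<open>fact m\<close> labelled hypermaps, so
  sorting these by class relates labelled to unlabelled counts.\<close>

lemma card_labelled:
  "fact m * card {X \<in> bicubic_maps (2 * m). a_num X = i \<and> c_num X = j} =
   card {(p, q, r) \<in> hmaps {..<m}. ast p q r = i \<and> cst p q r = j}"
proof -
  define T where "T = {X \<in> bicubic_maps (2 * m). a_num X = i \<and> c_num X = j}"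
  define S where "S = {(p, q, r) \<in> hmaps {..<m}. ast p q r = i \<and> cst p q r = j}"
  have fS: "finite S" unfolding S_def by (rule finite_subset[OF _ finite_hmaps[of "{..<m}"]]) auto
  have fT: "finite T" unfolding T_def using finite_bicubic_maps by simp
  have S_iff: "H \<in> S \<longleftrightarrow> H \<in> hmaps {..<m} \<and> map_class m H \<in> T" for H
    using map_class_stats map_class_quotient unfolding S_def T_def by (cases H) auto
  have fib: "(\<Sum>H\<in>{H \<in> S. map_class m H = X}. 1) = (fact m :: nat)" if X: "X \<in> T" for X
  proof -
    obtain H0 where H0: "H0 \<in> hmaps {..<m}" "X = map_class m H0" using X bicubic_maps_eq unfolding T_def by auto
    have "{H \<in> S. map_class m H = X} = {H \<in> hmaps {..<m}. sim H H0}"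
    proof (rule set_eqI)
      fix H
      show "H \<in> {H \<in> S. map_class m H = X} \<longleftrightarrow> H \<in> {H \<in> hmaps {..<m}. sim H H0}"
      proof (cases "H \<in> hmaps {..<m}")
        case True
        have "map_class m H = X \<longleftrightarrow> sim H H0" unfolding H0(2) by (rule map_class_eq_iff[OF True H0(1)])
        then show ?thesis using S_iff[of H] X True by auto
      qed (simp add: S_iff)
    qed
    then show ?thesis using card_sim_class[OF H0(1)] by simp
  qed
  have "map_class m ` S \<subseteq> T" by (rule image_subsetI) (simp add: S_iff)
  from sum.group[OF fS fT this, of "\<lambda>_. 1 :: nat"] have "card S = (\<Sum>X\<in>T. \<Sum>H\<in>{H \<in> S. map_class m H = X}. 1)" by simp
  also have "\<dots> = (\<Sum>X\<in>T. fact m)" by (rule sum.cong[OF refl fib])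
  finally show ?thesis unfolding S_def T_def by simp
qed

lemma bicubic_maps_equidistributed:
  "card {M \<in> bicubic_maps n. a_num M = i \<and> c_num M = j} = card {M \<in> bicubic_maps n. c_num M = i \<and> a_num M = j}"
proof (cases "bicubic_maps n = {}")
  case False
  then obtain X where "X \<in> bicubic_maps n" by blast
  then obtain m H where n: "n = 2 * m" by (rule map_class_surj)
  have "fact m * card {M \<in> bicubic_maps n. a_num M = i \<and> c_num M = j} =
      card {(p, q, r) \<in> hmaps {..<m}. ast p q r = i \<and> cst p q r = j}"
    unfolding n by (rule card_labelled)
  also have "\<dots> = card {(p, q, r) \<in> hmaps {..<m}. cst p q r = i \<and> ast p q r = j}" by (rule hmaps_equidistributed)
  also have "{(p, q, r) \<in> hmaps {..<m}. cst p q r = i \<and> ast p q r = j} = {(p, q, r) \<in> hmaps {..<m}. ast p q r = j \<and> cst p q r = i}"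
    by auto
  also have "card \<dots> = fact m * card {M \<in> bicubic_maps n. a_num M = j \<and> c_num M = i}"
    unfolding n by (rule card_labelled[symmetric])
  finally have "card {M \<in> bicubic_maps n. a_num M = i \<and> c_num M = j} = card {M \<in> bicubic_maps n. a_num M = j \<and> c_num M = i}" by simp
  also have "{M \<in> bicubic_maps n. a_num M = j \<and> c_num M = i} = {M \<in> bicubic_maps n. c_num M = i \<and> a_num M = j}" by auto
  finally show ?thesis .
\<comment> \<open>Without maps, as for odd \<open>n\<close>, both sets are empty.\<close>
qed simp

theorem theorem2:
  fixes n :: nat and x y :: "'a::comm_semiring_1"
  assumes "n > 0"
  shows "(\<Sum>M\<in>bicubic_maps n. x ^ a_num M * y ^ c_num M) =
           (\<Sum>M\<in>bicubic_maps n. x ^ c_num M * y ^ a_num M) \<and>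
         (\<forall>i j. card {M \<in> bicubic_maps n. a_num M = i \<and> c_num M = j} =
                card {M \<in> bicubic_maps n. c_num M = i \<and> a_num M = j})"
proof (intro conjI allI bicubic_maps_equidistributed)
  let ?T = "bicubic_maps n"
  \<comment> \<open>All values of either statistic, so that one finite index set serves both
    sums.\<close>
  let ?I = "a_num ` ?T \<union> c_num ` ?T"
  have fin: "finite ?T" "finite (?I \<times> ?I)" using finite_bicubic_maps by simp_all
  \<comment> \<open>Sorting the sum by the values of the two statistics makes the counts its
    coefficients, in any commutative semiring.\<close>
  have expand: "(\<Sum>M\<in>?T. x ^ u M * y ^ v M) =
      (\<Sum>kl\<in>?I \<times> ?I. of_nat (card {M \<in> ?T. u M = fst kl \<and> v M = snd kl}) * (x ^ fst kl * y ^ snd kl))"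
    if "u ` ?T \<subseteq> ?I" "v ` ?T \<subseteq> ?I" for u v
  proof -
    have "(\<lambda>M. (u M, v M)) ` ?T \<subseteq> ?I \<times> ?I" using that by auto
    from sum.group[OF fin this, of "\<lambda>M. x ^ u M * y ^ v M"]
    have "(\<Sum>M\<in>?T. x ^ u M * y ^ v M) = (\<Sum>kl\<in>?I \<times> ?I. \<Sum>M\<in>{M \<in> ?T. (u M, v M) = kl}. x ^ u M * y ^ v M)" ..
    also have "\<dots> = (\<Sum>kl\<in>?I \<times> ?I. of_nat (card {M \<in> ?T. u M = fst kl \<and> v M = snd kl}) * (x ^ fst kl * y ^ snd kl))"
    proof (rule sum.cong[OF refl])
      fix kl :: "nat \<times> nat"
      have "(\<Sum>M\<in>{M \<in> ?T. (u M, v M) = kl}. x ^ u M * y ^ v M) = (\<Sum>M\<in>{M \<in> ?T. u M = fst kl \<and> v M = snd kl}. x ^ fst kl * y ^ snd kl)"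
        by (rule sum.cong) auto
      then show "(\<Sum>M\<in>{M \<in> ?T. (u M, v M) = kl}. x ^ u M * y ^ v M) =
          of_nat (card {M \<in> ?T. u M = fst kl \<and> v M = snd kl}) * (x ^ fst kl * y ^ snd kl)" by simp
    qed
    finally show ?thesis .
  qed
  show "(\<Sum>M\<in>?T. x ^ a_num M * y ^ c_num M) = (\<Sum>M\<in>?T. x ^ c_num M * y ^ a_num M)"
    using expand[of a_num c_num] expand[of c_num a_num] bicubic_maps_equidistributed by simp
qed

end
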